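(* Let $F$ be the distribution function of a non-negative random variable $W$ with $\nu=\mathbb{E}[W^2]/\mathbb{E}[W]=1$, and suppose there exist $\tau>4$ and a constant $c_F>0$ such that, for all large enough $x\ge 0$, $$1-F(x)\le c_F x^{-(\tau-1)}.$$ Let $w_j=[1-F]^{-1}(j/n)$ for $j\in[n]$, and let $\tilde{\boldsymbol w}=(\tilde w_j)_{j\in[n]}$ with $\tilde w_j=(1+\varepsilon_n)w_j$, where $(\varepsilon_n)_{n\ge1}$ is a fixed real sequence such that $|\varepsilon_n|\le \Lambda n^{-1/3}$ for some $\Lambda>0$. Then there exists a constant $b=b(\Lambda)>0$ such that for all $\omega>1$ and for $n$ sufficiently large, the random graph $\mathrm{NR}_n(\tilde{\boldsymbol w})$ satisfies $$\mathbb{P}\Big(\omega^{-1}n^{2/3}\le |\mathcal{C}_{\max}|\le \omega n^{2/3}\Big)\ge 1-\frac{b}{\omega}.$$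
   Context: $[n]=\{1,\dots,n\}$. The generalized inverse is $[1-F]^{-1}(u)=\inf\{s: 1-F(s)\le u\}$ for $u\in(0,1)$, with the convention $[1-F]^{-1}(1)=0$. Norros--Reittu random graph: for non-negative vertex weights $\boldsymbol v=(v_j)_{j\in[n]}$ with total weight $L_n=\sum_{j=1}^n v_j>0$, $\mathrm{NR}_n(\boldsymbol v)$ is the random graph on vertex set $[n]$ in which the edges $ij$, $1\le i<j\le n$, are present independently, edge $ij$ being present with probability $1-e^{-v_iv_j/L_n}$. For $v\in[n]$, $\mathcal{C}(v)$ is the set of vertices connected to $v$ by a path of present edges (including $v$ itself), and $|\mathcal{C}_{\max}|=\max_{v\in[n]}|\mathcal{C}(v)|$. The distribution function $F$ is fixed, so constants may depend on $F$. *)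

theory Defs
  imports "HOL-Probability.Probability"
begin

text \<open>The generalized inverse of \<open>1 - F\<close> on \<open>(0,1]\<close>. At \<open>u = 1\<close> the infimum would range
  over a set that is unbounded below, so the value there is fixed to be \<open>0\<close>.\<close>

definition tail_inverse :: "(real \<Rightarrow> real) \<Rightarrow> real \<Rightarrow> real" where
  "tail_inverse F u = (if u = 1 then 0 else Inf {s. 1 - F s \<le> u})"

definition weight :: "(real \<Rightarrow> real) \<Rightarrow> nat \<Rightarrow> nat \<Rightarrow> real" where
  "weight F n j = tail_inverse F (real j / real n)"

definition vertex_pairs :: "nat \<Rightarrow> (nat \<times> nat) set" where
  "vertex_pairs n = {(i, j). i \<in> {1..n} \<and> j \<in> {1..n} \<and> i < j}"

definition total_weight :: "nat \<Rightarrow> (nat \<Rightarrow> real) \<Rightarrow> real" where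
  "total_weight n v = (\<Sum>j = 1..n. v j)"

text \<open>A graph on \<open>{1..n}\<close> is given by its edge set, the edge \<open>ij\<close> with \<open>i < j\<close> being the
  pair \<open>(i, j)\<close>. The definition is meaningful for non-negative weights with positive total
  weight; only then is the argument of \<^const>\<open>bernoulli_pmf\<close> known to lie in \<open>[0,1]\<close>
  and the division by the total weight to be proper.\<close>

definition norros_reittu :: "nat \<Rightarrow> (nat \<Rightarrow> real) \<Rightarrow> (nat \<times> nat) set pmf" where
  "norros_reittu n v =
     map_pmf (\<lambda>present. {e \<in> vertex_pairs n. present e})
       (Pi_pmf (vertex_pairs n) False
         (\<lambda>(i, j). bernoulli_pmf (1 - exp (- (v i * v j / total_weight n v)))))"

definition cluster :: "nat \<Rightarrow> (nat \<times> nat) set \<Rightarrow> nat \<Rightarrow> nat set" where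
  "cluster n E v = {x \<in> {1..n}. (v, x) \<in> (E \<union> E\<inverse>)\<^sup>*}"

definition max_cluster_size :: "nat \<Rightarrow> (nat \<times> nat) set \<Rightarrow> nat" where
  "max_cluster_size n E = Max ((\<lambda>v. card (cluster n E v)) ` {1..n})"

end

theory Submission
  imports Defs "HOL-Real_Asymp.Real_Asymp"
begin

text \<open>
  Explore a cluster vertex by vertex. If a function of the explored and the active vertices is a
  submartingale (supermartingale) for one exploration step, its expectation at the end bounds its
  initial value. Products over vertices of \<open>exp (\<plusminus> (h j + \<eta> * x j))\<close> are of this kind as soon as a
  single scalar inequality holds, so the generating function of the size of a cluster is controlled
  without any comparison with a branching process.

  With \<open>h\<close> of order \<open>n powr (- 2 / 3)\<close> and \<open>\<eta>\<close> of order \<open>n powr (- 1 / 3)\<close> this shows that on average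
  at most \<open>O (n powr (2 / 3))\<close> vertices lie in clusters larger than \<open>n powr (2 / 3)\<close>, and Markov's
  inequality gives the upper bound. For the lower bound, the weights are decreased by a factor
  \<open>1 - \<kappa>\<close> with \<open>\<kappa>\<close> of order \<open>sqrt \<omega> * n powr (- 1 / 3)\<close>. In this subcritical graph the mean cluster
  size is of order \<open>1 / \<kappa>\<close>, clusters smaller than a small multiple of \<open>1 / \<kappa>\<^sup>2\<close> contribute only a small
  fraction of it, and third moments are at most of order \<open>1 / \<kappa>^5\<close>. Hence the sum of
  the cluster sizes of all vertices that lie in larger clusters has mean of order \<open>n / \<kappa>\<close> and variance
  at most of order \<open>n / \<kappa>^5\<close>, and Chebyshev's inequality bounds the probability that it vanishes by a
  constant over \<open>n * \<kappa>^3\<close>.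
\<close>

section \<open>Random subsets\<close>

text \<open>A second moment argument needs third moments of cluster sizes. They are taken from an
  exponential moment, which requires a drift: if the second power sum of the weights is at most
  \<open>1 - \<kappa> / 2\<close> times the first, a gain linear in \<open>\<eta>\<close> pays for
  the quadratic error. This is why the lower bound passes to smaller weights; containing a large
  cluster is an increasing event, so the result carries over to the original graph. At criticality
  there is no drift, and only the bounded functional \<open>1 - exp (- h * k)\<close> of the cluster
  size \<open>k\<close> is estimated. There the second-order term, \<open>\<eta>\<^sup>2\<close>
  times the third power sum, has to pay for \<open>h\<close> and for the deviation from criticality,
  so \<open>h\<close> is of order \<open>\<eta>\<^sup>2\<close>; with \<open>\<eta>\<close> and the
  deviation of order \<open>n powr (- 1 / 3)\<close> all terms balance. With
  \<open>n * \<kappa> ^ 3 = K ^ 3\<close> and \<open>K\<close> of order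
  \<open>sqrt \<omega>\<close>, the bound for the failure of the lower estimate is of order
  \<open>\<omega> powr (- 3 / 2)\<close>, so the rate \<open>1 / \<omega>\<close> stems from the
  upper estimate.\<close>

definition subset_expectation :: "'a set \<Rightarrow> ('a \<Rightarrow> real) \<Rightarrow> ('a set \<Rightarrow> real) \<Rightarrow> real" where
  "subset_expectation I p g =
     (\<Sum>X\<in>Pow I. (\<Prod>x\<in>X. p x) * (\<Prod>x\<in>I - X. 1 - p x) * g X)"

lemma subset_expectation_empty [simp]: "subset_expectation {} p g = g {}"
  by (simp add: subset_expectation_def)

text \<open>Conditioning on whether \<open>x\<close> is chosen. The independence of the elements is
  contained in this recursion, to which the inductions over \<open>I\<close> in this section
  reduce.\<close>

lemma subset_expectation_insert:
  assumes "finite I" "x \<notin> I"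
  shows "subset_expectation (insert x I) p g =
    p x * subset_expectation I p (\<lambda>X. g (insert x X)) + (1 - p x) * subset_expectation I p g"
proof -
  let ?t = "\<lambda>I X. (\<Prod>x\<in>X. p x) * (\<Prod>x\<in>I - X. 1 - p x)"
  have inj: "inj_on (insert x) (Pow I)"
    using assms by (auto simp: inj_on_def)
  have "subset_expectation (insert x I) p g =
      (\<Sum>X\<in>Pow I. ?t (insert x I) X * g X) + (\<Sum>X\<in>insert x ` Pow I. ?t (insert x I) X * g X)"
    unfolding subset_expectation_def Pow_insert
    by (rule sum.union_disjoint) (use assms in auto)
  also have "(\<Sum>X\<in>insert x ` Pow I. ?t (insert x I) X * g X) =
      (\<Sum>X\<in>Pow I. ?t (insert x I) (insert x X) * g (insert x X))"
    by (subst sum.reindex[OF inj]) simp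
  also have "\<dots> = (\<Sum>X\<in>Pow I. p x * (?t I X * g (insert x X)))"
  proof (rule sum.cong)
    fix X assume "X \<in> Pow I"
    then have "finite X" "x \<notin> X" "insert x I - insert x X = I - X"
      using assms by (auto dest: finite_subset)
    then show "?t (insert x I) (insert x X) * g (insert x X) = p x * (?t I X * g (insert x X))"
      by simp
  qed simp
  also have "(\<Sum>X\<in>Pow I. ?t (insert x I) X * g X) = (\<Sum>X\<in>Pow I. (1 - p x) * (?t I X * g X))"
  proof (rule sum.cong)
    fix X assume "X \<in> Pow I"
    then have "finite (I - X)" "x \<notin> I - X" "insert x I - X = insert x (I - X)"
      using assms by auto
    then show "?t (insert x I) X * g X = (1 - p x) * (?t I X * g X)"
      by simp
  qed simp
  finally show ?thesis
    by (simp add: subset_expectation_def sum_distrib_left)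
qed

lemma subset_expectation_add:
  "subset_expectation I p (\<lambda>X. g X + h X) = subset_expectation I p g + subset_expectation I p h"
  by (simp add: subset_expectation_def distrib_left sum.distrib)

lemma subset_expectation_diff:
  "subset_expectation I p (\<lambda>X. g X - h X) = subset_expectation I p g - subset_expectation I p h"
  by (simp add: subset_expectation_def right_diff_distrib sum_subtractf)

lemma subset_expectation_minus:
  "subset_expectation I p (\<lambda>X. - g X) = - subset_expectation I p g"
  by (simp add: subset_expectation_def sum_negf)

lemma subset_expectation_cmult:
  "subset_expectation I p (\<lambda>X. c * g X) = c * subset_expectation I p g"
  by (simp add: subset_expectation_def sum_distrib_left mult_ac)

lemma subset_expectation_multc:
  "subset_expectation I p (\<lambda>X. g X * c) = subset_expectation I p g * c"
  using subset_expectation_cmult[of I p c g] by (simp add: mult.commute)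

lemma subset_expectation_sum:
  "subset_expectation I p (\<lambda>X. \<Sum>a\<in>A. g a X) = (\<Sum>a\<in>A. subset_expectation I p (g a))"
  unfolding subset_expectation_def sum_distrib_left by (rule sum.swap)

lemma subset_expectation_cong:
  assumes "\<And>X. X \<subseteq> I \<Longrightarrow> g X = h X"
  shows "subset_expectation I p g = subset_expectation I p h"
  unfolding subset_expectation_def using assms by (intro sum.cong) auto

lemma subset_expectation_const:
  assumes "finite I"
  shows "subset_expectation I p (\<lambda>_. c) = c"
  using assms by (induction I) (simp_all add: subset_expectation_insert algebra_simps)

lemma subset_expectation_mono:
  assumes "\<And>x. x \<in> I \<Longrightarrow> 0 \<le> p x \<and> p x \<le> 1" "\<And>X. X \<subseteq> I \<Longrightarrow> g X \<le> h X"
  shows "subset_expectation I p g \<le> subset_expectation I p h"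
  unfolding subset_expectation_def
  by (intro sum_mono mult_left_mono mult_nonneg_nonneg prod_nonneg) (use assms in auto)

lemma subset_expectation_nonneg:
  assumes "\<And>x. x \<in> I \<Longrightarrow> 0 \<le> p x \<and> p x \<le> 1" "\<And>X. X \<subseteq> I \<Longrightarrow> 0 \<le> g X"
  shows "0 \<le> subset_expectation I p g"
  unfolding subset_expectation_def
  by (intro sum_nonneg mult_nonneg_nonneg prod_nonneg) (use assms in auto)

lemma subset_expectation_Un:
  assumes "finite I" "finite J" "I \<inter> J = {}"
  shows "subset_expectation (I \<union> J) p g =
    subset_expectation I p (\<lambda>X. subset_expectation J p (\<lambda>Y. g (X \<union> Y)))"
  using assms(1,3)
proof (induction I arbitrary: g)
  case (insert x I)
  then have "subset_expectation (insert x I \<union> J) p g =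
      p x * subset_expectation (I \<union> J) p (\<lambda>X. g (insert x X)) +
      (1 - p x) * subset_expectation (I \<union> J) p g"
    using assms(2) by (simp add: subset_expectation_insert)
  with insert show ?case
    by (simp add: subset_expectation_insert)
qed simp

lemma subset_expectation_prod:
  assumes "finite I"
  shows "subset_expectation I p (\<lambda>X. \<Prod>x\<in>X. f x) = (\<Prod>x\<in>I. 1 - p x + p x * f x)"
  using assms
proof (induction I)
  case (insert x I)
  have "subset_expectation I p (\<lambda>X. \<Prod>y\<in>insert x X. f y) =
      subset_expectation I p (\<lambda>X. f x * (\<Prod>y\<in>X. f y))"
  proof (rule subset_expectation_cong)
    fix X assume "X \<subseteq> I"
    then have "finite X" "x \<notin> X"
      using insert by (auto dest: finite_subset)
    then show "(\<Prod>y\<in>insert x X. f y) = f x * (\<Prod>y\<in>X. f y)"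
      by simp
  qed
  with insert show ?case
    by (simp add: subset_expectation_insert subset_expectation_cmult algebra_simps)
qed simp

lemma subset_expectation_setsum:
  assumes "finite I"
  shows "subset_expectation I p (\<lambda>X. \<Sum>x\<in>X. f x) = (\<Sum>x\<in>I. p x * f x)"
  using assms
proof (induction I)
  case (insert x I)
  have "subset_expectation I p (\<lambda>X. \<Sum>y\<in>insert x X. f y) =
      subset_expectation I p (\<lambda>X. f x + (\<Sum>y\<in>X. f y))"
  proof (rule subset_expectation_cong)
    fix X assume "X \<subseteq> I"
    then have "finite X" "x \<notin> X"
      using insert by (auto dest: finite_subset)
    then show "(\<Sum>y\<in>insert x X. f y) = f x + (\<Sum>y\<in>X. f y)"
      by simp
  qed
  with insert show ?case
    by (simp add: subset_expectation_insert subset_expectation_add subset_expectation_const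
        algebra_simps)
qed simp

text \<open>The expectation is affine in each single \<open>p x\<close>, and its slope is the mean
  of \<open>g (insert x X) - g X\<close>, which is non-negative for increasing \<open>g\<close>.
  Raising the probabilities one element at a time takes the place of a monotone coupling.\<close>

lemma subset_expectation_mono_prob:
  assumes "finite I" "\<And>x. x \<in> I \<Longrightarrow> 0 \<le> p x \<and> p x \<le> q x \<and> q x \<le> 1"
    and "\<And>X Y. X \<subseteq> Y \<Longrightarrow> Y \<subseteq> I \<Longrightarrow> g X \<le> g Y"
  shows "subset_expectation I p g \<le> subset_expectation I q g"
  using assms
proof (induction I arbitrary: g)
  case (insert x I)
  let ?a = "subset_expectation I p (\<lambda>X. g (insert x X))"
  let ?b = "subset_expectation I p g"
  have ba: "?b \<le> ?a"
    using insert.hyps insert.prems by (intro subset_expectation_mono) (force, blast)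
  have a: "?a \<le> subset_expectation I q (\<lambda>X. g (insert x X))"
    by (rule insert.IH) (use insert.prems in \<open>auto intro!: insert.prems(2)\<close>)
  have b: "?b \<le> subset_expectation I q g"
    by (rule insert.IH) (use insert.prems in \<open>auto intro!: insert.prems(2)\<close>)
  have x: "0 \<le> p x" "p x \<le> q x" "q x \<le> 1"
    using insert.prems by auto
  have "p x * ?a + (1 - p x) * ?b = ?b + p x * (?a - ?b)"
    by (simp add: algebra_simps)
  also have "\<dots> \<le> ?b + q x * (?a - ?b)"
    using x ba by (intro add_left_mono mult_right_mono) auto
  also have "\<dots> = q x * ?a + (1 - q x) * ?b"
    by (simp add: algebra_simps)
  also have "\<dots> \<le> q x * subset_expectation I q (\<lambda>X. g (insert x X)) +
      (1 - q x) * subset_expectation I q g"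
    using x a b by (intro add_mono mult_left_mono) auto
  finally show ?case
    using insert by (simp add: subset_expectation_insert)
qed simp

text \<open>The exploration speaks of neighbours of a vertex, the graph of edges. With
  \<open>h = edge v\<close> this identifies the two descriptions of the star of \<open>v\<close>;
  reading the edge set through its preimage recovers the neighbours.\<close>

lemma subset_expectation_reindex:
  assumes "inj_on h I" "finite I"
  shows "subset_expectation (h ` I) p (\<lambda>X. g {i \<in> I. h i \<in> X}) =
    subset_expectation I (\<lambda>i. p (h i)) g"
  using assms(2,1)
proof (induction I arbitrary: g)
  case (insert x I)
  have fresh: "h x \<notin> h ` I"
    using insert by auto
  have "subset_expectation (h ` I) p (\<lambda>X. g {i \<in> insert x I. h i \<in> insert (h x) X}) =
      subset_expectation (h ` I) p (\<lambda>X. (\<lambda>Y. g (insert x Y)) {i \<in> I. h i \<in> X})"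
  proof (rule subset_expectation_cong)
    fix X assume "X \<subseteq> h ` I"
    have "h i \<noteq> h x" if "i \<in> I" for i
      using fresh that by (metis imageI)
    then have "{i \<in> insert x I. h i \<in> insert (h x) X} = insert x {i \<in> I. h i \<in> X}"
      by auto
    then show "g {i \<in> insert x I. h i \<in> insert (h x) X} = g (insert x {i \<in> I. h i \<in> X})"
      by simp
  qed
  moreover have "subset_expectation (h ` I) p (\<lambda>X. g {i \<in> insert x I. h i \<in> X}) =
      subset_expectation (h ` I) p (\<lambda>X. g {i \<in> I. h i \<in> X})"
  proof (rule subset_expectation_cong)
    fix X assume "X \<subseteq> h ` I"
    then have "{i \<in> insert x I. h i \<in> X} = {i \<in> I. h i \<in> X}"
      using fresh by auto
    then show "g {i \<in> insert x I. h i \<in> X} = g {i \<in> I. h i \<in> X}"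
      by simp
  qed
  ultimately have "subset_expectation (h ` insert x I) p (\<lambda>X. g {i \<in> insert x I. h i \<in> X}) =
      p (h x) * subset_expectation (h ` I) p (\<lambda>X. (\<lambda>Y. g (insert x Y)) {i \<in> I. h i \<in> X}) +
      (1 - p (h x)) * subset_expectation (h ` I) p (\<lambda>X. g {i \<in> I. h i \<in> X})"
    using fresh insert.hyps by (simp add: subset_expectation_insert)
  also have "\<dots> = subset_expectation (insert x I) (\<lambda>i. p (h i)) g"
    using insert.hyps insert.prems insert.IH[of "\<lambda>Y. g (insert x Y)"] insert.IH[of g]
    by (simp add: subset_expectation_insert)
  finally show ?case .
qed simp

lemma expectation_Pi_bernoulli:
  fixes g :: "'a set \<Rightarrow> real"
  assumes "finite I" "\<And>x. x \<in> I \<Longrightarrow> 0 \<le> p x \<and> p x \<le> 1"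
  shows "measure_pmf.expectation (Pi_pmf I False (\<lambda>x. bernoulli_pmf (p x))) (\<lambda>f. g {x \<in> I. f x}) =
    subset_expectation I p g"
  using assms
proof (induction I arbitrary: g)
  case (insert x I)
  let ?P = "Pi_pmf I False (\<lambda>x. bernoulli_pmf (p x))"
  \<comment> \<open>Finite support is what turns the expectation over the monadic bind into an
    iterated expectation.\<close>
  have fin: "finite (set_pmf ?P)"
    using insert.hyps by (simp add: set_Pi_pmf finite_PiE_dflt)
  have val: "g {y \<in> insert x I. (f(x := b)) y} =
      (if b then g (insert x {y \<in> I. f y}) else g {y \<in> I. f y})" for f b
    using insert.hyps by (auto intro!: arg_cong[where f = g])
  have "measure_pmf.expectation (Pi_pmf (insert x I) False (\<lambda>x. bernoulli_pmf (p x)))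
        (\<lambda>f. g {y \<in> insert x I. f y}) =
      measure_pmf.expectation (bernoulli_pmf (p x))
        (\<lambda>b. measure_pmf.expectation ?P (\<lambda>f. g {y \<in> insert x I. (f(x := b)) y}))"
    using insert.hyps fin
    by (subst Pi_pmf_insert', simp, simp, subst pmf_expectation_bind[where A = UNIV])
       (auto simp: map_pmf_def[symmetric] pmf_expectation_bind integral_measure_pmf[where A = UNIV]
          bind_return_pmf)
  also have "\<dots> = p x * measure_pmf.expectation ?P (\<lambda>f. g (insert x {y \<in> I. f y})) +
      (1 - p x) * measure_pmf.expectation ?P (\<lambda>f. g {y \<in> I. f y})"
    using insert.prems unfolding val by (subst integral_bernoulli_pmf) auto
  also have "\<dots> = subset_expectation (insert x I) p g"
    using insert.IH[of "\<lambda>X. g (insert x X)"] insert.IH[of g] insert.hyps insert.prems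
    by (simp add: subset_expectation_insert)
  finally show ?case .
qed simp

section \<open>Exploration of clusters\<close>

text \<open>Sorting the endpoints gives the orientation stored in \<open>vertex_pairs\<close>, so
  \<open>edge v j\<close> and \<open>edge j v\<close> are the same Bernoulli variable.\<close>

definition edge :: "nat \<Rightarrow> nat \<Rightarrow> nat \<times> nat" where
  "edge i j = (min i j, max i j)"

definition pairs :: "nat set \<Rightarrow> (nat \<times> nat) set" where
  "pairs A = {(i, j). i \<in> A \<and> j \<in> A \<and> i < j}"

text \<open>Starting from a set keeps the notion closed under exploration: once a vertex is explored
  and deleted, what remains to be found is the set reached from all active vertices at once.\<close>

definition reach :: "(nat \<times> nat) set \<Rightarrow> nat set \<Rightarrow> nat set" where
  "reach E S = (E \<union> E\<inverse>)\<^sup>* `` S"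

lemma vertex_pairs_eq: "vertex_pairs n = pairs {1..n}"
  by (simp add: vertex_pairs_def pairs_def)

lemma finite_pairs [simp]: "finite A \<Longrightarrow> finite (pairs A)"
  by (rule finite_subset[of _ "A \<times> A"]) (auto simp: pairs_def)

lemma reach_empty [simp]: "reach E {} = {}"
  by (simp add: reach_def)

lemma subset_reach: "S \<subseteq> reach E S"
  by (auto simp: reach_def)

lemma reach_mono: "E \<subseteq> E' \<Longrightarrow> S \<subseteq> S' \<Longrightarrow> reach E S \<subseteq> reach E' S'"
  unfolding reach_def by (intro Image_mono rtrancl_mono) auto

lemma reach_step: "x \<in> reach E S \<Longrightarrow> (x, y) \<in> E \<union> E\<inverse> \<Longrightarrow> y \<in> reach E S"
  unfolding reach_def by (auto intro: rtrancl_into_rtrancl)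

lemma reach_least:
  assumes "S \<subseteq> T" "\<And>x y. x \<in> T \<Longrightarrow> (x, y) \<in> E \<union> E\<inverse> \<Longrightarrow> y \<in> T"
  shows "reach E S \<subseteq> T"
proof
  fix x assume "x \<in> reach E S"
  then obtain s where "s \<in> S" "(s, x) \<in> (E \<union> E\<inverse>)\<^sup>*"
    by (auto simp: reach_def)
  from this(2,1) show "x \<in> T"
    by induction (use assms in blast)+
qed

lemma reach_subset: "E \<subseteq> pairs A \<Longrightarrow> S \<subseteq> A \<Longrightarrow> reach E S \<subseteq> A"
  by (rule reach_least) (auto simp: pairs_def)

lemma reach_sym: "j \<in> reach E {i} \<longleftrightarrow> i \<in> reach E {j}"
proof -
  have "sym ((E \<union> E\<inverse>)\<^sup>*)"
    by (intro sym_rtrancl) (auto simp: sym_def)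
  then show ?thesis
    by (auto simp: reach_def sym_def)
qed

lemma reach_idem: "reach E (reach E S) = reach E S"
  by (intro equalityI reach_least subset_reach) (auto intro: reach_step)

lemma reach_eq: "j \<in> reach E {i} \<Longrightarrow> reach E {j} = reach E {i}"
proof -
  have sub: "reach E {j} \<subseteq> reach E {i}" if "j \<in> reach E {i}" for i j
    using reach_mono[of E E "{j}" "reach E {i}"] that by (simp add: reach_idem)
  assume "j \<in> reach E {i}"
  then show ?thesis
    using sub reach_sym by blast
qed

lemma cluster_eq_reach:
  assumes "E \<subseteq> vertex_pairs n" "i \<in> {1..n}"
  shows "cluster n E i = reach E {i}"
  using reach_subset[of E "{1..n}" "{i}"] assms
  by (auto simp: cluster_def reach_def vertex_pairs_eq)

lemma pairs_decompose:
  assumes "v \<in> A"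
  shows "pairs A = edge v ` (A - {v}) \<union> pairs (A - {v})"
    and "edge v ` (A - {v}) \<inter> pairs (A - {v}) = {}"
proof -
  show "pairs A = edge v ` (A - {v}) \<union> pairs (A - {v})"
  proof (intro equalityI subsetI)
    fix e assume "e \<in> pairs A"
    then obtain i j where e: "e = (i, j)" "i \<in> A" "j \<in> A" "i < j"
      by (auto simp: pairs_def)
    show "e \<in> edge v ` (A - {v}) \<union> pairs (A - {v})"
    proof (cases "i = v \<or> j = v")
      case True
      then have "e = edge v (if i = v then j else i)" "(if i = v then j else i) \<in> A - {v}"
        using e by (auto simp: edge_def)
      then show ?thesis
        by blast
    qed (use e in \<open>auto simp: pairs_def\<close>)
  qed (use assms in \<open>auto simp: pairs_def edge_def min_def max_def\<close>)
  show "edge v ` (A - {v}) \<inter> pairs (A - {v}) = {}"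
    by (auto simp: pairs_def edge_def min_def max_def split: if_splits)
qed

lemma inj_edge: "inj (edge v)"
  by (auto simp: inj_def edge_def min_def max_def split: if_splits)

text \<open>Deterministic form of one exploration step: \<open>X\<close> holds the edges at
  \<open>v\<close>, \<open>Y\<close> those of the graph without \<open>v\<close>. The right-hand
  side is closed under both kinds of edges, because an edge of \<open>X\<close> joins
  \<open>v\<close> to a vertex that is already among the new starting points.\<close>

lemma reach_remove_vertex:
  assumes "v \<in> S" "X \<subseteq> edge v ` B" "Y \<subseteq> pairs A" "v \<notin> A" "B \<subseteq> A"
  shows "reach (X \<union> Y) S = insert v (reach Y (S - {v} \<union> {j \<in> B. edge v j \<in> X}))"
    (is "?l = ?r")
proof
  let ?T = "S - {v} \<union> {j \<in> B. edge v j \<in> X}"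
  show "?r \<subseteq> ?l"
  proof -
    have v: "v \<in> ?l"
      using assms(1) subset_reach[of S "X \<union> Y"] by blast
    have "?T \<subseteq> ?l"
    proof
      fix j assume "j \<in> ?T"
      then show "j \<in> ?l"
      proof
        assume "j \<in> {j \<in> B. edge v j \<in> X}"
        then have "(v, j) \<in> (X \<union> Y) \<union> (X \<union> Y)\<inverse>"
          by (auto simp: edge_def min_def max_def split: if_splits)
        then show ?thesis
          by (rule reach_step[OF v])
      next
        assume "j \<in> S - {v}"
        then show ?thesis
          using subset_reach[of S "X \<union> Y"] by blast
      qed
    qed
    then have "reach Y ?T \<subseteq> reach (X \<union> Y) ?l"
      by (intro reach_mono) auto
    with v show ?thesis
      by (simp add: reach_idem)
  qed
  show "?l \<subseteq> ?r"
  proof (rule reach_least)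
    show "S \<subseteq> ?r"
      using subset_reach[of ?T Y] by auto
  next
    fix x y assume x: "x \<in> ?r" and "(x, y) \<in> (X \<union> Y) \<union> (X \<union> Y)\<inverse>"
    then consider "(x, y) \<in> Y \<union> Y\<inverse>" | "(x, y) \<in> X \<union> X\<inverse>"
      by blast
    then show "y \<in> ?r"
    proof cases
      case 1
      then have "x \<noteq> v"
        using assms by (auto simp: pairs_def)
      then show ?thesis
        using x reach_step[OF _ 1] by blast
    next
      case 2
      then obtain e where e: "e \<in> X" "(x, y) = e \<or> (y, x) = e"
        by blast
      then obtain j where j: "j \<in> B" "edge v j \<in> X" "(x, y) = edge v j \<or> (y, x) = edge v j"
        using assms(2) by auto
      then have "y = v \<or> y = j"
        by (auto simp: edge_def min_def max_def split: if_splits)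
      moreover have "j \<in> ?r"
        using j subset_reach[of ?T Y] by blast
      ultimately show ?thesis
        by blast
    qed
  qed
qed

text \<open>The pair \<open>(D, S)\<close> records the explored vertices \<open>D\<close> and the discovered but not yet explored
  vertices \<open>S\<close>; exploring \<open>v \<in> S\<close> reveals only the edges between \<open>v\<close> and fresh vertices.\<close>

lemma exploration_le:
  assumes fin: "finite V"
    and q: "\<And>e. e \<in> pairs V \<Longrightarrow> 0 \<le> q e \<and> q e \<le> 1"
    and step: "\<And>D S v. D \<inter> S = {} \<Longrightarrow> D \<union> S \<subseteq> V \<Longrightarrow> v \<in> S \<Longrightarrow>
      \<phi> D S \<le> subset_expectation (V - (D \<union> S)) (\<lambda>j. q (edge v j))
        (\<lambda>R. \<phi> (insert v D) (S - {v} \<union> R))"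
    and "D \<inter> S = {}" "D \<union> S \<subseteq> V"
  shows "\<phi> D S \<le> subset_expectation (pairs (V - D)) q (\<lambda>E. \<phi> (D \<union> reach E S) {})"
  using assms(4,5)
proof (induction "card (V - D)" arbitrary: D S rule: less_induct)
  case less
  show ?case
  proof (cases "S = {}")
    case True
    then show ?thesis
      using fin by (simp add: subset_expectation_const)
  next
    case False
    then obtain v where v: "v \<in> S"
      by blast
    let ?A = "V - D" and ?A' = "V - D - {v}" and ?U = "V - (D \<union> S)"
    let ?\<Psi> = "\<lambda>R. subset_expectation (pairs ?A') q
      (\<lambda>Y. \<phi> (D \<union> insert v (reach Y (S - {v} \<union> R))) {})"
    have vA: "v \<in> ?A"
      using less.prems v by auto
    have finA: "finite ?A" "finite ?A'"
      using fin by auto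
    have cardless: "card (V - insert v D) < card ?A"
      using vA finA by (intro psubset_card_mono) auto
    have A'_eq: "V - insert v D = ?A'"
      by auto
    have IH: "\<phi> (insert v D) (S - {v} \<union> R) \<le> ?\<Psi> R" if "R \<subseteq> ?A' - S" for R
    proof -
      have "\<phi> (insert v D) (S - {v} \<union> R) \<le>
          subset_expectation (pairs ?A') q
            (\<lambda>E. \<phi> (insert v D \<union> reach E (S - {v} \<union> R)) {})"
        unfolding A'_eq[symmetric]
        by (rule less.hyps[OF cardless]) (use less.prems v that in auto)
      then show ?thesis
        by simp
    qed
    have qe: "0 \<le> q (edge v j) \<and> q (edge v j) \<le> 1" if "j \<in> V" "j \<noteq> v" for j
      using that vA by (intro q) (auto simp: pairs_def edge_def min_def max_def)
    have "\<phi> D S \<le> subset_expectation ?U (\<lambda>j. q (edge v j)) (\<lambda>R. \<phi> (insert v D) (S - {v} \<union> R))"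
      using step less.prems v by blast
    also have "\<dots> \<le> subset_expectation ?U (\<lambda>j. q (edge v j)) ?\<Psi>"
      by (intro subset_expectation_mono IH) (use qe v in auto)
    \<comment> \<open>The edges between \<open>v\<close> and the other active vertices stay
      unrevealed. Averaging over a dummy choice \<open>R'\<close> of them changes nothing, since
      these vertices are active anyway, and completes the fresh neighbours to the full star of
      \<open>v\<close>.\<close>
    also have "\<dots> = subset_expectation ?U (\<lambda>j. q (edge v j))
        (\<lambda>R. subset_expectation (S - {v}) (\<lambda>j. q (edge v j)) (\<lambda>R'. ?\<Psi> (R \<union> R')))"
    proof (rule subset_expectation_cong)
      fix R
      have "finite (S - {v})"
        using less.prems fin by (auto intro: finite_subset)
      have "subset_expectation (S - {v}) (\<lambda>j. q (edge v j)) (\<lambda>R'. ?\<Psi> (R \<union> R')) =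
          subset_expectation (S - {v}) (\<lambda>j. q (edge v j)) (\<lambda>R'. ?\<Psi> R)"
      proof (rule subset_expectation_cong)
        fix R' assume "R' \<subseteq> S - {v}"
        then have "S - {v} \<union> (R \<union> R') = S - {v} \<union> R"
          by auto
        then show "?\<Psi> (R \<union> R') = ?\<Psi> R"
          by (simp only:)
      qed
      then show "?\<Psi> R = subset_expectation (S - {v}) (\<lambda>j. q (edge v j)) (\<lambda>R'. ?\<Psi> (R \<union> R'))"
        using \<open>finite (S - {v})\<close> by (simp add: subset_expectation_const)
    qed
    also have "\<dots> = subset_expectation (?U \<union> (S - {v})) (\<lambda>j. q (edge v j)) ?\<Psi>"
      using less.prems fin
      by (intro subset_expectation_Un[symmetric]) (auto intro: finite_subset)
    also have "?U \<union> (S - {v}) = ?A'"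
      using less.prems v by auto
    also have "subset_expectation ?A' (\<lambda>j. q (edge v j)) ?\<Psi> =
        subset_expectation (edge v ` ?A') q (\<lambda>X. ?\<Psi> {j \<in> ?A'. edge v j \<in> X})"
      by (rule subset_expectation_reindex[symmetric])
        (use finA in \<open>auto intro: inj_on_subset[OF inj_edge]\<close>)
    also have "\<dots> = subset_expectation (edge v ` ?A') q
        (\<lambda>X. subset_expectation (pairs ?A') q (\<lambda>Y. \<phi> (D \<union> reach (X \<union> Y) S) {}))"
    proof (rule subset_expectation_cong)
      fix X assume X: "X \<subseteq> edge v ` ?A'"
      show "?\<Psi> {j \<in> ?A'. edge v j \<in> X} =
          subset_expectation (pairs ?A') q (\<lambda>Y. \<phi> (D \<union> reach (X \<union> Y) S) {})"
      proof (rule subset_expectation_cong)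
        fix Y assume "Y \<subseteq> pairs ?A'"
        then show "\<phi> (D \<union> insert v (reach Y (S - {v} \<union> {j \<in> ?A'. edge v j \<in> X}))) {} =
            \<phi> (D \<union> reach (X \<union> Y) S) {}"
          using reach_remove_vertex[OF v X, of Y ?A'] by simp
      qed
    qed
    also have "\<dots> = subset_expectation (pairs ?A) q (\<lambda>E. \<phi> (D \<union> reach E S) {})"
      unfolding pairs_decompose(1)[OF vA]
      by (rule subset_expectation_Un[symmetric]) (use finA pairs_decompose(2)[OF vA] in auto)
    finally show ?thesis .
  qed
qed

lemma exploration_ge:
  assumes fin: "finite V"
    and q: "\<And>e. e \<in> pairs V \<Longrightarrow> 0 \<le> q e \<and> q e \<le> 1"
    and step: "\<And>D S v. D \<inter> S = {} \<Longrightarrow> D \<union> S \<subseteq> V \<Longrightarrow> v \<in> S \<Longrightarrow>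
      subset_expectation (V - (D \<union> S)) (\<lambda>j. q (edge v j))
        (\<lambda>R. \<phi> (insert v D) (S - {v} \<union> R)) \<le> \<phi> D S"
    and "D \<inter> S = {}" "D \<union> S \<subseteq> V"
  shows "subset_expectation (pairs (V - D)) q (\<lambda>E. \<phi> (D \<union> reach E S) {}) \<le> \<phi> D S"
  using exploration_le[of V q "\<lambda>D S. - \<phi> D S" D S] assms
  by (simp add: subset_expectation_minus)

section \<open>Correlation of disjoint clusters\<close>

text \<open>Every edge of \<open>X\<close> touches \<open>A\<close> and no edge of \<open>Y\<close>
  does. So the event that the cluster of \<open>i\<close> equals \<open>A\<close> depends on
  \<open>X\<close> alone, and on that event the cluster of a vertex outside \<open>A\<close> depends
  on \<open>Y\<close> alone.\<close>

lemma reach_Un_component: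
  assumes X: "X \<subseteq> pairs V - pairs (V - A)" and Y: "Y \<subseteq> pairs (V - A)"
  shows "reach (X \<union> Y) {i} = A \<longleftrightarrow> reach X {i} = A"
    and "reach X {i} = A \<Longrightarrow> j \<in> V - A \<Longrightarrow> reach (X \<union> Y) {j} = reach Y {j}"
proof -
  have Y_avoids: "x \<notin> A \<and> y \<notin> A" if "(x, y) \<in> Y \<union> Y\<inverse>" for x y
    using that Y by (auto simp: pairs_def)
  have X_touches: "x \<in> A \<or> y \<in> A" if "(x, y) \<in> X \<union> X\<inverse>" for x y
    using that X by (auto simp: pairs_def)
  have sub: "reach X {i} \<subseteq> reach (X \<union> Y) {i}"
    by (rule reach_mono) auto
  have sup: "reach (X \<union> Y) {i} \<subseteq> reach X {i}" if "reach X {i} \<subseteq> A"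
  proof (rule reach_least)
    fix x y assume x: "x \<in> reach X {i}" and "(x, y) \<in> (X \<union> Y) \<union> (X \<union> Y)\<inverse>"
    then have "(x, y) \<in> X \<union> X\<inverse>"
      using Y_avoids[of x y] that by blast
    with x show "y \<in> reach X {i}"
      by (rule reach_step)
  qed (rule subset_reach)
  show "reach (X \<union> Y) {i} = A \<longleftrightarrow> reach X {i} = A"
    using sub sup by auto
  show "reach (X \<union> Y) {j} = reach Y {j}" if A: "reach X {i} = A" and j: "j \<in> V - A"
  proof
    show "reach (X \<union> Y) {j} \<subseteq> reach Y {j}"
    proof (rule reach_least)
      fix x y assume x: "x \<in> reach Y {j}" and xy: "(x, y) \<in> (X \<union> Y) \<union> (X \<union> Y)\<inverse>"
      have "x \<notin> A"
        using x reach_subset[OF Y, of "{j}"] j by auto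
      moreover have "x \<in> A" if "(x, y) \<in> X \<union> X\<inverse>"
        using X_touches[OF that] A reach_step[of y X "{i}" x] that by auto
      ultimately have "(x, y) \<in> Y \<union> Y\<inverse>"
        using xy by blast
      with x show "y \<in> reach Y {j}"
        by (rule reach_step)
    qed (rule subset_reach)
  qed (intro reach_mono, auto)
qed

text \<open>Given that the cluster of \<open>i\<close> is a set \<open>A\<close> without
  \<open>j\<close>, the cluster of \<open>j\<close> lives in the graph on \<open>V - A\<close>,
  where it is no larger than in the full graph. As \<open>f\<close> is increasing, the conditioning
  can only lower the mean of the second factor; it remains to sum over \<open>A\<close>. This plays
  the role of a van den Berg-Kesten inequality.\<close>

lemma disjoint_clusters_correlation:
  fixes f :: "nat \<Rightarrow> real"
  assumes fin: "finite V"
    and q: "\<And>e. e \<in> pairs V \<Longrightarrow> 0 \<le> q e \<and> q e \<le> 1"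
    and f: "mono f" "\<And>k. 0 \<le> f k"
    and ij: "i \<in> V" "j \<in> V"
  shows "subset_expectation (pairs V) q
      (\<lambda>E. if j \<in> reach E {i} then 0 else f (card (reach E {i})) * f (card (reach E {j})))
    \<le> subset_expectation (pairs V) q (\<lambda>E. f (card (reach E {i}))) *
      subset_expectation (pairs V) q (\<lambda>E. f (card (reach E {j})))"
proof -
  let ?E = "subset_expectation (pairs V) q"
  let ?Ej = "?E (\<lambda>E. f (card (reach E {j})))"
  let ?I = "\<lambda>A E. if reach E {i} = A then f (card A) else 0"
  have Ej_nonneg: "0 \<le> ?Ej"
    by (intro subset_expectation_nonneg) (use q f in auto)
  have comp: "?E (\<lambda>E. ?I A E * f (card (reach E {j}))) \<le> ?E (?I A) * ?Ej"
    if A: "A \<subseteq> V" "j \<notin> A" for A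
  proof -
    let ?J = "pairs (V - A)" and ?B = "pairs V - pairs (V - A)"
    have JV: "?J \<subseteq> pairs V"
      by (auto simp: pairs_def)
    have BJ: "pairs V = ?B \<union> ?J"
      using JV by auto
    have fin': "finite ?B" "finite ?J"
      using fin by auto
    have split: "?E g = subset_expectation ?B q (\<lambda>X. subset_expectation ?J q (\<lambda>Y. g (X \<union> Y)))" for g
      by (subst BJ, rule subset_expectation_Un) (use fin' in auto)
    let ?m = "subset_expectation ?J q (\<lambda>Y. f (card (reach Y {j})))"
    \<comment> \<open>Regarding the mean on \<open>V - A\<close> as a mean over all edges, with
      those touching \<open>A\<close> ignored, makes it comparable pointwise with the mean over the
      full graph.\<close>
    have "?m = subset_expectation ?B q (\<lambda>X. ?m)"
      using fin' by (simp add: subset_expectation_const)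
    also have "\<dots> \<le> ?Ej"
      unfolding split
    proof (intro subset_expectation_mono)
      fix X Y assume "X \<subseteq> ?B" "Y \<subseteq> ?J"
      then have "reach (X \<union> Y) {j} \<subseteq> V"
        using JV ij by (intro reach_subset) auto
      then have "finite (reach (X \<union> Y) {j})"
        using fin finite_subset by blast
      moreover have "reach Y {j} \<subseteq> reach (X \<union> Y) {j}"
        by (rule reach_mono) auto
      ultimately show "f (card (reach Y {j})) \<le> f (card (reach (X \<union> Y) {j}))"
        using f(1) by (intro monoD[OF f(1)] card_mono)
    qed (use q JV in auto)
    finally have m: "?m \<le> ?Ej" .
    have "?E (\<lambda>E. ?I A E * f (card (reach E {j}))) = subset_expectation ?B q (\<lambda>X. ?I A X * ?m)"
      unfolding split
    proof (rule subset_expectation_cong)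
      fix X assume X: "X \<subseteq> ?B"
      have "subset_expectation ?J q (\<lambda>Y. ?I A (X \<union> Y) * f (card (reach (X \<union> Y) {j}))) =
          subset_expectation ?J q (\<lambda>Y. ?I A X * f (card (reach Y {j})))"
      proof (rule subset_expectation_cong)
        fix Y assume Y: "Y \<subseteq> ?J"
        show "?I A (X \<union> Y) * f (card (reach (X \<union> Y) {j})) = ?I A X * f (card (reach Y {j}))"
          using reach_Un_component[OF X Y, of i] A ij by auto
      qed
      then show "subset_expectation ?J q (\<lambda>Y. ?I A (X \<union> Y) * f (card (reach (X \<union> Y) {j}))) =
          ?I A X * ?m"
        by (simp only: subset_expectation_cmult)
    qed
    also have "\<dots> = subset_expectation ?B q (?I A) * ?m"
      by (rule subset_expectation_multc)
    also have "\<dots> \<le> subset_expectation ?B q (?I A) * ?Ej"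
      by (intro mult_left_mono m subset_expectation_nonneg) (use q f in auto)
    also have "subset_expectation ?B q (?I A) = ?E (?I A)"
      unfolding split
    proof (rule subset_expectation_cong)
      fix X assume X: "X \<subseteq> ?B"
      have "subset_expectation ?J q (\<lambda>Y. ?I A (X \<union> Y)) = subset_expectation ?J q (\<lambda>Y. ?I A X)"
        by (rule subset_expectation_cong) (simp only: reach_Un_component(1)[OF X])
      then show "?I A X = subset_expectation ?J q (\<lambda>Y. ?I A (X \<union> Y))"
        using fin' by (simp only: subset_expectation_const)
    qed
    finally show ?thesis .
  qed
  let ?S = "{A. A \<subseteq> V \<and> j \<notin> A}"
  have finS: "finite ?S"
    using fin by auto
  have "?E (\<lambda>E. if j \<in> reach E {i} then 0 else f (card (reach E {i})) * f (card (reach E {j}))) =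
      ?E (\<lambda>E. \<Sum>A\<in>?S. ?I A E * f (card (reach E {j})))"
  proof (rule subset_expectation_cong)
    fix E assume "E \<subseteq> pairs V"
    then have "reach E {i} \<subseteq> V"
      using ij by (intro reach_subset) auto
    then have "(\<Sum>A\<in>?S. ?I A E) = (if j \<in> reach E {i} then 0 else f (card (reach E {i})))"
      using finS by (auto simp: sum.delta')
    then show "(if j \<in> reach E {i} then 0 else f (card (reach E {i})) * f (card (reach E {j}))) =
        (\<Sum>A\<in>?S. ?I A E * f (card (reach E {j})))"
      by (simp add: sum_distrib_right[symmetric])
  qed
  also have "\<dots> = (\<Sum>A\<in>?S. ?E (\<lambda>E. ?I A E * f (card (reach E {j}))))"
    by (rule subset_expectation_sum)
  also have "\<dots> \<le> (\<Sum>A\<in>?S. ?E (?I A) * ?Ej)"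
    by (intro sum_mono comp) auto
  also have "\<dots> = ?E (\<lambda>E. \<Sum>A\<in>?S. ?I A E) * ?Ej"
    by (simp only: subset_expectation_sum sum_distrib_right)
  also have "\<dots> \<le> ?E (\<lambda>E. f (card (reach E {i}))) * ?Ej"
  proof (intro mult_right_mono Ej_nonneg subset_expectation_mono)
    fix E
    have "(\<Sum>A\<in>?S. ?I A E) = (if reach E {i} \<in> ?S then f (card (reach E {i})) else 0)"
      using finS by (subst sum.delta'[symmetric]) auto
    then show "(\<Sum>A\<in>?S. ?I A E) \<le> f (card (reach E {i}))"
      using f by simp
  qed (use q in auto)
  finally show ?thesis .
qed

text \<open>Chebyshev's inequality in a form free of division. In the second moment of the sum,
  pairs in different clusters give at most the squared mean by negative correlation; pairs in a
  common cluster give exactly the right-hand side, as all members of a cluster share the same value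
  of \<open>f\<close>.\<close>

lemma cluster_statistic_zero_probability:
  fixes f :: "nat \<Rightarrow> real"
  assumes fin: "finite V"
    and q: "\<And>e. e \<in> pairs V \<Longrightarrow> 0 \<le> q e \<and> q e \<le> 1"
    and f: "mono f" "\<And>k. 0 \<le> f k"
  shows "(\<Sum>i\<in>V. subset_expectation (pairs V) q (\<lambda>E. f (card (reach E {i}))))\<^sup>2 *
      subset_expectation (pairs V) q (\<lambda>E. if (\<Sum>i\<in>V. f (card (reach E {i}))) = 0 then 1 else 0)
    \<le> (\<Sum>i\<in>V. subset_expectation (pairs V) q
          (\<lambda>E. real (card (reach E {i})) * (f (card (reach E {i})))\<^sup>2))"
proof -
  let ?E = "subset_expectation (pairs V) q"
  let ?c = "\<lambda>E i. f (card (reach E {i}))"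
  let ?Y = "\<lambda>E. \<Sum>i\<in>V. ?c E i"
  let ?m = "\<Sum>i\<in>V. ?E (\<lambda>E. ?c E i)"
  let ?v = "\<Sum>i\<in>V. ?E (\<lambda>E. real (card (reach E {i})) * (?c E i)\<^sup>2)"
  have finP: "finite (pairs V)"
    using fin by simp
  have EY: "?E ?Y = ?m"
    by (rule subset_expectation_sum)
  have sq: "(?Y E)\<^sup>2 = (\<Sum>i\<in>V. real (card (reach E {i})) * (?c E i)\<^sup>2) +
      (\<Sum>i\<in>V. \<Sum>j\<in>V. if j \<in> reach E {i} then 0 else ?c E i * ?c E j)" if E: "E \<subseteq> pairs V" for E
  proof -
    have "(\<Sum>j\<in>V. if j \<in> reach E {i} then ?c E i * ?c E j else 0) =
        real (card (reach E {i})) * (?c E i)\<^sup>2" if "i \<in> V" for i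
    proof -
      have "reach E {i} \<subseteq> V"
        using that by (intro reach_subset[OF E]) auto
      then have "V \<inter> {j. j \<in> reach E {i}} = reach E {i}"
        by auto
      then have "(\<Sum>j\<in>V. if j \<in> reach E {i} then ?c E i * ?c E j else 0) =
          (\<Sum>j\<in>reach E {i}. ?c E i * ?c E j)"
        using fin by (simp add: sum.If_cases)
      also have "\<dots> = (\<Sum>j\<in>reach E {i}. (?c E i)\<^sup>2)"
        by (intro sum.cong) (auto simp: reach_eq power2_eq_square)
      finally show ?thesis
        by simp
    qed
    moreover have "(?Y E)\<^sup>2 = (\<Sum>i\<in>V. (\<Sum>j\<in>V. if j \<in> reach E {i} then ?c E i * ?c E j else 0) +
        (\<Sum>j\<in>V. if j \<in> reach E {i} then 0 else ?c E i * ?c E j))"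
      unfolding power2_eq_square sum_product
      by (intro sum.cong refl) (simp add: sum.distrib[symmetric] if_distrib cong: if_cong)
    ultimately show ?thesis
      by (simp add: sum.distrib)
  qed
  have "?E (\<lambda>E. (?Y E)\<^sup>2) = ?v +
      (\<Sum>i\<in>V. \<Sum>j\<in>V. ?E (\<lambda>E. if j \<in> reach E {i} then 0 else ?c E i * ?c E j))"
    by (subst subset_expectation_cong[OF sq])
      (simp_all only: subset_expectation_add subset_expectation_sum)
  also have "\<dots> \<le> ?v + (\<Sum>i\<in>V. \<Sum>j\<in>V. ?E (\<lambda>E. ?c E i) * ?E (\<lambda>E. ?c E j))"
    by (intro add_left_mono sum_mono disjoint_clusters_correlation fin q f)
  also have "\<dots> = ?v + ?m\<^sup>2"
    by (simp add: power2_eq_square sum_product)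
  finally have EY2: "?E (\<lambda>E. (?Y E)\<^sup>2) \<le> ?v + ?m\<^sup>2" .
  have "?m\<^sup>2 * ?E (\<lambda>E. if ?Y E = 0 then 1 else 0) = ?E (\<lambda>E. ?m\<^sup>2 * (if ?Y E = 0 then 1 else 0))"
    by (rule subset_expectation_cmult[symmetric])
  \<comment> \<open>The right-hand side is the mean of \<open>(?Y E - ?m)\<^sup>2\<close>, which
    equals \<open>?m\<^sup>2\<close> wherever \<open>?Y E\<close> vanishes.\<close>
  also have "\<dots> \<le> ?E (\<lambda>E. (?Y E)\<^sup>2 - 2 * ?m * ?Y E + ?m\<^sup>2)"
  proof (rule subset_expectation_mono)
    fix E
    have "(?Y E)\<^sup>2 - 2 * ?m * ?Y E + ?m\<^sup>2 = (?Y E - ?m)\<^sup>2"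
      by (simp add: power2_eq_square algebra_simps)
    moreover have "0 \<le> (?Y E - ?m)\<^sup>2"
      by simp
    ultimately show "?m\<^sup>2 * (if ?Y E = 0 then 1 else 0) \<le> (?Y E)\<^sup>2 - 2 * ?m * ?Y E + ?m\<^sup>2"
      by (simp split: if_splits)
  qed (use q in auto)
  also have "\<dots> = ?E (\<lambda>E. (?Y E)\<^sup>2) - 2 * ?m * ?m + ?m\<^sup>2"
    using EY by (simp only: subset_expectation_add subset_expectation_diff
        subset_expectation_cmult subset_expectation_const[OF finP])
  also have "\<dots> \<le> ?v"
    using EY2 by (simp add: power2_eq_square)
  finally show ?thesis .
qed

section \<open>Cluster sizes for fixed weights\<close>

definition nr_prob :: "nat set \<Rightarrow> (nat \<Rightarrow> real) \<Rightarrow> nat \<times> nat \<Rightarrow> real" where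
  "nr_prob V x e = 1 - exp (- (x (fst e) * x (snd e) / sum x V))"

abbreviation nr_expectation :: "nat set \<Rightarrow> (nat \<Rightarrow> real) \<Rightarrow> ((nat \<times> nat) set \<Rightarrow> real) \<Rightarrow> real" where
  "nr_expectation V x \<equiv> subset_expectation (pairs V) (nr_prob V x)"

lemma nr_prob_edge: "nr_prob V x (edge i j) = 1 - exp (- (x i * x j / sum x V))"
  by (simp add: nr_prob_def edge_def min_def max_def mult.commute)

text \<open>In the potential \<open>\<phi>\<close> a vertex contributes \<open>h\<close> from its
  discovery on and \<open>\<eta> * x\<close> while it is active. Exploring \<open>v\<close> costs
  the factor \<open>exp (- (\<eta> * x v))\<close>, each newly found \<open>j\<close> brings
  \<open>exp (h j + \<eta> * x j)\<close>, and independence makes the mean a product. The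
  martingale-type property thus becomes a comparison of two numbers.\<close>

lemma prod_exploration_step:
  fixes h x :: "nat \<Rightarrow> real" and \<eta> :: real
  assumes "finite V" "D \<inter> S = {}" "D \<union> S \<subseteq> V" "v \<in> S"
  defines "\<phi> \<equiv> \<lambda>D S. exp (sum h (D \<union> S) + \<eta> * sum x S)"
  shows "subset_expectation (V - (D \<union> S)) p (\<lambda>R. \<phi> (insert v D) (S - {v} \<union> R)) =
    \<phi> D S * exp (- (\<eta> * x v)) * (\<Prod>j\<in>V - (D \<union> S). 1 - p j + p j * exp (h j + \<eta> * x j))"
proof -
  have fin: "finite D" "finite S"
    using assms finite_subset by blast+
  have "\<phi> (insert v D) (S - {v} \<union> R) =
      \<phi> D S * exp (- (\<eta> * x v)) * (\<Prod>j\<in>R. exp (h j + \<eta> * x j))" if R: "R \<subseteq> V - (D \<union> S)" for R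
  proof -
    have finR: "finite R"
      using R assms(1) finite_subset by blast
    have "insert v D \<union> (S - {v} \<union> R) = (D \<union> S) \<union> R"
      using assms by auto
    moreover have "sum h ((D \<union> S) \<union> R) = sum h (D \<union> S) + sum h R"
      using R fin finR by (intro sum.union_disjoint) auto
    moreover have "sum x (S - {v} \<union> R) = sum x (S - {v}) + sum x R"
      using R fin finR by (intro sum.union_disjoint) auto
    moreover have "sum x (S - {v}) = sum x S - x v"
      using assms fin by (simp add: sum_diff1)
    ultimately have eq: "sum x (S - {v} \<union> R) = sum x S - x v + sum x R"
        "sum h (insert v D \<union> (S - {v} \<union> R)) = sum h (D \<union> S) + sum h R"
      by simp_all
    have "\<phi> (insert v D) (S - {v} \<union> R) =
        exp ((sum h (D \<union> S) + \<eta> * sum x S) + - (\<eta> * x v) + (sum h R + \<eta> * sum x R))"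
      unfolding \<phi>_def eq by (simp add: algebra_simps)
    also have "sum h R + \<eta> * sum x R = (\<Sum>j\<in>R. h j + \<eta> * x j)"
      by (simp add: sum.distrib sum_distrib_left)
    finally show ?thesis
      by (simp only: \<phi>_def exp_add exp_sum[OF finR])
  qed
  then have "subset_expectation (V - (D \<union> S)) p (\<lambda>R. \<phi> (insert v D) (S - {v} \<union> R)) =
      subset_expectation (V - (D \<union> S)) p
        (\<lambda>R. \<phi> D S * exp (- (\<eta> * x v)) * (\<Prod>j\<in>R. exp (h j + \<eta> * x j)))"
    by (rule subset_expectation_cong)
  also have "\<dots> = \<phi> D S * exp (- (\<eta> * x v)) * (\<Prod>j\<in>V - (D \<union> S). 1 - p j + p j * exp (h j + \<eta> * x j))"
    using assms(1) by (simp add: subset_expectation_cmult subset_expectation_prod)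
  finally show ?thesis .
qed

text \<open>The right-hand side is the chord of \<open>exp\<close> between \<open>- a\<close> and
  \<open>0\<close>, evaluated at \<open>- (a * (1 - f))\<close>. The form
  \<open>1 - exp (- a)\<close> of the edge probability lets convexity produce the Poisson generating
  function.\<close>

lemma bernoulli_exp_mixture_ge:
  fixes a f :: real
  assumes "0 \<le> a" "0 \<le> f" "f \<le> 1"
  shows "exp (- (a * (1 - f))) \<le> exp (- a) + (1 - exp (- a)) * f"
proof -
  have "exp ((1 - (1 - f)) * 0 + (1 - f) * (- a)) \<le> (1 - (1 - f)) * exp 0 + (1 - f) * exp (- a)"
    using convex_onD[OF exp_convex, of "1 - f" 0 "- a"] assms by simp
  then show ?thesis
    by (simp add: algebra_simps)
qed

lemma bernoulli_exp_mixture_le: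
  fixes a f :: real
  assumes "0 \<le> a" "1 \<le> f"
  shows "exp (- a) + (1 - exp (- a)) * f \<le> exp (a * (f - 1))"
proof -
  have "1 - exp (- a) \<le> a"
    using exp_ge_add_one_self[of "- a"] by simp
  then have "(1 - exp (- a)) * (f - 1) \<le> a * (f - 1)"
    using assms by (intro mult_right_mono) auto
  also have "1 + a * (f - 1) \<le> exp (a * (f - 1))"
    by (rule exp_ge_add_one_self)
  finally show ?thesis
    by (simp add: algebra_simps)
qed

locale nr_graph =
  fixes V :: "nat set" and x :: "nat \<Rightarrow> real"
  assumes finite_V: "finite V" and weight_nonneg: "\<And>i. i \<in> V \<Longrightarrow> 0 \<le> x i"
    and weight_pos: "0 < sum x V"
begin

lemma nr_prob_bounds: "e \<in> pairs V \<Longrightarrow> 0 \<le> nr_prob V x e \<and> nr_prob V x e \<le> 1"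
  using weight_nonneg weight_pos by (auto simp: nr_prob_def pairs_def intro!: divide_nonneg_pos)

text \<open>The hypothesis says that \<open>i \<mapsto> exp (- h i - \<eta> * x i)\<close> is a subsolution of the equation
  satisfied by the generating function of the total progeny of the Poisson branching process that
  approximates the exploration of a cluster.\<close>

lemma generating_function_ge:
  assumes h: "\<And>j. j \<in> V \<Longrightarrow> 0 \<le> h j" and "0 \<le> \<eta>"
    and le: "(\<Sum>j\<in>V. x j / sum x V * (1 - exp (- (h j + \<eta> * x j)))) \<le> \<eta>"
    and i: "i \<in> V"
  shows "exp (- (h i + \<eta> * x i)) \<le> nr_expectation V x (\<lambda>E. exp (- sum h (reach E {i})))"
proof -
  define \<phi> where "\<phi> = (\<lambda>D S. exp (sum (\<lambda>j. - h j) (D \<union> S) + (- \<eta>) * sum x S))"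
  have "\<phi> {} {i} \<le> subset_expectation (pairs (V - {})) (nr_prob V x) (\<lambda>E. \<phi> ({} \<union> reach E {i}) {})"
  proof (rule exploration_le[OF finite_V nr_prob_bounds])
    fix D S v assume DS: "D \<inter> S = {}" "D \<union> S \<subseteq> V" and v: "v \<in> S"
    let ?U = "V - (D \<union> S)"
    let ?a = "\<lambda>j. x v * x j / sum x V" and ?f = "\<lambda>j. exp (- h j + - \<eta> * x j)"
    have vV: "v \<in> V"
      using DS v by auto
    have a: "0 \<le> ?a j" if "j \<in> V" for j
      using that vV weight_nonneg weight_pos by auto
    have f: "0 \<le> ?f j" "?f j \<le> 1" if "j \<in> V" for j
      using h[OF that] mult_nonneg_nonneg[OF assms(2) weight_nonneg[OF that]] by auto
    have af: "0 \<le> ?a j * (1 - ?f j)" if "j \<in> V" for j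
      using a[OF that] f[OF that] by (intro mult_nonneg_nonneg) auto
    have "x v * (\<Sum>j\<in>V. x j / sum x V * (1 - exp (- (h j + \<eta> * x j)))) =
        (\<Sum>j\<in>V. ?a j * (1 - ?f j))"
      by (simp add: sum_distrib_left algebra_simps)
    then have sum_le: "(\<Sum>j\<in>V. ?a j * (1 - ?f j)) \<le> \<eta> * x v"
      using mult_left_mono[OF le weight_nonneg[OF vV]] by (simp only: mult.commute)
    \<comment> \<open>Only fresh vertices can be found, but restricting a sum of non-negative terms
      to them is the favourable direction here, so the depletion of vertices costs nothing.\<close>
    have "exp (- (\<eta> * x v)) \<le> exp (- (\<Sum>j\<in>?U. ?a j * (1 - ?f j)))"
    proof -
      have "(\<Sum>j\<in>?U. ?a j * (1 - ?f j)) \<le> (\<Sum>j\<in>V. ?a j * (1 - ?f j))"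
        by (rule sum_mono2[OF finite_V]) (use af in auto)
      with sum_le show ?thesis
        by simp
    qed
    also have "\<dots> = (\<Prod>j\<in>?U. exp (- (?a j * (1 - ?f j))))"
      using finite_V by (simp add: exp_sum sum_negf[symmetric])
    also have "\<dots> \<le> (\<Prod>j\<in>?U. 1 - nr_prob V x (edge v j) + nr_prob V x (edge v j) * ?f j)"
    proof (rule prod_mono)
      fix j assume "j \<in> ?U"
      then show "0 \<le> exp (- (?a j * (1 - ?f j))) \<and> exp (- (?a j * (1 - ?f j))) \<le>
          1 - nr_prob V x (edge v j) + nr_prob V x (edge v j) * ?f j"
        using bernoulli_exp_mixture_ge[OF a[of j] f[of j]] unfolding nr_prob_edge by simp
    qed
    finally have "exp (\<eta> * x v) * exp (- (\<eta> * x v)) \<le> exp (\<eta> * x v) *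
        (\<Prod>j\<in>?U. 1 - nr_prob V x (edge v j) + nr_prob V x (edge v j) * ?f j)"
      by (intro mult_left_mono) auto
    then have one: "1 \<le> exp (\<eta> * x v) *
        (\<Prod>j\<in>?U. 1 - nr_prob V x (edge v j) + nr_prob V x (edge v j) * ?f j)"
      by (simp add: exp_minus_inverse)
    have "\<phi> D S \<le> \<phi> D S * (exp (\<eta> * x v) *
        (\<Prod>j\<in>?U. 1 - nr_prob V x (edge v j) + nr_prob V x (edge v j) * ?f j))"
      using one mult_left_mono[OF one, of "\<phi> D S"] by (simp add: \<phi>_def)
    also have "\<dots> = subset_expectation ?U (\<lambda>j. nr_prob V x (edge v j))
        (\<lambda>R. \<phi> (insert v D) (S - {v} \<union> R))"
      using prod_exploration_step[OF finite_V DS v, where h = "\<lambda>j. - h j" and \<eta> = "- \<eta>" and x = x]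
      by (simp add: \<phi>_def mult.assoc)
    finally show "\<phi> D S \<le> subset_expectation ?U (\<lambda>j. nr_prob V x (edge v j))
        (\<lambda>R. \<phi> (insert v D) (S - {v} \<union> R))" .
  qed (use i in auto)
  then show ?thesis
    by (simp add: \<phi>_def sum_negf)
qed

text \<open>Here \<open>i \<mapsto> exp (h i + \<eta> * x i)\<close> is a supersolution of the
  branching recursion. Both discrepancies between the graph and the branching process help: fewer
  vertices are available than in \<open>V\<close>, and \<open>1 - exp (- a) \<le> a\<close>.\<close>

lemma generating_function_le:
  assumes h: "\<And>j. j \<in> V \<Longrightarrow> 0 \<le> h j" and "0 \<le> \<eta>"
    and le: "(\<Sum>j\<in>V. x j / sum x V * (exp (h j + \<eta> * x j) - 1)) \<le> \<eta>"
    and i: "i \<in> V"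
  shows "nr_expectation V x (\<lambda>E. exp (sum h (reach E {i}))) \<le> exp (h i + \<eta> * x i)"
proof -
  define \<phi> where "\<phi> = (\<lambda>D S. exp (sum h (D \<union> S) + \<eta> * sum x S))"
  have "subset_expectation (pairs (V - {})) (nr_prob V x) (\<lambda>E. \<phi> ({} \<union> reach E {i}) {}) \<le> \<phi> {} {i}"
  proof (rule exploration_ge[OF finite_V nr_prob_bounds])
    fix D S v assume DS: "D \<inter> S = {}" "D \<union> S \<subseteq> V" and v: "v \<in> S"
    let ?U = "V - (D \<union> S)"
    let ?a = "\<lambda>j. x v * x j / sum x V" and ?f = "\<lambda>j. exp (h j + \<eta> * x j)"
    have vV: "v \<in> V"
      using DS v by auto
    have a: "0 \<le> ?a j" if "j \<in> V" for j
      using that vV weight_nonneg weight_pos by auto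
    have f: "1 \<le> ?f j" if "j \<in> V" for j
      using h[OF that] mult_nonneg_nonneg[OF assms(2) weight_nonneg[OF that]] by auto
    have af: "0 \<le> ?a j * (?f j - 1)" if "j \<in> V" for j
      using a[OF that] f[OF that] by (intro mult_nonneg_nonneg) auto
    have "x v * (\<Sum>j\<in>V. x j / sum x V * (exp (h j + \<eta> * x j) - 1)) = (\<Sum>j\<in>V. ?a j * (?f j - 1))"
      by (simp add: sum_distrib_left algebra_simps)
    then have sum_le: "(\<Sum>j\<in>V. ?a j * (?f j - 1)) \<le> \<eta> * x v"
      using mult_left_mono[OF le weight_nonneg[OF vV]] by (simp only: mult.commute)
    have "(\<Prod>j\<in>?U. 1 - nr_prob V x (edge v j) + nr_prob V x (edge v j) * ?f j) \<le>
        (\<Prod>j\<in>?U. exp (?a j * (?f j - 1)))"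
    proof (rule prod_mono)
      fix j assume j: "j \<in> ?U"
      then have "0 \<le> (1 - exp (- ?a j)) * ?f j"
        using a[of j] by (intro mult_nonneg_nonneg) auto
      then show "0 \<le> 1 - nr_prob V x (edge v j) + nr_prob V x (edge v j) * ?f j \<and>
          1 - nr_prob V x (edge v j) + nr_prob V x (edge v j) * ?f j \<le> exp (?a j * (?f j - 1))"
        using j a[of j] f[of j] bernoulli_exp_mixture_le[of "?a j" "?f j"]
        by (simp add: nr_prob_edge add_nonneg_nonneg)
    qed
    also have "\<dots> = exp (\<Sum>j\<in>?U. ?a j * (?f j - 1))"
      using finite_V by (simp add: exp_sum)
    also have "\<dots> \<le> exp (\<eta> * x v)"
    proof -
      have "(\<Sum>j\<in>?U. ?a j * (?f j - 1)) \<le> (\<Sum>j\<in>V. ?a j * (?f j - 1))"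
        by (rule sum_mono2[OF finite_V]) (use af in auto)
      with sum_le show ?thesis
        by simp
    qed
    finally have "exp (- (\<eta> * x v)) *
        (\<Prod>j\<in>?U. 1 - nr_prob V x (edge v j) + nr_prob V x (edge v j) * ?f j) \<le>
        exp (- (\<eta> * x v)) * exp (\<eta> * x v)"
      by (intro mult_left_mono) auto
    then have one: "exp (- (\<eta> * x v)) *
        (\<Prod>j\<in>?U. 1 - nr_prob V x (edge v j) + nr_prob V x (edge v j) * ?f j) \<le> 1"
      by (simp add: exp_minus_inverse mult.commute)
    have "subset_expectation ?U (\<lambda>j. nr_prob V x (edge v j))
        (\<lambda>R. \<phi> (insert v D) (S - {v} \<union> R)) = \<phi> D S * (exp (- (\<eta> * x v)) *
        (\<Prod>j\<in>?U. 1 - nr_prob V x (edge v j) + nr_prob V x (edge v j) * ?f j))"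
      using prod_exploration_step[OF finite_V DS v, where h = h and \<eta> = \<eta> and x = x]
      by (simp add: \<phi>_def mult.assoc)
    also have "\<dots> \<le> \<phi> D S"
      using mult_left_mono[OF one, of "\<phi> D S"] by (simp add: \<phi>_def)
    finally show "subset_expectation ?U (\<lambda>j. nr_prob V x (edge v j))
        (\<lambda>R. \<phi> (insert v D) (S - {v} \<union> R)) \<le> \<phi> D S" .
  qed (use i in auto)
  then show ?thesis
    by (simp add: \<phi>_def)
qed

text \<open>The two terms subtracted from the solution \<open>1 + \<theta> * x i\<close> of the branching process recursion
  account for vertices that are no longer available and for \<open>1 - exp (- a) \<ge> a - a\<^sup>2 / 2\<close>.\<close>

lemma cluster_size_ge:
  fixes \<theta> :: real
  assumes "0 \<le> \<theta>"
    and \<theta>: "\<theta> \<le> (\<Sum>j\<in>V. x j / sum x V * (1 + \<theta> * x j))"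
    and i: "i \<in> V"
  shows "1 + \<theta> * x i \<le> nr_expectation V x (\<lambda>E. \<Sum>v\<in>reach E {i}.
    1 + x v * (\<Sum>j\<in>reach E {i}. x j / sum x V * (1 + \<theta> * x j)) +
    (x v)\<^sup>2 * (\<Sum>j\<in>V. (x j / sum x V)\<^sup>2 / 2 * (1 + \<theta> * x j)))"
proof -
  let ?g = "\<lambda>j. 1 + \<theta> * x j"
  let ?B = "\<lambda>A. \<Sum>j\<in>A. x j / sum x V * ?g j"
  let ?c = "\<lambda>v. (x v)\<^sup>2 * (\<Sum>j\<in>V. (x j / sum x V)\<^sup>2 / 2 * ?g j)"
  \<comment> \<open>An active vertex is credited with its branching value
    \<open>1 + \<theta> * x j\<close>; an explored vertex with itself and a bound for the deficit
    incurred at its exploration.\<close>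
  define \<phi> where "\<phi> = (\<lambda>D S. (\<Sum>v\<in>D. 1 + x v * ?B (D \<union> S) + ?c v) + sum ?g S)"
  have g: "0 \<le> ?g j" if "j \<in> V" for j
    using that assms(1) weight_nonneg by (auto intro!: add_nonneg_nonneg)
  have term_nonneg: "0 \<le> x j / sum x V * ?g j" if "j \<in> V" for j
    using that g weight_nonneg weight_pos by (intro mult_nonneg_nonneg divide_nonneg_pos) auto
  have "\<phi> {} {i} \<le> subset_expectation (pairs (V - {})) (nr_prob V x) (\<lambda>E. \<phi> ({} \<union> reach E {i}) {})"
  proof (rule exploration_le[OF finite_V nr_prob_bounds])
    fix D S v assume DS: "D \<inter> S = {}" "D \<union> S \<subseteq> V" and v: "v \<in> S"
    let ?U = "V - (D \<union> S)"
    let ?p = "\<lambda>j. nr_prob V x (edge v j)"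
    let ?a = "\<lambda>j. x v * x j / sum x V"
    let ?K = "(\<Sum>u\<in>D. 1 + x u * ?B (D \<union> S) + ?c u) + (1 + x v * ?B (D \<union> S) + ?c v) +
      (sum ?g S - ?g v)"
    have fin: "finite D" "finite S" "finite ?U"
      using DS finite_V finite_subset by blast+
    have vV: "v \<in> V" and vD: "v \<notin> D"
      using DS v by auto
    have a: "0 \<le> ?a j" if "j \<in> V" for j
      using that vV weight_nonneg weight_pos by auto
    have p: "?a j - (?a j)\<^sup>2 / 2 \<le> ?p j" if "j \<in> V" for j
    proof -
      have "exp (- ?a j) \<le> 1 - ?a j + (?a j)\<^sup>2 / 2"
      proof -
        have "\<exists>t. \<bar>t\<bar> \<le> \<bar>- ?a j\<bar> \<and> exp (- ?a j) = (\<Sum>m<3. (- ?a j) ^ m / fact m) + exp t / fact 3 * (- ?a j) ^ 3"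
          using Maclaurin_exp_le[of "- ?a j" 3] by simp
        then obtain t where "exp (- ?a j) = (\<Sum>m<3. (- ?a j) ^ m / fact m) + exp t / fact 3 * (- ?a j) ^ 3"
          by blast
        moreover have "exp t / fact 3 * (- ?a j) ^ 3 \<le> 0"
          using a[OF that] zero_le_power[OF a[OF that], of 3] by (intro mult_nonneg_nonpos) auto
        ultimately show ?thesis
          by (simp add: eval_nat_numeral)
      qed
      then show ?thesis
        by (simp add: nr_prob_edge)
    qed
    have "x v * \<theta> \<le> x v * ?B V"
      using \<theta> weight_nonneg[OF vV] by (intro mult_left_mono) auto
    also have "?B V = ?B (D \<union> S) + ?B ?U"
      by (subst sum.subset_diff[OF DS(2) finite_V]) (rule add.commute)
    also have "x v * (?B (D \<union> S) + ?B ?U) = x v * ?B (D \<union> S) + (\<Sum>j\<in>?U. ?a j * ?g j)"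
      by (simp add: distrib_left sum_distrib_left mult.assoc)
    also have "(\<Sum>j\<in>?U. ?a j * ?g j) \<le> (\<Sum>j\<in>?U. ?p j * ?g j + (?a j)\<^sup>2 / 2 * ?g j)"
    proof (rule sum_mono)
      fix j assume "j \<in> ?U"
      then have "(?a j - (?a j)\<^sup>2 / 2) * ?g j \<le> ?p j * ?g j"
        using p g by (intro mult_right_mono) auto
      then show "?a j * ?g j \<le> ?p j * ?g j + (?a j)\<^sup>2 / 2 * ?g j"
        by (simp add: algebra_simps)
    qed
    also have "\<dots> = (\<Sum>j\<in>?U. ?p j * ?g j) + (\<Sum>j\<in>?U. (?a j)\<^sup>2 / 2 * ?g j)"
      by (rule sum.distrib)
    also have "(\<Sum>j\<in>?U. (?a j)\<^sup>2 / 2 * ?g j) \<le> (\<Sum>j\<in>V. (?a j)\<^sup>2 / 2 * ?g j)"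
      by (rule sum_mono2[OF finite_V]) (use g in auto)
    also have "\<dots> = ?c v"
      by (simp add: sum_distrib_left power_mult_distrib power_divide mult.assoc)
    finally have key: "?g v \<le> 1 + x v * ?B (D \<union> S) + ?c v + (\<Sum>j\<in>?U. ?p j * ?g j)"
      by (simp add: mult.commute)
    have "\<phi> D S \<le> ?K + (\<Sum>j\<in>?U. ?p j * ?g j)"
      using key by (simp add: \<phi>_def)
    also have "\<dots> = subset_expectation ?U ?p (\<lambda>R. ?K + (\<Sum>j\<in>R. ?g j))"
      by (simp only: subset_expectation_add subset_expectation_const[OF fin(3)]
          subset_expectation_setsum[OF fin(3)])
    also have "\<dots> \<le> subset_expectation ?U ?p (\<lambda>R. \<phi> (insert v D) (S - {v} \<union> R))"
    proof (rule subset_expectation_mono)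
      show "0 \<le> ?p j \<and> ?p j \<le> 1" if "j \<in> ?U" for j
        using a[of j] that by (simp add: nr_prob_edge)
    next
      fix R assume R: "R \<subseteq> ?U"
      then have finR: "finite R"
        using fin finite_subset by blast
      have eq: "insert v D \<union> (S - {v} \<union> R) = D \<union> S \<union> R"
        using v by auto
      have "sum ?g (S - {v} \<union> R) = sum ?g (S - {v}) + sum ?g R"
        using R fin finR by (intro sum.union_disjoint) auto
      moreover have "sum ?g (S - {v}) = sum ?g S - ?g v"
        using v fin by (simp add: sum_diff1)
      \<comment> \<open>The deficits of vertices explored earlier are re-evaluated with all vertices
        known by now. As \<open>?B\<close> grows with its set this only raises
        \<open>\<phi>\<close>, and it lets the final value depend on the finished cluster
        alone.\<close>
      moreover have "?B (D \<union> S) \<le> ?B (D \<union> S \<union> R)"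
        by (rule sum_mono2) (use R DS fin finR term_nonneg in auto)
      then have "1 + x u * ?B (D \<union> S) + ?c u \<le> 1 + x u * ?B (D \<union> S \<union> R) + ?c u" if "u \<in> V" for u
        using weight_nonneg[OF that] by (auto intro!: mult_left_mono)
      then have "(\<Sum>u\<in>insert v D. 1 + x u * ?B (D \<union> S) + ?c u) \<le>
          (\<Sum>u\<in>insert v D. 1 + x u * ?B (D \<union> S \<union> R) + ?c u)"
        using DS vV by (intro sum_mono) auto
      then have "(\<Sum>u\<in>D. 1 + x u * ?B (D \<union> S) + ?c u) + (1 + x v * ?B (D \<union> S) + ?c v) \<le>
          (\<Sum>u\<in>insert v D. 1 + x u * ?B (D \<union> S \<union> R) + ?c u)"
        unfolding sum.insert[OF fin(1) vD] by linarith
      ultimately show "?K + (\<Sum>j\<in>R. ?g j) \<le> \<phi> (insert v D) (S - {v} \<union> R)"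
        unfolding \<phi>_def eq by linarith
    qed
    finally show "\<phi> D S \<le> subset_expectation ?U ?p (\<lambda>R. \<phi> (insert v D) (S - {v} \<union> R))" .
  qed (use i in auto)
  then show ?thesis
    by (simp add: \<phi>_def)
qed

end

section \<open>Elementary estimates for the exponential function\<close>

lemma one_minus_exp_le:
  fixes y :: real
  assumes "0 \<le> y" "y \<le> 1"
  shows "1 - exp (- y) \<le> y - y\<^sup>2 / 3"
proof -
  obtain t where "exp (- y) = (\<Sum>m<4. (- y) ^ m / fact m) + exp t / fact 4 * (- y) ^ 4"
    using Maclaurin_exp_le[of "- y" 4] by blast
  moreover have "0 \<le> exp t / fact 4 * (- y) ^ 4"
    by simp
  ultimately have "1 - y + y\<^sup>2 / 2 - y ^ 3 / 6 \<le> exp (- y)"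
    by (simp add: eval_nat_numeral)
  \<comment> \<open>For \<open>y \<le> 1\<close> the cubic Taylor term takes at most
    \<open>y\<^sup>2 / 6\<close> from \<open>y\<^sup>2 / 2\<close>, hence the constant
    \<open>1 / 3\<close>.\<close>
  moreover have "y ^ 3 \<le> y\<^sup>2"
    using power_decreasing[of 2 3 y] assms by simp
  ultimately show ?thesis
    by linarith
qed

lemma one_minus_exp_ge:
  fixes y :: real
  assumes "0 \<le> y" "y \<le> 1"
  shows "y / 2 \<le> 1 - exp (- y)"
proof -
  have "exp (- y) * exp y = 1" "1 + y \<le> exp y"
    by (simp_all add: exp_minus_inverse mult.commute)
  then have "exp (- y) * (1 + y) \<le> 1"
    using mult_left_mono[of "1 + y" "exp y" "exp (- y)"] by simp
  moreover have "1 \<le> (1 - y / 2) * (1 + y)"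
    using mult_left_le[of y y] assms by (simp add: algebra_simps)
  ultimately have "exp (- y) * (1 + y) \<le> (1 - y / 2) * (1 + y)"
    by linarith
  then show ?thesis
    using assms by (simp add: mult_le_cancel_right)
qed

lemma exp_minus_one_ge:
  fixes y :: real
  assumes "0 \<le> y"
  shows "y\<^sup>2 / 2 \<le> exp y - 1" "y ^ 3 / 6 \<le> exp y - 1"
proof -
  obtain t where "exp y = (\<Sum>m<4. y ^ m / fact m) + exp t / fact 4 * y ^ 4"
    using Maclaurin_exp_le[of y 4] by blast
  moreover have "0 \<le> exp t / fact 4 * y ^ 4"
    using assms by simp
  ultimately have "1 + y + y\<^sup>2 / 2 + y ^ 3 / 6 \<le> exp y"
    by (simp add: eval_nat_numeral)
  moreover have "0 \<le> y\<^sup>2" "0 \<le> y ^ 3"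
    using assms by auto
  ultimately show "y\<^sup>2 / 2 \<le> exp y - 1" "y ^ 3 / 6 \<le> exp y - 1"
    using assms by linarith+
qed

section \<open>Shares of small and large clusters, and subcritical moments\<close>

context nr_graph
begin

lemma mean_mono:
  "(\<And>E. E \<subseteq> pairs V \<Longrightarrow> g E \<le> g' E) \<Longrightarrow> nr_expectation V x g \<le> nr_expectation V x g'"
  by (rule subset_expectation_mono[OF nr_prob_bounds])

lemma mean_const: "nr_expectation V x (\<lambda>_. c) = c"
  using finite_V by (simp add: subset_expectation_const)

text \<open>The function \<open>1 - exp (- (h * k))\<close> behaves like the minimum of
  \<open>1\<close> and \<open>h * k\<close>. Assumption \<open>le\<close> is the subsolution
  condition with the exponential expanded to second order: the term with the third power sum has to
  pay for \<open>h\<close> and for any excess of the second power sum over the first.\<close>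

lemma truncated_cluster_bound:
  assumes "0 \<le> h" "0 \<le> \<eta>" "\<And>i. i \<in> V \<Longrightarrow> \<eta> * x i \<le> 1"
    and le: "h * sum x V + \<eta> * (\<Sum>i\<in>V. (x i)\<^sup>2) - \<eta>\<^sup>2 * (\<Sum>i\<in>V. (x i) ^ 3) / 3 \<le> \<eta> * sum x V"
  shows "(\<Sum>i\<in>V. nr_expectation V x (\<lambda>E. 1 - exp (- (h * real (card (reach E {i}))))))
    \<le> h * real (card V) + \<eta> * sum x V"
proof -
  let ?L = "sum x V"
  have "(\<Sum>j\<in>V. x j / ?L * (1 - exp (- (h + \<eta> * x j)))) \<le>
      (\<Sum>j\<in>V. x j / ?L * (h + \<eta> * x j - (\<eta> * x j)\<^sup>2 / 3))"
  proof (intro sum_mono mult_left_mono)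
    fix j assume j: "j \<in> V"
    let ?y = "\<eta> * x j"
    have y: "0 \<le> ?y" "?y \<le> 1"
      using j assms weight_nonneg by auto
    have "1 - exp (- (h + ?y)) = (1 - exp (- ?y)) + exp (- ?y) * (1 - exp (- h))"
      by (simp add: algebra_simps exp_add[symmetric])
    also have "exp (- ?y) * (1 - exp (- h)) \<le> 1 * h"
      using y exp_ge_add_one_self[of "- h"] assms(1) by (intro mult_mono) auto
    also have "1 - exp (- ?y) \<le> ?y - ?y\<^sup>2 / 3"
      by (rule one_minus_exp_le[OF y])
    finally show "1 - exp (- (h + ?y)) \<le> h + ?y - ?y\<^sup>2 / 3"
      by simp
  qed (use weight_nonneg weight_pos in auto)
  also have "\<dots> = (\<Sum>j\<in>V. h * x j + \<eta> * (x j)\<^sup>2 - \<eta>\<^sup>2 * (x j) ^ 3 / 3) / ?L"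
    unfolding sum_divide_distrib
    by (intro sum.cong refl) (simp add: field_simps power2_eq_square power3_eq_cube)
  also have "\<dots> = (h * ?L + \<eta> * (\<Sum>i\<in>V. (x i)\<^sup>2) - \<eta>\<^sup>2 * (\<Sum>i\<in>V. (x i) ^ 3) / 3) / ?L"
    by (simp add: sum.distrib sum_subtractf sum_distrib_left sum_divide_distrib)
  also have "\<dots> \<le> \<eta>"
    using le weight_pos by (simp add: pos_divide_le_eq)
  finally have cond: "(\<Sum>j\<in>V. x j / ?L * (1 - exp (- (h + \<eta> * x j)))) \<le> \<eta>" .
  have "nr_expectation V x (\<lambda>E. 1 - exp (- (h * real (card (reach E {i}))))) \<le> h + \<eta> * x i"
    if i: "i \<in> V" for i
  proof -
    have "exp (- (h + \<eta> * x i)) \<le> nr_expectation V x (\<lambda>E. exp (- sum (\<lambda>_. h) (reach E {i})))"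
      by (rule generating_function_ge) (use assms cond i in auto)
    moreover have "1 - (h + \<eta> * x i) \<le> exp (- (h + \<eta> * x i))"
      using exp_ge_add_one_self[of "- (h + \<eta> * x i)"] by linarith
    ultimately show ?thesis
      by (simp add: subset_expectation_diff mean_const mult.commute)
  qed
  then have "(\<Sum>i\<in>V. nr_expectation V x (\<lambda>E. 1 - exp (- (h * real (card (reach E {i})))))) \<le>
      (\<Sum>i\<in>V. h + \<eta> * x i)"
    by (rule sum_mono)
  then show ?thesis
    by (simp add: sum.distrib sum_distrib_left mult.commute)
qed

text \<open>In a cluster of more than \<open>t\<close> vertices each of them contributes at least
  \<open>1 / 2\<close> to \<open>?Z\<close>, so \<open>?Z\<close> is at least \<open>t / 2\<close>.
  Counting all vertices of the cluster in Markov's inequality is what gains the factor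
  \<open>1 / t\<close> over a union bound.\<close>

lemma large_cluster_probability_le:
  assumes "0 < h" "0 \<le> \<eta>" "\<And>i. i \<in> V \<Longrightarrow> \<eta> * x i \<le> 1"
    and le: "h * sum x V + \<eta> * (\<Sum>i\<in>V. (x i)\<^sup>2) - \<eta>\<^sup>2 * (\<Sum>i\<in>V. (x i) ^ 3) / 3 \<le> \<eta> * sum x V"
    and t: "1 \<le> h * t"
  shows "nr_expectation V x (\<lambda>E. if \<exists>i\<in>V. t < real (card (reach E {i})) then 1 else 0)
    \<le> 2 * (h * real (card V) + \<eta> * sum x V) / t"
proof -
  let ?Z = "\<lambda>E. \<Sum>i\<in>V. 1 - exp (- (h * real (card (reach E {i}))))"
  have t0: "0 < t"
    using t assms(1) by (metis less_le_trans zero_less_mult_pos zero_less_one)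
  have "nr_expectation V x (\<lambda>E. if \<exists>i\<in>V. t < real (card (reach E {i})) then 1 else 0) \<le>
      nr_expectation V x (\<lambda>E. 2 / t * ?Z E)"
  proof (rule mean_mono)
    fix E assume E: "E \<subseteq> pairs V"
    have Z: "0 \<le> 1 - exp (- (h * real (card (reach E {i}))))" for i
      using assms(1) by simp
    show "(if \<exists>i\<in>V. t < real (card (reach E {i})) then 1 else 0) \<le> 2 / t * ?Z E"
    proof (cases "\<exists>i\<in>V. t < real (card (reach E {i}))")
      case True
      then obtain i where i: "i \<in> V" "t < real (card (reach E {i}))"
        by blast
      have sub: "reach E {i} \<subseteq> V"
        using i by (intro reach_subset[OF E]) auto
      have "1 \<le> h * real (card (reach E {i}))"
        using t mult_left_mono[of t "real (card (reach E {i}))" h] i assms(1) by linarith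
      then have "exp (- (h * real (card (reach E {i})))) \<le> exp (- 1)"
        by simp
      then have half: "1 / 2 \<le> 1 - exp (- (h * real (card (reach E {i}))))"
        using one_minus_exp_ge[of 1] by linarith
      have "t / 2 \<le> (\<Sum>j\<in>reach E {i}. 1 / 2)"
        using i by simp
      also have "\<dots> \<le> (\<Sum>j\<in>reach E {i}. 1 - exp (- (h * real (card (reach E {j})))))"
      proof (rule sum_mono)
        fix j assume "j \<in> reach E {i}"
        with half show "1 / 2 \<le> 1 - exp (- (h * real (card (reach E {j}))))"
          by (simp add: reach_eq)
      qed
      also have "\<dots> \<le> ?Z E"
        by (rule sum_mono2[OF finite_V sub]) (use Z in auto)
      finally show ?thesis
        using True t0 by (simp add: field_simps)
    next
      case False
      then show ?thesis
        using t0 Z by (simp add: sum_nonneg)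
    qed
  qed
  also have "\<dots> = 2 / t * (\<Sum>i\<in>V. nr_expectation V x (\<lambda>E. 1 - exp (- (h * real (card (reach E {i}))))))"
    by (simp only: subset_expectation_cmult subset_expectation_sum)
  also have "\<dots> \<le> 2 / t * (h * real (card V) + \<eta> * sum x V)"
    using t0 assms by (intro mult_left_mono truncated_cluster_bound) auto
  finally show ?thesis
    by simp
qed

text \<open>While \<open>h * k < 1\<close>, the size \<open>k\<close> is at most
  \<open>2 / h\<close> times \<open>1 - exp (- (h * k))\<close>, so the truncated bound limits the
  share of small clusters in the mean.\<close>

lemma small_cluster_mean_le:
  assumes "0 < h" "0 \<le> \<eta>" "\<And>i. i \<in> V \<Longrightarrow> \<eta> * x i \<le> 1"
    and le: "h * sum x V + \<eta> * (\<Sum>i\<in>V. (x i)\<^sup>2) - \<eta>\<^sup>2 * (\<Sum>i\<in>V. (x i) ^ 3) / 3 \<le> \<eta> * sum x V"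
  shows "(\<Sum>i\<in>V. nr_expectation V x
      (\<lambda>E. if h * real (card (reach E {i})) < 1 then real (card (reach E {i})) else 0))
    \<le> 2 / h * (h * real (card V) + \<eta> * sum x V)"
proof -
  have "nr_expectation V x
      (\<lambda>E. if h * real (card (reach E {i})) < 1 then real (card (reach E {i})) else 0) \<le>
      2 / h * nr_expectation V x (\<lambda>E. 1 - exp (- (h * real (card (reach E {i})))))" for i
    unfolding subset_expectation_cmult[symmetric]
  proof (rule mean_mono)
    fix E
    let ?c = "real (card (reach E {i}))"
    show "(if h * ?c < 1 then ?c else 0) \<le> 2 / h * (1 - exp (- (h * ?c)))"
      using one_minus_exp_ge[of "h * ?c"] assms(1) by (auto simp: field_simps)
  qed
  then have "(\<Sum>i\<in>V. nr_expectation V x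
      (\<lambda>E. if h * real (card (reach E {i})) < 1 then real (card (reach E {i})) else 0)) \<le>
      2 / h * (\<Sum>i\<in>V. nr_expectation V x (\<lambda>E. 1 - exp (- (h * real (card (reach E {i}))))))"
    unfolding sum_distrib_left by (rule sum_mono)
  also have "\<dots> \<le> 2 / h * (h * real (card V) + \<eta> * sum x V)"
    using assms by (intro mult_left_mono truncated_cluster_bound) auto
  finally show ?thesis .
qed

text \<open>One functional dominating the size, the weight and the squared weights of a cluster. The
  correction terms of \<open>cluster_size_ge\<close> are products of such sums and become multiples
  of its square.\<close>

definition cluster_mass :: "(nat \<times> nat) set \<Rightarrow> nat \<Rightarrow> real" where
  "cluster_mass E i = (\<Sum>j\<in>reach E {i}. 1 + x j + (x j)\<^sup>2)"

lemma cluster_mass_bounds: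
  assumes "E \<subseteq> pairs V" "i \<in> V"
  shows "1 \<le> real (card (reach E {i}))" "real (card (reach E {i})) \<le> cluster_mass E i"
    "sum x (reach E {i}) \<le> cluster_mass E i" "(\<Sum>j\<in>reach E {i}. (x j)\<^sup>2) \<le> cluster_mass E i"
    "(\<Sum>j\<in>reach E {i}. x j + (x j)\<^sup>2) \<le> cluster_mass E i"
proof -
  have sub: "reach E {i} \<subseteq> V"
    using assms by (intro reach_subset) auto
  then have fin: "finite (reach E {i})"
    using finite_V finite_subset by blast
  moreover have "i \<in> reach E {i}"
    using subset_reach[of "{i}" E] by simp
  ultimately have "card (reach E {i}) \<noteq> 0"
    by auto
  then show "1 \<le> real (card (reach E {i}))"
    by simp
  have nn: "0 \<le> x j" if "j \<in> reach E {i}" for j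
    using that sub weight_nonneg by auto
  have "(\<Sum>j\<in>reach E {i}. 1) \<le> cluster_mass E i"
    unfolding cluster_mass_def by (rule sum_mono) (use nn in auto)
  then show "real (card (reach E {i})) \<le> cluster_mass E i"
    by simp
  show "sum x (reach E {i}) \<le> cluster_mass E i" "(\<Sum>j\<in>reach E {i}. (x j)\<^sup>2) \<le> cluster_mass E i"
    "(\<Sum>j\<in>reach E {i}. x j + (x j)\<^sup>2) \<le> cluster_mass E i"
    unfolding cluster_mass_def by (rule sum_mono, use nn in auto)+
qed

text \<open>By \<open>m2\<close> the supersolution condition has a slack of
  \<open>\<eta> * \<kappa> / 2\<close>, which absorbs both \<open>h\<close> and the second-order
  part of the exponential. So \<open>\<eta>\<close> may be of order \<open>\<kappa>\<close> and
  \<open>h\<close> of order \<open>\<kappa>\<^sup>2\<close>: masses are controlled on the scale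
  \<open>1 / \<kappa>\<^sup>2\<close>.\<close>

lemma subcritical_exponential_moment:
  assumes "1 \<le> A" "0 < \<kappa>" "\<kappa> \<le> 1" "\<And>i. i \<in> V \<Longrightarrow> \<kappa> * x i \<le> 1"
    and m0: "(\<Sum>i\<in>V. 1 + x i + (x i)\<^sup>2) \<le> A * real (card V)"
    and m1: "(\<Sum>i\<in>V. x i * (1 + x i + (x i)\<^sup>2)) \<le> A * sum x V"
    and m2: "(\<Sum>i\<in>V. (x i)\<^sup>2) \<le> (1 - \<kappa> / 2) * sum x V"
  defines "h \<equiv> \<kappa>\<^sup>2 / (96 * A\<^sup>2)"
  shows "(\<Sum>i\<in>V. nr_expectation V x (\<lambda>E. exp (h * cluster_mass E i) - 1)) \<le> real (card V) * \<kappa>"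
proof -
  let ?L = "sum x V"
  \<comment> \<open>The slack \<open>\<eta> * \<kappa> / 2 = \<kappa>\<^sup>2 / (16 * A)\<close> is
    used up exactly, since \<open>3 * h * A\<close> and \<open>2 * \<eta>\<^sup>2 * A\<close> both
    equal \<open>\<kappa>\<^sup>2 / (32 * A)\<close>.\<close>
  define \<eta> where "\<eta> = \<kappa> / (8 * A)"
  define y where "y = (\<lambda>j. h * (1 + x j + (x j)\<^sup>2) + \<eta> * x j)"
  have pos: "0 \<le> h" "0 \<le> \<eta>"
    using assms by (auto simp: h_def \<eta>_def)
  have h_le: "h \<le> \<kappa>\<^sup>2 / 96"
    using assms(1) unfolding h_def
    by (intro divide_left_mono) (auto intro: mult_mono simp: power2_eq_square mult_ge1_I)
  have \<eta>_le: "\<eta> \<le> \<kappa> / 8"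
    using assms(1,2) unfolding \<eta>_def by (intro divide_left_mono) auto
  have hq: "h * (1 + x j + (x j)\<^sup>2) \<le> 1 / 32" if "j \<in> V" for j
  proof -
    have "h * (1 + x j + (x j)\<^sup>2) \<le> \<kappa>\<^sup>2 / 96 * (1 + x j + (x j)\<^sup>2)"
      using weight_nonneg[OF that] h_le by (intro mult_right_mono) auto
    also have "\<dots> = (\<kappa> * \<kappa> + \<kappa> * (\<kappa> * x j) + (\<kappa> * x j) * (\<kappa> * x j)) / 96"
      by (simp add: field_simps power2_eq_square)
    also have "\<dots> \<le> (1 * 1 + 1 * 1 + 1 * 1) / 96"
      using assms(2,3) assms(4)[OF that] weight_nonneg[OF that]
      by (intro divide_right_mono add_mono mult_mono) auto
    finally show ?thesis
      by simp
  qed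
  have y: "0 \<le> y j" "y j \<le> 1" if "j \<in> V" for j
  proof -
    have "\<eta> * x j \<le> \<kappa> / 8 * x j"
      using \<eta>_le weight_nonneg[OF that] by (rule mult_right_mono)
    then show "y j \<le> 1"
      using hq[OF that] assms(4)[OF that] by (simp add: y_def)
    show "0 \<le> y j"
      using pos weight_nonneg[OF that] by (simp add: y_def)
  qed
  have exp_le: "exp (y j) - 1 \<le> y j + (y j)\<^sup>2" if "j \<in> V" for j
    using exp_bound[OF y[OF that]] by simp
  have "(\<Sum>j\<in>V. x j / ?L * (exp (y j) - 1)) \<le>
      (\<Sum>j\<in>V. x j / ?L * (3 * h * (1 + x j + (x j)\<^sup>2) + \<eta> * x j + 2 * \<eta>\<^sup>2 * (x j)\<^sup>2))"
  proof (intro sum_mono mult_left_mono)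
    fix j assume j: "j \<in> V"
    let ?u = "h * (1 + x j + (x j)\<^sup>2)" and ?v = "\<eta> * x j"
    \<comment> \<open>The small part \<open>?u\<close> absorbs twice its square, whence the factor
      \<open>3\<close>; only \<open>?v\<close> is left at second order.\<close>
    have "0 \<le> (?u - ?v)\<^sup>2"
      by simp
    then have "(?u + ?v)\<^sup>2 \<le> 2 * ?u\<^sup>2 + 2 * ?v\<^sup>2"
      by (simp add: power2_sum power2_diff)
    moreover have "?u\<^sup>2 \<le> ?u"
      using hq[OF j] pos weight_nonneg[OF j] unfolding power2_eq_square
      by (intro mult_left_le) auto
    ultimately have "exp (y j) - 1 \<le> 3 * ?u + ?v + 2 * ?v\<^sup>2"
      using exp_le[OF j] unfolding y_def by linarith
    then show "exp (y j) - 1 \<le> 3 * h * (1 + x j + (x j)\<^sup>2) + \<eta> * x j + 2 * \<eta>\<^sup>2 * (x j)\<^sup>2"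
      by (simp add: power_mult_distrib mult.assoc)
  qed (use weight_nonneg weight_pos in auto)
  also have "\<dots> = (3 * h * (\<Sum>j\<in>V. x j * (1 + x j + (x j)\<^sup>2)) + \<eta> * (\<Sum>j\<in>V. (x j)\<^sup>2) +
      2 * \<eta>\<^sup>2 * (\<Sum>j\<in>V. (x j) ^ 3)) / ?L"
    unfolding sum_distrib_left sum.distrib[symmetric] sum_divide_distrib
    by (intro sum.cong refl) (simp add: field_simps power2_eq_square power3_eq_cube)
  also have "\<dots> \<le> (3 * h * (A * ?L) + \<eta> * ((1 - \<kappa> / 2) * ?L) + 2 * \<eta>\<^sup>2 * (A * ?L)) / ?L"
  proof -
    have "(\<Sum>j\<in>V. (x j) ^ 3) \<le> (\<Sum>j\<in>V. x j * (1 + x j + (x j)\<^sup>2))"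
      by (intro sum_mono) (use weight_nonneg in
        \<open>auto simp: power3_eq_cube power2_eq_square distrib_left\<close>)
    with m1 have "(\<Sum>j\<in>V. (x j) ^ 3) \<le> A * ?L"
      by linarith
    then show ?thesis
      using m1 m2 pos weight_pos by (intro divide_right_mono add_mono mult_left_mono) auto
  qed
  also have "\<dots> = \<eta>"
  proof -
    have "3 * h * A + \<eta> * (1 - \<kappa> / 2) + 2 * \<eta>\<^sup>2 * A = \<eta>"
      using assms(1,2) by (simp add: h_def \<eta>_def field_simps power2_eq_square)
    moreover have "(3 * h * (A * ?L) + \<eta> * ((1 - \<kappa> / 2) * ?L) + 2 * \<eta>\<^sup>2 * (A * ?L)) / ?L =
        3 * h * A + \<eta> * (1 - \<kappa> / 2) + 2 * \<eta>\<^sup>2 * A"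
      using weight_pos by (simp add: add_divide_distrib)
    ultimately show ?thesis
      by simp
  qed
  finally have cond: "(\<Sum>j\<in>V. x j / ?L * (exp (h * (1 + x j + (x j)\<^sup>2) + \<eta> * x j) - 1)) \<le> \<eta>"
    by (simp add: y_def)
  have "nr_expectation V x (\<lambda>E. exp (h * cluster_mass E i) - 1) \<le> 2 * y i" if i: "i \<in> V" for i
  proof -
    have "nr_expectation V x (\<lambda>E. exp (sum (\<lambda>j. h * (1 + x j + (x j)\<^sup>2)) (reach E {i}))) \<le>
        exp (h * (1 + x i + (x i)\<^sup>2) + \<eta> * x i)"
      by (rule generating_function_le) (use cond i pos weight_nonneg in auto)
    then have "nr_expectation V x (\<lambda>E. exp (h * cluster_mass E i)) \<le> exp (y i)"
      by (simp add: cluster_mass_def y_def sum_distrib_left)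
    moreover have "(y i)\<^sup>2 \<le> y i"
      using y[OF i] unfolding power2_eq_square by (intro mult_left_le) auto
    ultimately show ?thesis
      using exp_le[OF i] by (simp add: subset_expectation_diff mean_const)
  qed
  then have "(\<Sum>i\<in>V. nr_expectation V x (\<lambda>E. exp (h * cluster_mass E i) - 1)) \<le> (\<Sum>i\<in>V. 2 * y i)"
    by (rule sum_mono)
  also have "\<dots> = 2 * (h * (\<Sum>i\<in>V. 1 + x i + (x i)\<^sup>2) + \<eta> * ?L)"
    unfolding y_def sum_distrib_left[symmetric] sum.distrib by simp
  also have "\<dots> \<le> 2 * (h * (A * real (card V)) + \<eta> * (A * real (card V)))"
  proof -
    have "?L \<le> (\<Sum>i\<in>V. 1 + x i + (x i)\<^sup>2)"
      by (rule sum_mono) simp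
    with m0 have "?L \<le> A * real (card V)"
      by linarith
    then show ?thesis
      using m0 pos by (intro mult_left_mono add_mono) auto
  qed
  also have "\<dots> = real (card V) * (2 * (h * A + \<eta> * A))"
    by (simp add: algebra_simps)
  also have "\<dots> \<le> real (card V) * \<kappa>"
  proof (intro mult_left_mono)
    have "h * A = \<kappa> * \<kappa> / (96 * A)" "\<eta> * A = \<kappa> / 8"
      using assms(1) by (auto simp: h_def \<eta>_def power2_eq_square)
    moreover have "\<kappa> * \<kappa> / (96 * A) \<le> \<kappa> * 1 / 96"
      using assms(1-3) by (intro frac_le mult_left_mono) auto
    ultimately show "2 * (h * A + \<eta> * A) \<le> \<kappa>"
      using assms(2) by simp
  qed simp
  finally show ?thesis .
qed

text \<open>Summed over \<open>V\<close>, the branching values give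
  \<open>card V + \<theta> * sum x V\<close>. The corrections are at most
  \<open>2 * A * \<theta> / sum x V\<close> times the second moments of \<open>cluster_mass\<close>,
  whose total is at most of order \<open>card V / \<kappa> ^ 3\<close>; by \<open>large\<close> this
  takes away at most half of the main term \<open>\<theta> * sum x V\<close>.\<close>

lemma subcritical_cluster_size_ge:
  assumes "1 \<le> A" "0 < \<kappa>" "\<kappa> \<le> 1 / 2" "\<And>i. i \<in> V \<Longrightarrow> \<kappa> * x i \<le> 1"
    and N: "real (card V) \<le> A * sum x V"
    and m0: "(\<Sum>i\<in>V. 1 + x i + (x i)\<^sup>2) \<le> A * real (card V)"
    and m1: "(\<Sum>i\<in>V. x i * (1 + x i + (x i)\<^sup>2)) \<le> A * sum x V"
    and m2: "(1 - 2 * \<kappa>) * sum x V \<le> (\<Sum>i\<in>V. (x i)\<^sup>2)"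
      "(\<Sum>i\<in>V. (x i)\<^sup>2) \<le> (1 - \<kappa> / 2) * sum x V"
    and large: "8 * A ^ 3 * (96 * A\<^sup>2)\<^sup>2 \<le> real (card V) * \<kappa> ^ 3"
  shows "real (card V) / (4 * A * \<kappa>) \<le> (\<Sum>i\<in>V. nr_expectation V x (\<lambda>E. real (card (reach E {i}))))"
proof -
  let ?L = "sum x V" and ?N = "real (card V)"
  define h where "h = \<kappa>\<^sup>2 / (96 * A\<^sup>2)"
  \<comment> \<open>The fixed point of the mean recursion at the lower end allowed by
    \<open>m2\<close>: \<open>1 + \<theta> * (1 - 2 * \<kappa>) = \<theta>\<close>.\<close>
  define \<theta> where "\<theta> = 1 / (2 * \<kappa>)"
  have \<theta>1: "1 \<le> \<theta>" and h0: "0 < h"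
    using assms(1-3) by (auto simp: \<theta>_def h_def field_simps)
  have mass2: "(\<Sum>i\<in>V. nr_expectation V x (\<lambda>E. (cluster_mass E i)\<^sup>2)) \<le> 2 / h\<^sup>2 * (?N * \<kappa>)"
  proof -
    have "nr_expectation V x (\<lambda>E. (cluster_mass E i)\<^sup>2) \<le>
        2 / h\<^sup>2 * nr_expectation V x (\<lambda>E. exp (h * cluster_mass E i) - 1)" if "i \<in> V" for i
      unfolding subset_expectation_cmult[symmetric]
    proof (rule mean_mono)
      fix E assume "E \<subseteq> pairs V"
      then have "0 \<le> cluster_mass E i"
        using cluster_mass_bounds[of E i] that by linarith
      then show "(cluster_mass E i)\<^sup>2 \<le> 2 / h\<^sup>2 * (exp (h * cluster_mass E i) - 1)"
        using exp_minus_one_ge(1)[of "h * cluster_mass E i"] h0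
        by (simp add: field_simps power_mult_distrib)
    qed
    then have "(\<Sum>i\<in>V. nr_expectation V x (\<lambda>E. (cluster_mass E i)\<^sup>2)) \<le>
        2 / h\<^sup>2 * (\<Sum>i\<in>V. nr_expectation V x (\<lambda>E. exp (h * cluster_mass E i) - 1))"
      unfolding sum_distrib_left by (rule sum_mono)
    also have "\<dots> \<le> 2 / h\<^sup>2 * (?N * \<kappa>)"
      unfolding h_def by (intro mult_left_mono subcritical_exponential_moment) (use assms in auto)
    finally show ?thesis .
  qed
  have m3: "(\<Sum>j\<in>V. (x j)\<^sup>2 * (1 + \<theta> * x j)) \<le> \<theta> * (A * ?L)"
  proof -
    have "(\<Sum>j\<in>V. (x j)\<^sup>2 * (1 + \<theta> * x j)) \<le> (\<Sum>j\<in>V. \<theta> * (x j * (1 + x j + (x j)\<^sup>2)))"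
    proof (rule sum_mono)
      fix j assume j: "j \<in> V"
      have "(x j)\<^sup>2 * 1 \<le> (x j)\<^sup>2 * \<theta>"
        using \<theta>1 by (intro mult_left_mono) auto
      moreover have "0 \<le> \<theta> * x j"
        using \<theta>1 weight_nonneg[OF j] by simp
      ultimately show "(x j)\<^sup>2 * (1 + \<theta> * x j) \<le> \<theta> * (x j * (1 + x j + (x j)\<^sup>2))"
        by (simp add: algebra_simps power2_eq_square)
    qed
    also have "\<dots> \<le> \<theta> * (A * ?L)"
      unfolding sum_distrib_left[symmetric] using m1 \<theta>1 by (intro mult_left_mono) auto
    finally show ?thesis .
  qed
  have "\<theta> \<le> (\<Sum>j\<in>V. x j / ?L * (1 + \<theta> * x j))"
  proof -
    have "(\<Sum>j\<in>V. x j / ?L * (1 + \<theta> * x j)) = (\<Sum>j\<in>V. x j + \<theta> * (x j)\<^sup>2) / ?L"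
      unfolding sum_divide_distrib
      by (intro sum.cong refl) (simp add: field_simps power2_eq_square)
    also have "\<dots> = (?L + \<theta> * (\<Sum>j\<in>V. (x j)\<^sup>2)) / ?L"
      by (simp add: sum.distrib sum_distrib_left)
    also have "\<dots> \<ge> (?L + \<theta> * ((1 - 2 * \<kappa>) * ?L)) / ?L"
      using m2(1) \<theta>1 weight_pos by (intro divide_right_mono add_left_mono mult_left_mono) auto
    also have "(?L + \<theta> * ((1 - 2 * \<kappa>) * ?L)) / ?L = \<theta>"
      using weight_pos assms(2) by (simp add: \<theta>_def field_simps)
    finally show ?thesis .
  qed
  note size = cluster_size_ge[OF order_trans[OF zero_le_one \<theta>1] this]
  have "1 + \<theta> * x i \<le> nr_expectation V x (\<lambda>E. real (card (reach E {i}))) +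
      2 * A * \<theta> / ?L * nr_expectation V x (\<lambda>E. (cluster_mass E i)\<^sup>2)" if i: "i \<in> V" for i
    unfolding subset_expectation_cmult[symmetric] subset_expectation_add[symmetric]
  proof (rule order_trans[OF size[OF i] mean_mono])
    fix E assume E: "E \<subseteq> pairs V"
    let ?C = "reach E {i}" and ?T = "cluster_mass E i"
    note bounds = cluster_mass_bounds[OF E i]
    have sub: "?C \<subseteq> V"
      using i by (intro reach_subset[OF E]) auto
    have nn: "0 \<le> x j" if "j \<in> ?C" for j
      using that sub weight_nonneg by auto
    have T1: "1 \<le> ?T"
      using bounds by linarith
    have B: "(\<Sum>j\<in>?C. x j / ?L * (1 + \<theta> * x j)) \<le> \<theta> * ?T / ?L"
    proof -
      have "(\<Sum>j\<in>?C. x j / ?L * (1 + \<theta> * x j)) \<le> (\<Sum>j\<in>?C. \<theta> * (x j + (x j)\<^sup>2) / ?L)"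
      proof (rule sum_mono)
        fix j assume j: "j \<in> ?C"
        have "x j * 1 \<le> x j * \<theta>"
          using \<theta>1 nn[OF j] by (intro mult_left_mono) auto
        then have "x j * (1 + \<theta> * x j) \<le> \<theta> * (x j + (x j)\<^sup>2)"
          by (simp add: algebra_simps power2_eq_square)
        then show "x j / ?L * (1 + \<theta> * x j) \<le> \<theta> * (x j + (x j)\<^sup>2) / ?L"
          using weight_pos by (simp add: divide_right_mono)
      qed
      also have "\<dots> = \<theta> * (\<Sum>j\<in>?C. x j + (x j)\<^sup>2) / ?L"
        by (simp add: sum_distrib_left sum_divide_distrib)
      also have "\<dots> \<le> \<theta> * ?T / ?L"
        using bounds(5) \<theta>1 weight_pos by (intro divide_right_mono mult_left_mono) auto
      finally show ?thesis .
    qed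
    have B0: "0 \<le> (\<Sum>j\<in>?C. x j / ?L * (1 + \<theta> * x j))"
      using nn \<theta>1 weight_pos by (intro sum_nonneg mult_nonneg_nonneg) auto
    have D: "(\<Sum>j\<in>V. (x j / ?L)\<^sup>2 / 2 * (1 + \<theta> * x j)) \<le> \<theta> * A / ?L"
    proof -
      have "(\<Sum>j\<in>V. (x j / ?L)\<^sup>2 / 2 * (1 + \<theta> * x j)) =
          (\<Sum>j\<in>V. (x j)\<^sup>2 * (1 + \<theta> * x j)) / (2 * ?L\<^sup>2)"
        unfolding sum_divide_distrib by (intro sum.cong refl) (simp add: power_divide)
      also have "\<dots> \<le> \<theta> * (A * ?L) / (2 * ?L\<^sup>2)"
        using m3 by (intro divide_right_mono) auto
      also have "\<dots> = (\<theta> * A / ?L) / 2"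
        using weight_pos by (simp add: power2_eq_square)
      also have "\<dots> \<le> \<theta> * A / ?L"
      proof -
        have "r / 2 \<le> r" if "0 \<le> r" for r :: real
          using that by simp
        moreover have "0 \<le> \<theta> * A / ?L"
          using \<theta>1 assms(1) weight_pos by simp
        ultimately show ?thesis
          by blast
      qed
      finally show ?thesis .
    qed
    have D0: "0 \<le> (\<Sum>j\<in>V. (x j / ?L)\<^sup>2 / 2 * (1 + \<theta> * x j))"
      using weight_nonneg \<theta>1 by (intro sum_nonneg mult_nonneg_nonneg) auto
    have "(\<Sum>v\<in>?C. 1 + x v * (\<Sum>j\<in>?C. x j / ?L * (1 + \<theta> * x j)) +
        (x v)\<^sup>2 * (\<Sum>j\<in>V. (x j / ?L)\<^sup>2 / 2 * (1 + \<theta> * x j))) =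
        real (card ?C) + sum x ?C * (\<Sum>j\<in>?C. x j / ?L * (1 + \<theta> * x j)) +
        (\<Sum>v\<in>?C. (x v)\<^sup>2) * (\<Sum>j\<in>V. (x j / ?L)\<^sup>2 / 2 * (1 + \<theta> * x j))"
      by (simp add: sum.distrib sum_distrib_right[symmetric])
    also have "\<dots> \<le> real (card ?C) + ?T * (\<theta> * ?T / ?L) + ?T * (\<theta> * A / ?L)"
      using bounds B B0 D D0 T1 by (intro add_mono mult_mono order_refl) auto
    also have "\<dots> \<le> real (card ?C) + A * \<theta> / ?L * ?T\<^sup>2 + A * \<theta> / ?L * ?T\<^sup>2"
    proof -
      have "1 * (\<theta> * ?T\<^sup>2 / ?L) \<le> A * (\<theta> * ?T\<^sup>2 / ?L)"
        using assms(1) \<theta>1 weight_pos by (intro mult_right_mono) auto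
      then have "?T * (\<theta> * ?T / ?L) \<le> A * \<theta> / ?L * ?T\<^sup>2"
        by (simp add: power2_eq_square mult_ac)
      moreover have "(A * \<theta> / ?L) * ?T \<le> (A * \<theta> / ?L) * ?T\<^sup>2"
        using assms(1) \<theta>1 weight_pos T1 by (intro mult_left_mono self_le_power) auto
      then have "?T * (\<theta> * A / ?L) \<le> A * \<theta> / ?L * ?T\<^sup>2"
        by (simp only: mult_ac times_divide_eq_left times_divide_eq_right)
      ultimately show ?thesis
        by (intro add_mono order_refl)
    qed
    finally show "(\<Sum>v\<in>?C. 1 + x v * (\<Sum>j\<in>?C. x j / ?L * (1 + \<theta> * x j)) +
        (x v)\<^sup>2 * (\<Sum>j\<in>V. (x j / ?L)\<^sup>2 / 2 * (1 + \<theta> * x j))) \<le>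
        real (card ?C) + 2 * A * \<theta> / ?L * ?T\<^sup>2"
      by (simp add: mult.assoc)
  qed
  then have "(\<Sum>i\<in>V. 1 + \<theta> * x i) \<le> (\<Sum>i\<in>V. nr_expectation V x (\<lambda>E. real (card (reach E {i})))) +
      2 * A * \<theta> / ?L * (\<Sum>i\<in>V. nr_expectation V x (\<lambda>E. (cluster_mass E i)\<^sup>2))"
    unfolding sum_distrib_left sum.distrib[symmetric] by (rule sum_mono)
  also have "\<dots> \<le> (\<Sum>i\<in>V. nr_expectation V x (\<lambda>E. real (card (reach E {i})))) +
      2 * A * \<theta> / ?L * (2 / h\<^sup>2 * (?N * \<kappa>))"
    using mass2 assms(1) \<theta>1 weight_pos by (intro add_left_mono mult_left_mono) auto
  also have "2 * A * \<theta> / ?L * (2 / h\<^sup>2 * (?N * \<kappa>)) \<le> \<theta> * ?L / 2"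
  proof -
    have L2: "?N \<le> A * ?L" "0 < ?L" "0 < ?N"
      using N weight_pos finite_V by (auto simp: card_gt_0_iff)
    have "2 * A * (2 / h\<^sup>2 * (?N * \<kappa>)) = 4 * A * (96 * A\<^sup>2)\<^sup>2 * ?N / \<kappa> ^ 3"
      using assms(1,2) by (simp add: h_def field_simps eval_nat_numeral)
    also have "\<dots> \<le> ?N * ?N / (2 * A\<^sup>2)"
    proof -
      have "8 * A ^ 3 * (96 * A\<^sup>2)\<^sup>2 * ?N \<le> ?N * \<kappa> ^ 3 * ?N"
        using large by (intro mult_right_mono) auto
      then show ?thesis
        using assms(1,2) by (simp add: field_simps eval_nat_numeral)
    qed
    also have "\<dots> \<le> (A * ?L) * (A * ?L) / (2 * A\<^sup>2)"
      using L2 assms(1) by (intro divide_right_mono mult_mono) auto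
    also have "\<dots> = ?L * ?L / 2"
      using assms(1) by (simp add: power2_eq_square)
    finally have "2 * A * (2 / h\<^sup>2 * (?N * \<kappa>)) * (\<theta> / ?L) \<le> ?L * ?L / 2 * (\<theta> / ?L)"
      using \<theta>1 L2 by (intro mult_right_mono) auto
    then show ?thesis
      using L2 by (simp add: field_simps)
  qed
  finally have "(\<Sum>i\<in>V. 1 + \<theta> * x i) \<le>
      (\<Sum>i\<in>V. nr_expectation V x (\<lambda>E. real (card (reach E {i})))) + \<theta> * ?L / 2"
    by simp
  moreover have "(\<Sum>i\<in>V. 1 + \<theta> * x i) = ?N + \<theta> * ?L"
    by (simp add: sum.distrib sum_distrib_left)
  moreover have "?N / (4 * A * \<kappa>) \<le> \<theta> * ?L / 2"
  proof -
    have "?N / (4 * A * \<kappa>) \<le> (A * ?L) / (4 * A * \<kappa>)"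
      using N assms(1,2) by (intro divide_right_mono) auto
    then show ?thesis
      using assms(1,2) by (simp add: \<theta>_def field_simps)
  qed
  ultimately show ?thesis
    by linarith
qed

lemma no_large_cluster_probability_le:
  assumes "1 \<le> A" "0 < \<kappa>" "\<kappa> \<le> 1 / (32 * A)" "\<And>i. i \<in> V \<Longrightarrow> \<kappa> * x i \<le> 1 / (800 * A\<^sup>2)"
    and N: "real (card V) \<le> A * sum x V"
    and m0: "(\<Sum>i\<in>V. 1 + x i + (x i)\<^sup>2) \<le> A * real (card V)"
    and m1: "(\<Sum>i\<in>V. x i * (1 + x i + (x i)\<^sup>2)) \<le> A * sum x V"
    and m2: "(1 - 2 * \<kappa>) * sum x V \<le> (\<Sum>i\<in>V. (x i)\<^sup>2)"
      "(\<Sum>i\<in>V. (x i)\<^sup>2) \<le> (1 - \<kappa> / 2) * sum x V"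
    and m3: "sum x V / 8 \<le> (\<Sum>i\<in>V. (x i) ^ 3)"
    and large: "8 * A ^ 3 * (96 * A\<^sup>2)\<^sup>2 \<le> real (card V) * \<kappa> ^ 3"
  defines "d \<equiv> 1 / (160 * A\<^sup>2)"
  shows "nr_expectation V x
      (\<lambda>E. if \<forall>i\<in>V. real (card (reach E {i})) < d\<^sup>2 / \<kappa>\<^sup>2 then 1 else 0)
    \<le> 384 * A\<^sup>2 * (96 * A\<^sup>2) ^ 3 / (real (card V) * \<kappa> ^ 3)"
proof -
  let ?L = "sum x V" and ?N = "real (card V)"
  define h where "h = \<kappa>\<^sup>2 / (96 * A\<^sup>2)"
  \<comment> \<open>Truncation from below keeps \<open>f\<close> monotone, as the correlation
    inequality demands, and if no cluster reaches the threshold then the sum of \<open>f\<close>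
    over all vertices vanishes.\<close>
  define f where "f = (\<lambda>k::nat. if d\<^sup>2 / \<kappa>\<^sup>2 \<le> real k then real k else 0)"
  let ?M = "\<Sum>i\<in>V. nr_expectation V x (\<lambda>E. f (card (reach E {i})))"
  have d0: "0 < d" and d1: "d \<le> 1"
    using assms(1) by (auto simp: d_def field_simps power2_eq_square intro: mult_ge1_I)
  have \<kappa>1: "\<kappa> \<le> 1 / 2" "\<kappa> \<le> 1"
  proof -
    have "1 / (32 * A) \<le> 1 / (32 * 1)"
      using assms(1) by (intro divide_left_mono) auto
    then show "\<kappa> \<le> 1 / 2" "\<kappa> \<le> 1"
      using assms(3) by linarith+
  qed
  have \<kappa>x: "\<kappa> * x i \<le> d / 5" "\<kappa> * x i \<le> 1" if "i \<in> V" for i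
    using assms(4)[OF that] d1 by (auto simp: d_def)
  have N0: "0 < ?N"
    using weight_pos finite_V by (auto simp: card_gt_0_iff)
  have h0: "0 < h"
    using assms(1,2) by (simp add: h_def)
  have size: "?N / (4 * A * \<kappa>) \<le> (\<Sum>i\<in>V. nr_expectation V x (\<lambda>E. real (card (reach E {i}))))"
    by (rule subcritical_cluster_size_ge) (use assms \<kappa>1 \<kappa>x in auto)
  have small: "(\<Sum>i\<in>V. nr_expectation V x
      (\<lambda>E. if \<kappa>\<^sup>2 / d\<^sup>2 * real (card (reach E {i})) < 1 then real (card (reach E {i})) else 0)) \<le>
      ?N / (8 * A * \<kappa>)"
  proof -
    \<comment> \<open>Here the truncated bound has parameters
      \<open>\<kappa>\<^sup>2 / d\<^sup>2\<close> and \<open>5 * \<kappa> / d\<close>. As the third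
      power sum is at least \<open>?L / 8\<close>, the gain is \<open>25 / 24\<close> of what the
      first parameter costs. Each of the two resulting terms is at most a quarter of the lower bound
      in \<open>size\<close>: one by the choice of \<open>d\<close>, the other by
      \<open>\<kappa> \<le> 1 / (32 * A)\<close>.\<close>
    have "(\<Sum>i\<in>V. nr_expectation V x
        (\<lambda>E. if \<kappa>\<^sup>2 / d\<^sup>2 * real (card (reach E {i})) < 1 then real (card (reach E {i})) else 0)) \<le>
        2 / (\<kappa>\<^sup>2 / d\<^sup>2) * (\<kappa>\<^sup>2 / d\<^sup>2 * ?N + 5 * \<kappa> / d * ?L)"
    proof (rule small_cluster_mean_le)
      show "5 * \<kappa> / d * x i \<le> 1" if "i \<in> V" for i
        using \<kappa>x[OF that] d0 by (simp add: field_simps)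
      have "(\<Sum>i\<in>V. (x i)\<^sup>2) \<le> 1 * ?L"
        using m2(2) mult_right_mono[of "1 - \<kappa> / 2" 1 ?L] weight_pos assms(2) by linarith
      then have "5 * \<kappa> / d * (\<Sum>i\<in>V. (x i)\<^sup>2) \<le> 5 * \<kappa> / d * ?L"
        using assms(2) d0 by (intro mult_left_mono) auto
      moreover have "(5 * \<kappa> / d)\<^sup>2 * (?L / 8) \<le> (5 * \<kappa> / d)\<^sup>2 * (\<Sum>i\<in>V. (x i) ^ 3)"
        using m3 by (intro mult_left_mono) auto
      moreover have "\<kappa>\<^sup>2 / d\<^sup>2 * ?L \<le> (5 * \<kappa> / d)\<^sup>2 * (?L / 8) / 3"
      proof -
        have "0 \<le> \<kappa>\<^sup>2 / d\<^sup>2 * ?L"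
          using weight_pos by simp
        moreover have "(5 * \<kappa> / d)\<^sup>2 * (?L / 8) / 3 = 25 / 24 * (\<kappa>\<^sup>2 / d\<^sup>2 * ?L)"
          by (simp add: power_mult_distrib power_divide)
        ultimately show ?thesis
          by linarith
      qed
      ultimately show "\<kappa>\<^sup>2 / d\<^sup>2 * ?L + 5 * \<kappa> / d * (\<Sum>i\<in>V. (x i)\<^sup>2) -
          (5 * \<kappa> / d)\<^sup>2 * (\<Sum>i\<in>V. (x i) ^ 3) / 3 \<le> 5 * \<kappa> / d * ?L"
        by linarith
    qed (use assms(2) d0 in auto)
    also have "\<dots> = 2 * ?N + 10 * d * ?L / \<kappa>"
      using assms(2) d0 by (simp add: field_simps power2_eq_square)
    also have "\<dots> \<le> ?N / (16 * A * \<kappa>) + ?N / (16 * A * \<kappa>)"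
    proof (rule add_mono)
      have "2 * ?N * (16 * A * \<kappa>) = ?N * (32 * A * \<kappa>)"
        by simp
      also have "\<dots> \<le> ?N * 1"
        using assms(1-3) by (intro mult_left_mono) (auto simp: field_simps)
      finally show "2 * ?N \<le> ?N / (16 * A * \<kappa>)"
        using assms(1,2) by (simp add: pos_le_divide_eq)
      have "?L \<le> (\<Sum>i\<in>V. 1 + x i + (x i)\<^sup>2)"
        by (rule sum_mono) simp
      with m0 have "10 * d * ?L / \<kappa> \<le> 10 * d * (A * ?N) / \<kappa>"
        using d0 assms(2) by (intro divide_right_mono mult_left_mono) auto
      also have "\<dots> = ?N / (16 * A * \<kappa>)"
        using assms(1,2) by (simp add: d_def field_simps power2_eq_square)
      finally show "10 * d * ?L / \<kappa> \<le> ?N / (16 * A * \<kappa>)" .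
    qed
    finally show ?thesis
      by simp
  qed
  have f_eq: "f k = real k - (if \<kappa>\<^sup>2 / d\<^sup>2 * real k < 1 then real k else 0)" for k
    using assms(2) d0 by (auto simp: f_def field_simps)
  have M: "?N / (8 * A * \<kappa>) \<le> ?M"
    using size small by (simp add: f_eq subset_expectation_diff sum_subtractf)
  have f_mono: "mono f" and f_nonneg: "0 \<le> f k" for k
    by (auto simp: f_def mono_def)
  have third: "(\<Sum>i\<in>V. nr_expectation V x
      (\<lambda>E. real (card (reach E {i})) * (f (card (reach E {i})))\<^sup>2)) \<le> 6 / h ^ 3 * (?N * \<kappa>)"
  proof -
    have "nr_expectation V x (\<lambda>E. real (card (reach E {i})) * (f (card (reach E {i})))\<^sup>2) \<le>
        6 / h ^ 3 * nr_expectation V x (\<lambda>E. exp (h * cluster_mass E i) - 1)" if "i \<in> V" for i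
      unfolding subset_expectation_cmult[symmetric]
    proof (rule mean_mono)
      fix E assume "E \<subseteq> pairs V"
      then have T: "real (card (reach E {i})) \<le> cluster_mass E i"
        using cluster_mass_bounds[of E i] that by linarith
      let ?k = "card (reach E {i})"
      have "real ?k * (f ?k)\<^sup>2 \<le> real ?k ^ 3"
        by (simp add: f_def power2_eq_square power3_eq_cube)
      also have "\<dots> \<le> cluster_mass E i ^ 3"
        using T by (intro power_mono) auto
      also have "\<dots> \<le> 6 / h ^ 3 * (exp (h * cluster_mass E i) - 1)"
        using exp_minus_one_ge(2)[of "h * cluster_mass E i"] h0 T
        by (simp add: field_simps power_mult_distrib)
      finally show "real ?k * (f ?k)\<^sup>2 \<le> 6 / h ^ 3 * (exp (h * cluster_mass E i) - 1)" .
    qed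
    then have "(\<Sum>i\<in>V. nr_expectation V x
        (\<lambda>E. real (card (reach E {i})) * (f (card (reach E {i})))\<^sup>2)) \<le>
        6 / h ^ 3 * (\<Sum>i\<in>V. nr_expectation V x (\<lambda>E. exp (h * cluster_mass E i) - 1))"
      unfolding sum_distrib_left by (rule sum_mono)
    also have "\<dots> \<le> 6 / h ^ 3 * (?N * \<kappa>)"
      using h0 unfolding h_def
      by (intro mult_left_mono subcritical_exponential_moment) (use assms \<kappa>1 \<kappa>x in auto)
    finally show ?thesis .
  qed
  let ?P = "nr_expectation V x (\<lambda>E. if (\<Sum>i\<in>V. f (card (reach E {i}))) = 0 then 1 else 0)"
  have P0: "0 \<le> ?P"
    by (intro subset_expectation_nonneg nr_prob_bounds) auto
  have "(?N / (8 * A * \<kappa>))\<^sup>2 * ?P \<le> ?M\<^sup>2 * ?P"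
    using M P0 N0 assms(1,2) by (intro mult_right_mono power_mono) auto
  also have "\<dots> \<le> 6 / h ^ 3 * (?N * \<kappa>)"
    using cluster_statistic_zero_probability[OF finite_V nr_prob_bounds f_mono f_nonneg] third
    by (rule order_trans)
  also have "\<dots> = (?N / (8 * A * \<kappa>))\<^sup>2 * (384 * A\<^sup>2 * (96 * A\<^sup>2) ^ 3 / (?N * \<kappa> ^ 3))"
    using assms(1,2) N0 by (simp add: h_def field_simps eval_nat_numeral)
  finally have "?P \<le> 384 * A\<^sup>2 * (96 * A\<^sup>2) ^ 3 / (?N * \<kappa> ^ 3)"
    by (rule mult_left_le_imp_le) (use assms(1,2) N0 in auto)
  moreover have "nr_expectation V x
      (\<lambda>E. if \<forall>i\<in>V. real (card (reach E {i})) < d\<^sup>2 / \<kappa>\<^sup>2 then 1 else 0) \<le> ?P"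
    by (rule mean_mono) (auto simp: f_def intro!: sum.neutral)
  ultimately show ?thesis
    by linarith
qed

end

section \<open>The critical window\<close>

text \<open>The interface between the quantile weights and the graph estimates. The same
  \<open>m\<close> in both moment conditions expresses criticality, and their error is a relative
  one of order \<open>n powr (- 1 / 3)\<close>, the width of the window. \<open>max_weight\<close>
  yields \<open>\<eta> * x i \<le> 1\<close> for \<open>\<eta>\<close> of order
  \<open>n powr (- 1 / 3)\<close>.\<close>

locale critical_weights =
  fixes w :: "nat \<Rightarrow> nat \<Rightarrow> real" and m C :: real
  assumes weights_nonneg: "\<And>n i. i \<in> {1..n} \<Longrightarrow> 0 \<le> w n i"
    and m_pos: "0 < m" and C_nonneg: "0 \<le> C"
    and first_moment: "\<forall>\<^sub>F n in sequentially.
      \<bar>(\<Sum>i=1..n. w n i) - m * real n\<bar> \<le> C * (real n powr (1 / 3))\<^sup>2"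
    and second_moment: "\<forall>\<^sub>F n in sequentially.
      \<bar>(\<Sum>i=1..n. (w n i)\<^sup>2) - m * real n\<bar> \<le> C * (real n powr (1 / 3))\<^sup>2"
    and third_moment: "\<forall>\<^sub>F n in sequentially. (\<Sum>i=1..n. (w n i) ^ 3) \<le> C * real n"
    and max_weight: "\<And>\<delta>. 0 < \<delta> \<Longrightarrow>
      \<forall>\<^sub>F n in sequentially. \<forall>i\<in>{1..n}. w n i \<le> \<delta> * real n powr (1 / 3)"
begin

lemma cube_root_cubed: "(real n powr (1 / 3)) ^ 3 = real n"
  by (cases "n = 0") (simp_all add: powr_realpow[symmetric] powr_powr)

lemma cube_root_eventually_ge: "\<forall>\<^sub>F n in sequentially. c \<le> real n powr (1 / 3)"
proof -
  have "filterlim (\<lambda>n. real n powr (1 / 3)) at_top sequentially"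
    by real_asymp
  then show ?thesis
    by (simp add: filterlim_at_top)
qed

lemma perturbation_le:
  fixes \<epsilon> :: "nat \<Rightarrow> real"
  assumes "\<forall>n\<ge>1. \<bar>\<epsilon> n\<bar> \<le> \<Lambda> * real n powr (- 1 / 3)" "1 \<le> n"
  shows "\<bar>\<epsilon> n\<bar> \<le> \<Lambda> / real n powr (1 / 3)"
proof -
  have "real n powr (- 1 / 3) = 1 / real n powr (1 / 3)"
    using powr_minus_divide[of "real n" "1 / 3"] by simp
  with assms show ?thesis
    by (metis mult.right_neutral times_divide_eq_right)
qed

lemma power_sum_bounds:
  "\<forall>\<^sub>F n in sequentially.
    9 / 10 * (m * real n) \<le> (\<Sum>i=1..n. w n i) \<and> (\<Sum>i=1..n. w n i) \<le> 11 / 10 * (m * real n) \<and>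
    9 / 10 * (m * real n) \<le> (\<Sum>i=1..n. (w n i)\<^sup>2) \<and> (\<Sum>i=1..n. (w n i)\<^sup>2) \<le> 11 / 10 * (m * real n) \<and>
    \<bar>(\<Sum>i=1..n. (w n i)\<^sup>2) - (\<Sum>i=1..n. w n i)\<bar> \<le> 2 * C * (real n powr (1 / 3))\<^sup>2 \<and>
    7 / 10 * (m * real n) \<le> (\<Sum>i=1..n. (w n i) ^ 3)"
  using first_moment second_moment cube_root_eventually_ge[of "10 * C / m"]
proof eventually_elim
  case (elim n)
  let ?t = "real n powr (1 / 3)"
  have "10 * C \<le> m * ?t"
    using elim(3) m_pos by (simp add: field_simps)
  then have "C * ?t\<^sup>2 \<le> m * ?t / 10 * ?t\<^sup>2"
    by (intro mult_right_mono) auto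
  also have "\<dots> = m * real n / 10"
    by (subst cube_root_cubed[symmetric]) (simp add: eval_nat_numeral)
  finally have err: "C * ?t\<^sup>2 \<le> m * real n / 10" .
  \<comment> \<open>A lower bound on the third power sum comes for free from criticality: it is at
    least twice the second minus the first, hence at least \<open>(18 - 11) / 10\<close> of
    \<open>m * real n\<close>.\<close>
  have "0 \<le> (\<Sum>i=1..n. w n i * (w n i - 1)\<^sup>2)"
    using weights_nonneg by (intro sum_nonneg mult_nonneg_nonneg) auto
  also have "\<dots> = (\<Sum>i=1..n. (w n i) ^ 3 - 2 * (w n i)\<^sup>2 + w n i)"
    by (intro sum.cong refl) (simp add: algebra_simps eval_nat_numeral)
  also have "\<dots> = (\<Sum>i=1..n. (w n i) ^ 3) - 2 * (\<Sum>i=1..n. (w n i)\<^sup>2) + (\<Sum>i=1..n. w n i)"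
    by (simp add: sum.distrib sum_subtractf sum_distrib_left)
  finally have third: "2 * (\<Sum>i=1..n. (w n i)\<^sup>2) - (\<Sum>i=1..n. w n i) \<le> (\<Sum>i=1..n. (w n i) ^ 3)"
    by simp
  show ?case
    using elim(1,2) err third by (intro conjI) (auto simp: abs_if split: if_splits)
qed

lemma largest_cluster_upper:
  assumes "0 < \<Lambda>"
  shows "\<exists>b>0. \<forall>\<epsilon> :: nat \<Rightarrow> real. (\<forall>n\<ge>1. \<bar>\<epsilon> n\<bar> \<le> \<Lambda> * real n powr (- 1 / 3)) \<longrightarrow>
    (\<forall>\<omega>>1. \<forall>\<^sub>F n in sequentially.
      nr_expectation {1..n} (\<lambda>i. (1 + \<epsilon> n) * w n i)
        (\<lambda>E. if \<exists>i\<in>{1..n}. \<omega> * (real n powr (1 / 3))\<^sup>2 < real (card (reach E {i})) then 1 else 0)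
      \<le> b / \<omega>)"
proof -
  \<comment> \<open>The gain is quadratic in \<open>D\<close> while the costs are at most linear, so
    a large \<open>D\<close> wins. The number \<open>24\<close> collects \<open>1 / 3\<close> from
    the truncated bound, \<open>1 / 4\<close> from \<open>a\<^sup>2\<close> and \<open>1 / 2\<close>
    from the third power sum.\<close>
  define D where "D = 24 * (2 + (2 * C + 2 * \<Lambda> * m) / m)"
  have D1: "1 \<le> D"
    using assms m_pos C_nonneg by (simp add: D_def)
  have Dm: "D * m / 24 = 2 * m + (2 * C + 2 * \<Lambda> * m)"
    using m_pos by (simp add: D_def field_simps)
  show ?thesis
  proof (intro exI[of _ "2 * (1 + 4 * D * m)"] conjI allI impI)
    show "0 < 2 * (1 + 4 * D * m)"
      using D1 m_pos by (simp add: add_pos_nonneg)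
  next
    fix \<epsilon> :: "nat \<Rightarrow> real" and \<omega> :: real
    assume \<epsilon>: "\<forall>n\<ge>1. \<bar>\<epsilon> n\<bar> \<le> \<Lambda> * real n powr (- 1 / 3)" and \<omega>: "1 < \<omega>"
    have "0 < 1 / (2 * D)"
      using D1 by simp
    from power_sum_bounds max_weight[OF this] cube_root_eventually_ge[of "max 1 (2 * \<Lambda>)"]
      eventually_ge_at_top[of 1]
    show "\<forall>\<^sub>F n in sequentially.
      nr_expectation {1..n} (\<lambda>i. (1 + \<epsilon> n) * w n i)
        (\<lambda>E. if \<exists>i\<in>{1..n}. \<omega> * (real n powr (1 / 3))\<^sup>2 < real (card (reach E {i})) then 1 else 0)
      \<le> 2 * (1 + 4 * D * m) / \<omega>"
    proof eventually_elim
      case (elim n)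
      define t where "t = real n powr (1 / 3)"
      define a where "a = 1 + \<epsilon> n"
      let ?x = "\<lambda>i. a * w n i"
      let ?S1 = "\<Sum>i=1..n. w n i" and ?S2 = "\<Sum>i=1..n. (w n i)\<^sup>2" and ?S3 = "\<Sum>i=1..n. (w n i) ^ 3"
      have t: "1 \<le> t" "2 * \<Lambda> \<le> t"
        using elim(3) by (auto simp: t_def)
      have n_eq: "real n = t ^ 3"
        by (simp add: t_def cube_root_cubed)
      have \<epsilon>_le: "\<bar>\<epsilon> n\<bar> \<le> \<Lambda> / t"
        unfolding t_def by (rule perturbation_le[OF \<epsilon> elim(4)])
      also have "\<dots> \<le> 1 / 2"
        using t by (simp add: field_simps)
      finally have a: "1 / 2 \<le> a" "a \<le> 3 / 2"
        by (auto simp: a_def abs_if split: if_splits)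
      have S: "9 / 10 * (m * t ^ 3) \<le> ?S1" "?S1 \<le> 11 / 10 * (m * t ^ 3)"
        "?S2 \<le> 11 / 10 * (m * t ^ 3)" "?S2 - ?S1 \<le> 2 * C * t\<^sup>2" "7 / 10 * (m * t ^ 3) \<le> ?S3"
        using elim(1) by (auto simp: n_eq[symmetric] t_def[symmetric])
      have mt: "0 < m * t ^ 3"
        using m_pos t by simp
      have S1_pos: "0 < ?S1"
        using S(1) mt by linarith
      have sums: "sum ?x {1..n} = a * ?S1" "(\<Sum>i\<in>{1..n}. (?x i)\<^sup>2) = a\<^sup>2 * ?S2"
        "(\<Sum>i\<in>{1..n}. (?x i) ^ 3) = a ^ 3 * ?S3"
        by (simp_all add: sum_distrib_left power_mult_distrib)
      interpret nr_graph "{1..n}" ?x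
      proof
        show "0 < sum ?x {1..n}"
          unfolding sums using S1_pos a by simp
        show "0 \<le> ?x i" if "i \<in> {1..n}" for i
          using weights_nonneg[OF that] a by simp
      qed simp
      \<comment> \<open>The condition of the truncated bound divided by \<open>a\<close>, since the
        power sums scale with \<open>a\<close>, \<open>a\<^sup>2\<close> and
        \<open>a ^ 3\<close>.\<close>
      have main: "1 / t\<^sup>2 * ?S1 + D / t * (a * ?S2) - (D / t)\<^sup>2 * (a\<^sup>2 * ?S3) / 3 \<le> D / t * ?S1"
      proof -
        have "a * ?S2 - ?S1 = (?S2 - ?S1) + \<epsilon> n * ?S2"
          by (simp add: a_def algebra_simps)
        also have "\<epsilon> n * ?S2 \<le> \<Lambda> / t * (2 * (m * t ^ 3))"
        proof -
          have "0 \<le> ?S2"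
            by (simp add: sum_nonneg)
          then have "\<epsilon> n * ?S2 \<le> \<bar>\<epsilon> n\<bar> * ?S2"
            by (intro mult_right_mono) auto
          also have "\<dots> \<le> \<Lambda> / t * (2 * (m * t ^ 3))"
            using \<epsilon>_le S(3) mt \<open>0 \<le> ?S2\<close> assms t by (intro mult_mono) auto
          finally show ?thesis .
        qed
        also have "\<Lambda> / t * (2 * (m * t ^ 3)) = 2 * \<Lambda> * m * t\<^sup>2"
          using t by (simp add: field_simps eval_nat_numeral)
        finally have "a * ?S2 - ?S1 \<le> (2 * C + 2 * \<Lambda> * m) * t\<^sup>2"
          using S(4) by (simp add: algebra_simps)
        then have "D / t * (a * ?S2 - ?S1) \<le> D / t * ((2 * C + 2 * \<Lambda> * m) * t\<^sup>2)"
          using D1 t by (intro mult_left_mono) auto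
        also have "\<dots> = D * (2 * C + 2 * \<Lambda> * m) * t"
          using t by (simp add: field_simps eval_nat_numeral)
        finally have i2: "D / t * (a * ?S2 - ?S1) \<le> D * (2 * C + 2 * \<Lambda> * m) * t" .
        have "1 / t\<^sup>2 * ?S1 \<le> 1 / t\<^sup>2 * (2 * (m * t ^ 3))"
          using S(2) mt by (intro mult_left_mono) auto
        also have "\<dots> = 2 * m * t"
          using t by (simp add: field_simps eval_nat_numeral)
        finally have i1: "1 / t\<^sup>2 * ?S1 \<le> 2 * m * t" .
        have "(1 / 2)\<^sup>2 * (1 / 2 * (m * t ^ 3)) \<le> a\<^sup>2 * ?S3"
          using S(5) mt a by (intro mult_mono power_mono) auto
        then have "(D / t)\<^sup>2 * ((1 / 2)\<^sup>2 * (1 / 2 * (m * t ^ 3))) \<le> (D / t)\<^sup>2 * (a\<^sup>2 * ?S3)"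
          by (intro mult_left_mono) auto
        also have "(D / t)\<^sup>2 * ((1 / 2)\<^sup>2 * (1 / 2 * (m * t ^ 3))) = D * (D * m / 24) * t * 3"
          using t by (simp add: field_simps eval_nat_numeral)
        finally have i3: "D * (2 * m + (2 * C + 2 * \<Lambda> * m)) * t \<le> (D / t)\<^sup>2 * (a\<^sup>2 * ?S3) / 3"
          unfolding Dm by simp
        have "2 * m * t \<le> D * (2 * m) * t"
          using D1 m_pos t by simp
        then have "2 * m * t + D * (2 * C + 2 * \<Lambda> * m) * t \<le> D * (2 * m + (2 * C + 2 * \<Lambda> * m)) * t"
          by (simp add: algebra_simps)
        with i1 i2 i3 show ?thesis
          by (simp add: right_diff_distrib)
      qed
      have t2: "0 < t\<^sup>2"
        using t by simp
      have "nr_expectation {1..n} ?x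
          (\<lambda>E. if \<exists>i\<in>{1..n}. \<omega> * t\<^sup>2 < real (card (reach E {i})) then 1 else 0) \<le>
          2 * (1 / t\<^sup>2 * real (card {1..n}) + D / t * sum ?x {1..n}) / (\<omega> * t\<^sup>2)"
      proof (rule large_cluster_probability_le)
        fix i assume i: "i \<in> {1..n}"
        have "D / t * (a * w n i) \<le> D / t * (3 / 2 * (1 / (2 * D) * t))"
          using elim(2) i a weights_nonneg[OF i] D1 t
          by (intro mult_left_mono mult_mono) (auto simp: t_def)
        also have "\<dots> \<le> 1"
          using D1 t by simp
        finally show "D / t * (a * w n i) \<le> 1" .
      next
        have "a * (1 / t\<^sup>2 * ?S1 + D / t * (a * ?S2) - (D / t)\<^sup>2 * (a\<^sup>2 * ?S3) / 3) \<le> a * (D / t * ?S1)"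
          using main a by (intro mult_left_mono) auto
        then show "1 / t\<^sup>2 * sum ?x {1..n} + D / t * (\<Sum>i\<in>{1..n}. (?x i)\<^sup>2) -
            (D / t)\<^sup>2 * (\<Sum>i\<in>{1..n}. (?x i) ^ 3) / 3 \<le> D / t * sum ?x {1..n}"
          unfolding sums by (simp add: algebra_simps eval_nat_numeral)
      qed (use t t2 D1 \<omega> in auto)
      also have "\<dots> \<le> 2 * (1 + 4 * D * m) / \<omega>"
      proof -
        have "a * ?S1 \<le> 3 / 2 * (11 / 10 * (m * t ^ 3))"
          using a S(2) S1_pos by (intro mult_mono) auto
        then have "a * ?S1 \<le> 4 * (m * t ^ 3)"
          using mt by linarith
        then have "D / t * (a * ?S1) \<le> D / t * (4 * (m * t ^ 3))"
          using D1 t by (intro mult_left_mono) auto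
        also have "\<dots> = 4 * D * m * t\<^sup>2"
          using t by (simp add: field_simps eval_nat_numeral)
        finally have "D / t * (a * ?S1) \<le> 4 * D * m * t\<^sup>2" .
        moreover have "1 / t\<^sup>2 * t ^ 3 = t"
          using t by (simp add: field_simps eval_nat_numeral)
        moreover have "t \<le> t\<^sup>2"
          using t by (intro self_le_power) auto
        ultimately have "1 / t\<^sup>2 * t ^ 3 + D / t * (a * ?S1) \<le> t\<^sup>2 + 4 * D * m * t\<^sup>2"
          by linarith
        then have "2 * (1 / t\<^sup>2 * t ^ 3 + D / t * (a * ?S1)) / (\<omega> * t\<^sup>2) \<le>
            2 * (t\<^sup>2 + 4 * D * m * t\<^sup>2) / (\<omega> * t\<^sup>2)"
          using \<omega> t2 by (intro divide_right_mono mult_left_mono) auto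
        also have "\<dots> = 2 * (1 + 4 * D * m) / \<omega>"
          using \<omega> t2 by (simp add: field_simps)
        finally show ?thesis
          unfolding sums by (simp add: n_eq)
      qed
      finally show ?case
        by (simp add: t_def a_def)
    qed
  qed
qed

text \<open>As \<open>K\<close> is fixed while \<open>n\<close> grows,
  \<open>\<kappa> = K / n powr (1 / 3)\<close> becomes small, all conditions of the subcritical
  estimate hold eventually with one constant \<open>A\<close>, and \<open>n * \<kappa> ^ 3\<close>
  is just \<open>K ^ 3\<close>.\<close>

lemma subcritical_no_large_cluster:
  obtains d B K\<^sub>0 :: real where "0 < d" "0 < B" "0 < K\<^sub>0"
    "\<And>K. K\<^sub>0 \<le> K \<Longrightarrow> \<forall>\<^sub>F n in sequentially.
      K / real n powr (1 / 3) \<le> 1 / 2 \<and>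
      nr_expectation {1..n} (\<lambda>i. (1 - K / real n powr (1 / 3)) * w n i)
        (\<lambda>E. if \<forall>i\<in>{1..n}. real (card (reach E {i})) < d\<^sup>2 / K\<^sup>2 * (real n powr (1 / 3))\<^sup>2 then 1 else 0)
      \<le> B / K ^ 3"
proof -
  \<comment> \<open>The summand \<open>4 / m\<close> serves to compare \<open>n\<close> with the
    total weight, \<open>10 + 4 * m\<close> to compare the first two power sums with
    \<open>n\<close>, and \<open>2 * C / m\<close> enters with the third power sum.\<close>
  define A where "A = 10 + 4 * m + 4 / m + 2 * C / m"
  have Am: "A * m = 10 * m + 4 * m * m + 4 + 2 * C"
    using m_pos by (simp add: A_def field_simps)
  have A10: "10 \<le> A" "4 * m \<le> A"
    using m_pos C_nonneg by (auto simp: A_def)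
  define B where "B = 384 * A\<^sup>2 * (96 * A\<^sup>2) ^ 3"
  define d where "d = 1 / (160 * A\<^sup>2)"
  \<comment> \<open>The summand \<open>8 * C / m\<close> lets the reduction by
    \<open>\<kappa>\<close> outweigh the deviation from criticality; the last one gives the
    condition on \<open>n * \<kappa> ^ 3\<close>, because \<open>K \<le> K ^ 3\<close>.\<close>
  define K\<^sub>0 where "K\<^sub>0 = 1 + 8 * C / m + 8 * A ^ 3 * (96 * A\<^sup>2)\<^sup>2"
  have K0: "1 \<le> K\<^sub>0" "8 * C / m \<le> K\<^sub>0" "8 * A ^ 3 * (96 * A\<^sup>2)\<^sup>2 \<le> K\<^sub>0"
    using A10 m_pos C_nonneg by (auto simp: K\<^sub>0_def)
  show thesis
  proof (rule that[of d B K\<^sub>0])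
    show "0 < d" "0 < B" "0 < K\<^sub>0"
      using A10 K0 by (auto simp: d_def B_def)
  next
    fix K assume K: "K\<^sub>0 \<le> K"
    have K1: "1 \<le> K" "8 * C \<le> K * m"
    proof -
      have "8 * C / m \<le> K"
        using K K0 by linarith
      then show "8 * C \<le> K * m"
        using m_pos by (simp add: field_simps)
    qed (use K K0 in linarith)
    have "0 < 1 / (800 * A\<^sup>2 * K)"
      using A10 K1 by simp
    from power_sum_bounds third_moment max_weight[OF this] cube_root_eventually_ge[of "32 * A * K"]
    show "\<forall>\<^sub>F n in sequentially.
      K / real n powr (1 / 3) \<le> 1 / 2 \<and>
      nr_expectation {1..n} (\<lambda>i. (1 - K / real n powr (1 / 3)) * w n i)
        (\<lambda>E. if \<forall>i\<in>{1..n}. real (card (reach E {i})) < d\<^sup>2 / K\<^sup>2 * (real n powr (1 / 3))\<^sup>2 then 1 else 0)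
      \<le> B / K ^ 3"
    proof eventually_elim
      case (elim n)
      define t where "t = real n powr (1 / 3)"
      define \<kappa> where "\<kappa> = K / t"
      let ?x = "\<lambda>i. (1 - \<kappa>) * w n i"
      let ?S1 = "\<Sum>i=1..n. w n i" and ?S2 = "\<Sum>i=1..n. (w n i)\<^sup>2" and ?S3 = "\<Sum>i=1..n. (w n i) ^ 3"
      have "32 * A * K \<le> t"
        using elim(4) by (simp add: t_def)
      moreover have "320 \<le> 32 * A * K"
        using mult_mono[of 320 "32 * A" 1 K] A10 K1 by simp
      ultimately have t: "0 < t" "32 * A * K \<le> t"
        by linarith+
      have n_eq: "real n = t ^ 3"
        by (simp add: t_def cube_root_cubed)
      have \<kappa>: "0 < \<kappa>" "\<kappa> \<le> 1 / (32 * A)"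
        using t K1 A10 by (auto simp: \<kappa>_def field_simps)
      have "1 / (32 * A) \<le> 1 / 320"
        using A10 by (intro divide_left_mono) auto
      with \<kappa> have \<kappa>': "\<kappa> \<le> 1 / 320"
        by linarith
      have S: "9 / 10 * (m * t ^ 3) \<le> ?S1" "?S1 \<le> 11 / 10 * (m * t ^ 3)"
        "9 / 10 * (m * t ^ 3) \<le> ?S2" "?S2 \<le> 11 / 10 * (m * t ^ 3)"
        "?S2 - ?S1 \<le> 2 * C * t\<^sup>2" "?S1 - ?S2 \<le> 2 * C * t\<^sup>2"
        "7 / 10 * (m * t ^ 3) \<le> ?S3" "?S3 \<le> C * t ^ 3"
        using elim(1,2) by (auto simp: n_eq[symmetric] t_def[symmetric])
      have mt: "0 < m * t ^ 3"
        using m_pos t by simp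
      have S1_pos: "0 < ?S1" "0 < ?S2"
        using S mt by linarith+
      have sums: "sum ?x {1..n} = (1 - \<kappa>) * ?S1" "(\<Sum>i\<in>{1..n}. (?x i)\<^sup>2) = (1 - \<kappa>)\<^sup>2 * ?S2"
        "(\<Sum>i\<in>{1..n}. (?x i) ^ 3) = (1 - \<kappa>) ^ 3 * ?S3"
        by (simp_all add: sum_distrib_left power_mult_distrib)
      interpret nr_graph "{1..n}" ?x
      proof
        show "0 < sum ?x {1..n}"
          unfolding sums using S1_pos \<kappa>' by simp
        show "0 \<le> ?x i" if "i \<in> {1..n}" for i
          using weights_nonneg[OF that] \<kappa>' by simp
      qed simp
      \<comment> \<open>The ratio of \<open>?S2\<close> to \<open>?S1\<close> is thus within
        \<open>\<kappa> / 3\<close> of \<open>1\<close>. After scaling by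
        \<open>1 - \<kappa>\<close> it lies between \<open>1 - 2 * \<kappa>\<close> and
        \<open>1 - \<kappa> / 2\<close>.\<close>
      have gap: "2 * C * t\<^sup>2 \<le> \<kappa> / 2 * ?S1 * (2 / 3)"
      proof -
        have "6 * C * t\<^sup>2 \<le> 9 / 10 * (K * m) * t\<^sup>2"
          using K1(2) C_nonneg by (intro mult_right_mono) auto
        also have "\<dots> = \<kappa> * (9 / 10 * (m * t ^ 3))"
          using t by (simp add: \<kappa>_def field_simps eval_nat_numeral)
        also have "\<dots> \<le> \<kappa> * ?S1"
          using S(1) \<kappa> by (intro mult_left_mono) auto
        finally show ?thesis
          by simp
      qed
      have "nr_expectation {1..n} ?x
          (\<lambda>E. if \<forall>i\<in>{1..n}. real (card (reach E {i})) < d\<^sup>2 / \<kappa>\<^sup>2 then 1 else 0) \<le>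
          B / (real (card {1..n}) * \<kappa> ^ 3)"
        unfolding B_def d_def
      proof (rule no_large_cluster_probability_le)
        show "1 \<le> A"
          using A10 by simp
        show "0 < \<kappa>" "\<kappa> \<le> 1 / (32 * A)"
          by fact+
      next
        fix i assume i: "i \<in> {1..n}"
        have "\<kappa> * ((1 - \<kappa>) * w n i) \<le> \<kappa> * (1 * (1 / (800 * A\<^sup>2 * K) * t))"
          using elim(3) i \<kappa> \<kappa>' weights_nonneg[OF i] A10 K1 t
          by (intro mult_left_mono mult_mono) (auto simp: t_def)
        also have "\<dots> = 1 / (800 * A\<^sup>2)"
          using t K1 by (simp add: \<kappa>_def field_simps)
        finally show "\<kappa> * ((1 - \<kappa>) * w n i) \<le> 1 / (800 * A\<^sup>2)" .
      next
        have "1 * t ^ 3 \<le> A * m / 4 * t ^ 3"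
          using Am m_pos C_nonneg t by (intro mult_right_mono) auto
        also have "\<dots> = A * (1 / 2 * (1 / 2 * (m * t ^ 3)))"
          by simp
        also have "\<dots> \<le> A * ((1 - \<kappa>) * ?S1)"
          using A10 \<kappa>' S(1) mt by (intro mult_left_mono mult_mono) auto
        finally show "real (card {1..n}) \<le> A * sum ?x {1..n}"
          unfolding sums by (simp add: n_eq)
      next
        have "(\<Sum>i\<in>{1..n}. 1 + ?x i + (?x i)\<^sup>2) \<le> (\<Sum>i\<in>{1..n}. 1 + w n i + (w n i)\<^sup>2)"
        proof (intro sum_mono add_mono order_refl power_mono)
          fix i assume i: "i \<in> {1..n}"
          show "?x i \<le> w n i" "?x i \<le> w n i" "0 \<le> ?x i"
            using weights_nonneg[OF i] \<kappa> \<kappa>' by (auto intro: mult_left_le_one_le)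
        qed
        also have "\<dots> = t ^ 3 + ?S1 + ?S2"
          by (simp add: sum.distrib n_eq)
        also have "\<dots> \<le> t ^ 3 + 11 / 10 * (m * t ^ 3) + 11 / 10 * (m * t ^ 3)"
          using S by linarith
        also have "\<dots> = (1 + 22 / 10 * m) * t ^ 3"
          by (simp add: algebra_simps)
        also have "\<dots> \<le> A * t ^ 3"
          using m_pos C_nonneg t by (intro mult_right_mono) (auto simp: A_def)
        finally show "(\<Sum>i\<in>{1..n}. 1 + ?x i + (?x i)\<^sup>2) \<le> A * real (card {1..n})"
          by (simp add: n_eq)
      next
        have "(\<Sum>i\<in>{1..n}. ?x i * (1 + ?x i + (?x i)\<^sup>2)) \<le>
            (\<Sum>i\<in>{1..n}. (1 - \<kappa>) * w n i * (1 + w n i + (w n i)\<^sup>2))"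
        proof (intro sum_mono mult_left_mono add_mono order_refl power_mono)
          fix i assume i: "i \<in> {1..n}"
          show "?x i \<le> w n i" "?x i \<le> w n i" "0 \<le> ?x i" "0 \<le> ?x i"
            using weights_nonneg[OF i] \<kappa> \<kappa>' by (auto intro: mult_left_le_one_le)
        qed
        also have "\<dots> = (1 - \<kappa>) * (?S1 + ?S2 + ?S3)"
          unfolding sum.distrib[symmetric] sum_distrib_left
          by (intro sum.cong refl) (simp add: algebra_simps eval_nat_numeral)
        also have "\<dots> \<le> (1 - \<kappa>) * (A * ?S1)"
        proof (intro mult_left_mono)
          have "?S1 + ?S2 + ?S3 \<le> 22 / 10 * (m * t ^ 3) + C * t ^ 3"
            using S by linarith
          also have "\<dots> = (22 / 10 * m + C) * t ^ 3"
            by (simp add: algebra_simps)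
          also have "\<dots> \<le> (9 / 10 * (A * m)) * t ^ 3"
            unfolding Am using m_pos C_nonneg t by (intro mult_right_mono) auto
          also have "\<dots> = A * (9 / 10 * (m * t ^ 3))"
            by simp
          also have "\<dots> \<le> A * ?S1"
            using S(1) A10 by (intro mult_left_mono) auto
          finally show "?S1 + ?S2 + ?S3 \<le> A * ?S1" .
        qed (use \<kappa>' in simp)
        finally show "(\<Sum>i\<in>{1..n}. ?x i * (1 + ?x i + (?x i)\<^sup>2)) \<le> A * sum ?x {1..n}"
          unfolding sums by (simp only: mult.left_commute)
      next
        have "(1 - 2 * \<kappa>) * ?S1 \<le> (1 - \<kappa>) * ?S2"
        proof -
          have "(1 - \<kappa>) * (?S1 - ?S2) \<le> 1 * (\<kappa> / 2 * ?S1 * (2 / 3))"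
          proof (cases "?S1 \<le> ?S2")
            case True
            then have "(1 - \<kappa>) * (?S1 - ?S2) \<le> 0"
              using \<kappa>' by (intro mult_nonneg_nonpos) auto
            also have "0 \<le> 1 * (\<kappa> / 2 * ?S1 * (2 / 3))"
              using \<kappa> S1_pos by simp
            finally show ?thesis .
          next
            case False
            then show ?thesis
              using \<kappa> \<kappa>' S(6) gap by (intro mult_mono) auto
          qed
          moreover have "0 \<le> \<kappa> * ?S1"
            using \<kappa> S1_pos by simp
          ultimately show ?thesis
            by (simp add: algebra_simps)
        qed
        then have "(1 - \<kappa>) * ((1 - 2 * \<kappa>) * ?S1) \<le> (1 - \<kappa>) * ((1 - \<kappa>) * ?S2)"
          using \<kappa>' by (intro mult_left_mono) auto
        then show "(1 - 2 * \<kappa>) * sum ?x {1..n} \<le> (\<Sum>i\<in>{1..n}. (?x i)\<^sup>2)"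
          unfolding sums by (simp add: power2_eq_square mult_ac)
      next
        have "(1 - \<kappa>) * ?S2 \<le> (1 - \<kappa> / 2) * ?S1"
        proof -
          have "0 \<le> \<kappa> / 2 * ?S1"
            using \<kappa> S1_pos by simp
          then have "?S2 \<le> ?S1 + \<kappa> / 2 * ?S1"
            using S(5) gap by linarith
          then have "(1 - \<kappa>) * ?S2 \<le> (1 - \<kappa>) * (?S1 + \<kappa> / 2 * ?S1)"
            using \<kappa>' by (intro mult_left_mono) auto
          also have "\<dots> = (1 - \<kappa> / 2) * ?S1 - \<kappa> / 2 * \<kappa> * ?S1"
            by (simp add: field_simps)
          also have "\<dots> \<le> (1 - \<kappa> / 2) * ?S1"
            using \<kappa> S1_pos by simp
          finally show ?thesis .
        qed
        then have "(1 - \<kappa>) * ((1 - \<kappa>) * ?S2) \<le> (1 - \<kappa>) * ((1 - \<kappa> / 2) * ?S1)"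
          using \<kappa>' by (intro mult_left_mono) auto
        then show "(\<Sum>i\<in>{1..n}. (?x i)\<^sup>2) \<le> (1 - \<kappa> / 2) * sum ?x {1..n}"
          unfolding sums by (simp add: power2_eq_square mult_ac)
      next
        have "?S1 / 8 \<le> (1 / 2)\<^sup>2 * ?S3"
          using S(2,7) mt by (simp add: power2_eq_square)
        also have "\<dots> \<le> (1 - \<kappa>)\<^sup>2 * ?S3"
          using \<kappa>' S(7) mt by (intro mult_right_mono power_mono) auto
        finally have "(1 - \<kappa>) * (?S1 / 8) \<le> (1 - \<kappa>) * ((1 - \<kappa>)\<^sup>2 * ?S3)"
          using \<kappa>' by (intro mult_left_mono) auto
        then show "sum ?x {1..n} / 8 \<le> (\<Sum>i\<in>{1..n}. (?x i) ^ 3)"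
          unfolding sums by (simp add: eval_nat_numeral mult_ac)
      next
        have "K \<le> K ^ 3"
          using K1 by (intro self_le_power) auto
        moreover have "t ^ 3 * \<kappa> ^ 3 = K ^ 3"
          using t by (simp add: \<kappa>_def power_divide)
        ultimately show "8 * A ^ 3 * (96 * A\<^sup>2)\<^sup>2 \<le> real (card {1..n}) * \<kappa> ^ 3"
          using K0(3) K by (simp add: n_eq)
      qed
      also have "real (card {1..n}) * \<kappa> ^ 3 = K ^ 3"
        using t by (simp add: n_eq \<kappa>_def power_divide)
      also have "d\<^sup>2 / \<kappa>\<^sup>2 = d\<^sup>2 / K\<^sup>2 * t\<^sup>2"
        using t by (simp add: \<kappa>_def power_divide)
      finally show ?case
        using order_trans[OF \<kappa>', of "1 / 2"] by (simp add: \<kappa>_def t_def)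
    qed
  qed
qed

text \<open>Having no large cluster is a decreasing event, and
  \<open>1 - K / t \<le> 1 + \<epsilon> n\<close> as soon as \<open>K \<ge> \<Lambda>\<close>. One
  subcritical graph, chosen independently of \<open>\<epsilon>\<close>, therefore serves all
  perturbations at once.\<close>

lemma largest_cluster_lower:
  assumes "0 < \<Lambda>"
  shows "\<exists>b>0. \<forall>\<epsilon> :: nat \<Rightarrow> real. (\<forall>n\<ge>1. \<bar>\<epsilon> n\<bar> \<le> \<Lambda> * real n powr (- 1 / 3)) \<longrightarrow>
    (\<forall>\<omega>\<ge>b. \<forall>\<^sub>F n in sequentially.
      nr_expectation {1..n} (\<lambda>i. (1 + \<epsilon> n) * w n i)
        (\<lambda>E. if \<forall>i\<in>{1..n}. real (card (reach E {i})) < (real n powr (1 / 3))\<^sup>2 / \<omega> then 1 else 0)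
      \<le> b / \<omega>)"
proof -
  obtain d B K\<^sub>0 :: real where pos: "0 < d" "0 < B" "0 < K\<^sub>0"
    and sub: "\<And>K. K\<^sub>0 \<le> K \<Longrightarrow> \<forall>\<^sub>F n in sequentially.
      K / real n powr (1 / 3) \<le> 1 / 2 \<and>
      nr_expectation {1..n} (\<lambda>i. (1 - K / real n powr (1 / 3)) * w n i)
        (\<lambda>E. if \<forall>i\<in>{1..n}. real (card (reach E {i})) < d\<^sup>2 / K\<^sup>2 * (real n powr (1 / 3))\<^sup>2 then 1 else 0)
      \<le> B / K ^ 3"
    by (rule subcritical_no_large_cluster) (blast intro: that)
  define b where "b = 1 + ((K\<^sub>0 + \<Lambda>) / d)\<^sup>2 + B / d ^ 3"
  have b: "1 \<le> b" "((K\<^sub>0 + \<Lambda>) / d)\<^sup>2 \<le> b" "B / d ^ 3 \<le> b"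
    using pos by (auto simp: b_def)
  show ?thesis
  proof (intro exI[of _ b] conjI allI impI)
    show "0 < b"
      using b by simp
  next
    fix \<epsilon> :: "nat \<Rightarrow> real" and \<omega> :: real
    assume \<epsilon>: "\<forall>n\<ge>1. \<bar>\<epsilon> n\<bar> \<le> \<Lambda> * real n powr (- 1 / 3)" and \<omega>: "b \<le> \<omega>"
    \<comment> \<open>Makes the size threshold \<open>d\<^sup>2 / K\<^sup>2\<close> equal to
      \<open>1 / \<omega>\<close>; the bound \<open>B / K ^ 3\<close> is then of order
      \<open>\<omega> powr (- 3 / 2)\<close>.\<close>
    define K where "K = d * sqrt \<omega>"
    have \<omega>1: "1 \<le> \<omega>"
      using b \<omega> by simp
    have "((K\<^sub>0 + \<Lambda>) / d)\<^sup>2 \<le> \<omega>"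
      using b \<omega> by linarith
    then have "(K\<^sub>0 + \<Lambda>) / d \<le> sqrt \<omega>"
      by (rule real_le_rsqrt)
    then have K: "K\<^sub>0 + \<Lambda> \<le> K"
      using pos by (simp add: K_def field_simps)
    have K2: "d\<^sup>2 / K\<^sup>2 = 1 / \<omega>"
      using pos \<omega>1 by (simp add: K_def power_mult_distrib)
    have K3: "B / K ^ 3 \<le> b / \<omega>"
    proof -
      have "\<omega> = sqrt \<omega> ^ 2"
        using \<omega>1 by simp
      also have "\<dots> \<le> sqrt \<omega> ^ 3"
        using \<omega>1 by (intro power_increasing) auto
      finally have "B / d ^ 3 / sqrt \<omega> ^ 3 \<le> b / \<omega>"
        using b pos \<omega>1 by (intro frac_le) auto
      then show ?thesis
        by (simp add: K_def power_mult_distrib)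
    qed
    have "K\<^sub>0 \<le> K"
      using K assms by simp
    from sub[OF this] power_sum_bounds eventually_ge_at_top[of 1]
    show "\<forall>\<^sub>F n in sequentially.
      nr_expectation {1..n} (\<lambda>i. (1 + \<epsilon> n) * w n i)
        (\<lambda>E. if \<forall>i\<in>{1..n}. real (card (reach E {i})) < (real n powr (1 / 3))\<^sup>2 / \<omega> then 1 else 0)
      \<le> b / \<omega>"
    proof eventually_elim
      case (elim n)
      define t where "t = real n powr (1 / 3)"
      let ?x = "\<lambda>i. (1 - K / t) * w n i" and ?y = "\<lambda>i. (1 + \<epsilon> n) * w n i"
      let ?S1 = "\<Sum>i=1..n. w n i"
      let ?g = "\<lambda>E. if \<forall>i\<in>{1..n}. real (card (reach E {i})) < t\<^sup>2 / \<omega> then 1 else (0::real)"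
      have t: "0 < t"
        using elim(3) by (simp add: t_def)
      have "0 < m * real n"
        using m_pos elim(3) by simp
      then have S1: "0 < ?S1"
        using elim(2) by linarith
      have K_le: "K / t \<le> 1 / 2"
        using elim(1) by (simp add: t_def)
      have "\<bar>\<epsilon> n\<bar> \<le> \<Lambda> / t"
        unfolding t_def by (rule perturbation_le[OF \<epsilon> elim(3)])
      also have "\<dots> \<le> K / t"
        using K pos t by (intro divide_right_mono) auto
      finally have scale: "1 - K / t \<le> 1 + \<epsilon> n"
        by (simp add: abs_if split: if_splits)
      have scale_pos: "0 < 1 - K / t" "0 < 1 + \<epsilon> n"
        using scale K_le by linarith+
      \<comment> \<open>Scaling all weights by \<open>c\<close> multiplies the exponent by
        \<open>c\<close> rather than \<open>c\<^sup>2\<close>, because the total weight scales as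
        well.\<close>
      have prob: "nr_prob {1..n} (\<lambda>i. c * w n i) e = 1 - exp (- (c * (w n (fst e) * w n (snd e) / ?S1)))"
        if "0 < c" for c e
        using that S1 by (simp add: nr_prob_def sum_distrib_left[symmetric])
      \<comment> \<open>The negated indicator is increasing, as monotonicity in the edge
        probabilities requires.\<close>
      have "nr_expectation {1..n} ?x (\<lambda>E. - ?g E) \<le> nr_expectation {1..n} ?y (\<lambda>E. - ?g E)"
      proof (rule subset_expectation_mono_prob)
        fix e assume "e \<in> pairs {1..n}"
        then have "0 \<le> w n (fst e) * w n (snd e) / ?S1"
          using weights_nonneg S1 by (auto simp: pairs_def)
        from mult_right_mono[OF scale this] mult_nonneg_nonneg[OF _ this, of "1 - K / t"]
        show "0 \<le> nr_prob {1..n} ?x e \<and> nr_prob {1..n} ?x e \<le> nr_prob {1..n} ?y e \<and>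
            nr_prob {1..n} ?y e \<le> 1"
          using scale_pos unfolding prob[OF scale_pos(1)] prob[OF scale_pos(2)] by auto
      next
        fix X Y assume XY: "X \<subseteq> Y" "Y \<subseteq> pairs {1..n}"
        have le: "real (card (reach X {i})) \<le> real (card (reach Y {i}))" if "i \<in> {1..n}" for i
        proof -
          have "reach Y {i} \<subseteq> {1..n}"
            using that by (intro reach_subset[OF XY(2)]) auto
          then have "finite (reach Y {i})"
            using finite_subset by blast
          then show ?thesis
            using XY(1) by (simp add: card_mono reach_mono)
        qed
        have "\<forall>i\<in>{1..n}. real (card (reach X {i})) < t\<^sup>2 / \<omega>"
          if "\<forall>i\<in>{1..n}. real (card (reach Y {i})) < t\<^sup>2 / \<omega>"
          using le that le_less_trans by blast
        then show "- ?g X \<le> - ?g Y"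
          by (cases "\<forall>i\<in>{1..n}. real (card (reach Y {i})) < t\<^sup>2 / \<omega>") (simp_all only: if_True, simp_all)
      qed simp
      then have "nr_expectation {1..n} ?y ?g \<le> nr_expectation {1..n} ?x ?g"
        by (simp only: subset_expectation_minus neg_le_iff_le)
      also have "\<dots> \<le> b / \<omega>"
        using elim(1) K2 K3 by (simp add: t_def)
      finally show ?case
        by (simp add: t_def)
    qed
  qed
qed

section \<open>From expectations over edge sets to probabilities of the random graph\<close>

lemma prob_norros_reittu:
  assumes "nr_graph {1..n} x"
  shows "measure_pmf.prob (norros_reittu n x) {E. P E} =
    nr_expectation {1..n} x (\<lambda>E. if P E then 1 else 0)"
proof -
  interpret nr_graph "{1..n}" x
    by fact
  have pmf_eq: "(\<lambda>(i, j). bernoulli_pmf (1 - exp (- (x i * x j / total_weight n x)))) =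
      (\<lambda>e. bernoulli_pmf (nr_prob {1..n} x e))"
    by (auto simp: nr_prob_def total_weight_def)
  have "measure_pmf.prob (norros_reittu n x) {E. P E} =
      measure_pmf.expectation (norros_reittu n x) (\<lambda>E. if P E then 1 else 0)"
    by (subst Bochner_Integration.integral_cong[of _ _ _ "indicator {E. P E}"])
      (auto simp: indicator_def)
  also have "\<dots> = measure_pmf.expectation
      (Pi_pmf (pairs {1..n}) False (\<lambda>e. bernoulli_pmf (nr_prob {1..n} x e)))
      (\<lambda>f. (\<lambda>E. if P E then 1 else 0) {e \<in> pairs {1..n}. f e})"
    by (simp add: norros_reittu_def vertex_pairs_eq pmf_eq)
  also have "\<dots> = nr_expectation {1..n} x (\<lambda>E. if P E then 1 else 0)"
    by (rule expectation_Pi_bernoulli) (use nr_prob_bounds in auto)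
  finally show ?thesis .
qed

theorem largest_cluster_order:
  assumes "0 < \<Lambda>"
  shows "\<exists>b>0. \<forall>\<epsilon> :: nat \<Rightarrow> real. (\<forall>n\<ge>1. \<bar>\<epsilon> n\<bar> \<le> \<Lambda> * real n powr (- 1 / 3)) \<longrightarrow>
    (\<forall>\<omega>>1. \<forall>\<^sub>F n in sequentially.
      measure_pmf.prob (norros_reittu n (\<lambda>j. (1 + \<epsilon> n) * w n j))
        {E. real n powr (2 / 3) / \<omega> \<le> real (max_cluster_size n E) \<and>
            real (max_cluster_size n E) \<le> \<omega> * real n powr (2 / 3)}
      \<ge> 1 - b / \<omega>)"
proof -
  obtain b\<^sub>1 where b1: "0 < b\<^sub>1"
    and upper: "\<And>\<epsilon> \<omega>. \<forall>n\<ge>1. \<bar>\<epsilon> n\<bar> \<le> \<Lambda> * real n powr (- 1 / 3) \<Longrightarrow> 1 < \<omega> \<Longrightarrow> \<forall>\<^sub>F n in sequentially.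
      nr_expectation {1..n} (\<lambda>i. (1 + \<epsilon> n) * w n i)
        (\<lambda>E. if \<exists>i\<in>{1..n}. \<omega> * (real n powr (1 / 3))\<^sup>2 < real (card (reach E {i})) then 1 else 0)
      \<le> b\<^sub>1 / \<omega>"
    using largest_cluster_upper[OF assms] by blast
  obtain b\<^sub>2 where b2: "0 < b\<^sub>2"
    and lower: "\<And>\<epsilon> \<omega>. \<forall>n\<ge>1. \<bar>\<epsilon> n\<bar> \<le> \<Lambda> * real n powr (- 1 / 3) \<Longrightarrow> b\<^sub>2 \<le> \<omega> \<Longrightarrow> \<forall>\<^sub>F n in sequentially.
      nr_expectation {1..n} (\<lambda>i. (1 + \<epsilon> n) * w n i)
        (\<lambda>E. if \<forall>i\<in>{1..n}. real (card (reach E {i})) < (real n powr (1 / 3))\<^sup>2 / \<omega> then 1 else 0)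
      \<le> b\<^sub>2 / \<omega>"
    using largest_cluster_lower[OF assms] by blast
  show ?thesis
  proof (intro exI[of _ "b\<^sub>1 + b\<^sub>2"] conjI allI impI)
    show "0 < b\<^sub>1 + b\<^sub>2"
      using b1 b2 by simp
  next
    fix \<epsilon> :: "nat \<Rightarrow> real" and \<omega> :: real
    assume \<epsilon>: "\<forall>n\<ge>1. \<bar>\<epsilon> n\<bar> \<le> \<Lambda> * real n powr (- 1 / 3)" and \<omega>: "1 < \<omega>"
    let ?good = "\<lambda>n E. real n powr (2 / 3) / \<omega> \<le> real (max_cluster_size n E) \<and>
      real (max_cluster_size n E) \<le> \<omega> * real n powr (2 / 3)"
    show "\<forall>\<^sub>F n in sequentially.
      1 - (b\<^sub>1 + b\<^sub>2) / \<omega> \<le>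
        measure_pmf.prob (norros_reittu n (\<lambda>j. (1 + \<epsilon> n) * w n j)) {E. ?good n E}"
    proof (cases "b\<^sub>2 \<le> \<omega>")
      \<comment> \<open>For \<open>\<omega> < b\<^sub>2\<close> the claimed bound is at most
        \<open>0\<close>; this covers the range left open by the lower estimate.\<close>
      case False
      then have "1 \<le> (b\<^sub>1 + b\<^sub>2) / \<omega>"
        using \<omega> b1 by (simp add: field_simps)
      then show ?thesis
        by (intro always_eventually allI order_trans[OF _ measure_nonneg]) simp
    next
      case True
      from upper[OF \<epsilon> \<omega>] lower[OF \<epsilon> True] power_sum_bounds eventually_ge_at_top[of 1]
        cube_root_eventually_ge[of "2 * \<Lambda>"]
      show ?thesis
      proof eventually_elim
        case (elim n)
        define t where "t = real n powr (1 / 3)"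
        let ?x = "\<lambda>i. (1 + \<epsilon> n) * w n i"
        have t: "0 < t" "2 * \<Lambda> \<le> t"
          using elim(4,5) by (auto simp: t_def)
        have t2: "real n powr (2 / 3) = t\<^sup>2"
          using elim(4) by (simp add: t_def powr_realpow[symmetric] powr_powr)
        have "\<bar>\<epsilon> n\<bar> \<le> \<Lambda> / t"
          unfolding t_def by (rule perturbation_le[OF \<epsilon> elim(4)])
        also have "\<dots> \<le> 1 / 2"
          using t by (simp add: field_simps)
        finally have a: "0 < 1 + \<epsilon> n"
          by (simp add: abs_if split: if_splits)
        have "0 < m * real n"
          using m_pos elim(4) by simp
        then have "0 < (\<Sum>i=1..n. w n i)"
          using elim(3) by linarith
        then have graph: "nr_graph {1..n} ?x"
          using a weights_nonneg by unfold_locales (auto simp: sum_distrib_left[symmetric])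
        interpret nr_graph "{1..n}" ?x
          by (rule graph)
        let ?b1 = "\<lambda>E. if \<exists>i\<in>{1..n}. \<omega> * t\<^sup>2 < real (card (reach E {i})) then 1 else (0::real)"
        let ?b2 = "\<lambda>E. if \<forall>i\<in>{1..n}. real (card (reach E {i})) < t\<^sup>2 / \<omega> then 1 else (0::real)"
        have "1 - (b\<^sub>1 + b\<^sub>2) / \<omega> \<le> 1 - nr_expectation {1..n} ?x ?b1 - nr_expectation {1..n} ?x ?b2"
          using elim(1,2) by (simp add: t_def add_divide_distrib)
        also have "\<dots> = nr_expectation {1..n} ?x (\<lambda>E. 1 - ?b1 E - ?b2 E)"
          by (simp only: subset_expectation_diff mean_const)
        \<comment> \<open>The union bound, verified pointwise: an edge set in neither bad event is
          good.\<close>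
        also have "\<dots> \<le> nr_expectation {1..n} ?x (\<lambda>E. if ?good n E then 1 else 0)"
        proof (rule mean_mono)
          fix E assume E: "E \<subseteq> pairs {1..n}"
          have clusters: "(\<lambda>v. card (cluster n E v)) ` {1..n} = (\<lambda>v. card (reach E {v})) ` {1..n}"
            using cluster_eq_reach[of E n] E by (intro image_cong refl) (simp add: vertex_pairs_eq)
          have ne: "(\<lambda>v. card (reach E {v})) ` {1..n} \<noteq> {}"
            using elim(4) by simp
          have "t\<^sup>2 / \<omega> \<le> real (max_cluster_size n E)"
            if "i \<in> {1..n}" "t\<^sup>2 / \<omega> \<le> real (card (reach E {i}))" for i
          proof -
            have "card (reach E {i}) \<le> max_cluster_size n E"
              unfolding max_cluster_size_def clusters using that by (intro Max_ge) auto
            with that show ?thesis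
              by linarith
          qed
          moreover have "real (max_cluster_size n E) \<le> \<omega> * t\<^sup>2"
            if "\<forall>i\<in>{1..n}. real (card (reach E {i})) \<le> \<omega> * t\<^sup>2"
          proof -
            have "max_cluster_size n E \<in> (\<lambda>v. card (reach E {v})) ` {1..n}"
              unfolding max_cluster_size_def clusters using ne by (intro Max_in) auto
            with that show ?thesis
              by auto
          qed
          ultimately show "1 - ?b1 E - ?b2 E \<le> (if ?good n E then 1 else 0)"
            unfolding t2 by (auto simp: not_less)
        qed
        also have "\<dots> = measure_pmf.prob (norros_reittu n ?x) {E. ?good n E}"
          by (rule prob_norros_reittu[OF graph, symmetric])
        finally show ?case .
      qed
    qed
  qed
qed

end

section \<open>Power sums of the quantile weights\<close>

text \<open>The integrand is unbounded at \<open>1\<close>, but its antiderivative \<open>F\<close>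
  is continuous there, and the fundamental theorem for non-negative integrands yields integrability
  along with the value. The exponent \<open>- 2 / 3\<close> is the envelope for the quantile
  function and its square.\<close>

lemma tail_integral:
  fixes \<delta> :: real
  assumes "0 < \<delta>"
  shows "set_integrable lborel {1 - \<delta><..<1} (\<lambda>u. (1 - u) powr (- 2 / 3))"
    and "(LINT u:{1 - \<delta><..<1}|lborel. (1 - u) powr (- 2 / 3)) = 3 * \<delta> powr (1 / 3)"
proof -
  define F where "F = (\<lambda>u::real. - 3 * (1 - u) powr (1 / 3))"
  have lt: "ereal (1 - \<delta>) < ereal 1"
    using assms by simp
  have deriv: "DERIV F u :> (1 - u) powr (- 2 / 3)" if "u < 1" for u
    using that unfolding F_def by (auto intro!: derivative_eq_intros)
  have cont: "isCont (\<lambda>u. (1 - u) powr (- 2 / 3)) u" if "u < 1" for u :: real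
    using that by (intro continuous_intros) auto
  have lim_left: "((F \<circ> real_of_ereal) \<longlongrightarrow> - 3 * \<delta> powr (1 / 3)) (at_right (ereal (1 - \<delta>)))"
  proof -
    have "isCont F (1 - \<delta>)"
      using deriv[of "1 - \<delta>"] assms by (intro DERIV_isCont) auto
    then have "(F \<longlongrightarrow> - 3 * \<delta> powr (1 / 3)) (at_right (1 - \<delta>))"
      unfolding isCont_def F_def by (auto intro: filterlim_mono at_le)
    then show ?thesis
      by (simp add: ereal_tendsto_simps)
  qed
  have lim_right: "((F \<circ> real_of_ereal) \<longlongrightarrow> 0) (at_left (ereal 1))"
  proof -
    have "continuous_on {..1} F"
      unfolding F_def by (intro continuous_intros continuous_on_powr') auto
    then have "(F \<longlongrightarrow> F 1) (at 1 within {..1})"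
      by (simp add: continuous_on_def)
    then have "(F \<longlongrightarrow> 0) (at_left 1)"
      by (rule filterlim_mono) (auto simp: F_def intro: at_le)
    then show ?thesis
      by (simp add: ereal_tendsto_simps)
  qed
  have nonneg: "AE u in lborel. ereal (1 - \<delta>) < ereal u \<longrightarrow> ereal u < ereal 1 \<longrightarrow> 0 \<le> (1 - u) powr (- 2 / 3)"
    by simp
  note FTC = interval_integral_FTC_nonneg[OF lt _ _ nonneg lim_left lim_right]
  have eint: "einterval (ereal (1 - \<delta>)) (ereal 1) = {1 - \<delta><..<1}"
    by (auto simp: einterval_def)
  show "set_integrable lborel {1 - \<delta><..<1} (\<lambda>u. (1 - u) powr (- 2 / 3))"
    using FTC(1) deriv cont unfolding eint by simp
  have "(LBINT u=ereal (1 - \<delta>)..ereal 1. (1 - u) powr (- 2 / 3)) = 3 * \<delta> powr (1 / 3)"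
    using FTC(2) deriv cont by simp
  then show "(LINT u:{1 - \<delta><..<1}|lborel. (1 - u) powr (- 2 / 3)) = 3 * \<delta> powr (1 / 3)"
    unfolding interval_lebesgue_integral_def eint using assms by simp
qed

text \<open>For increasing \<open>g\<close> the sum divided by \<open>n\<close> is an upper Riemann
  sum on \<open>(0, 1 - 1 / n]\<close> and a lower one on \<open>[1 / n, 1)\<close>. The error
  therefore comes from the last cell, where the tail bound gives at most
  \<open>3 * c * n powr (- 1 / 3)\<close>.\<close>

lemma monotone_sum_integral:
  fixes g :: "real \<Rightarrow> real"
  assumes int: "set_integrable lborel {0<..<1} g"
    and mono: "mono_on {0<..<1} g"
    and nonneg: "\<And>u. u \<in> {0<..<1} \<Longrightarrow> 0 \<le> g u"
    and tail: "\<And>u. u \<in> {0<..<1} \<Longrightarrow> g u \<le> c * (1 - u) powr (- 2 / 3)"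
    and n: "1 \<le> n"
  shows "\<bar>(\<Sum>i=1..<n. g (real i / real n)) - real n * (LINT u:{0<..<1}|lborel. g u)\<bar>
    \<le> 3 * c * (real n powr (1 / 3))\<^sup>2"
proof -
  define J where "J = (\<lambda>A. LINT u:A|lborel. g u)"
  have int': "set_integrable lborel A g" if "A \<in> sets lborel" "A \<subseteq> {0<..<1}" for A
    by (rule set_integrable_subset[OF int that])
  have const: "(LINT u:A|lborel. (k::real)) = k * measure lborel A"
    "set_integrable lborel A (\<lambda>_. k)" if "A \<in> sets lborel" "emeasure lborel A \<noteq> \<infinity>" for A k
    using that by (auto simp: set_integral_const set_integrable_def less_top[symmetric]
        intro!: integrable_scaleR_left)
  have n0: "0 < real n"
    using n by simp
  have J_nonneg: "0 \<le> J A" if "A \<subseteq> {0<..<1}" for A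
    unfolding J_def set_lebesgue_integral_def
    using that nonneg by (intro Bochner_Integration.integral_nonneg) (auto simp: indicator_def)
  have lower: "J {0<..real N / real n} \<le> (\<Sum>i=1..N. g (real i / real n)) / real n" if "N < n" for N
    using that
  proof (induction N)
    case 0
    then show ?case
      by (simp add: J_def set_lebesgue_integral_def)
  next
    case (Suc N)
    define a b where "a = real N / real n" and "b = real (Suc N) / real n"
    have ab: "0 \<le> a" "a < b" "b < 1" "b - a = 1 / real n"
      using Suc.prems n0 by (auto simp: a_def b_def field_simps)
    have "{0<..b} = {0<..a} \<union> {a<..b}"
      using ab by auto
    then have "J {0<..b} = J {0<..a} + J {a<..b}"
      unfolding J_def using ab by (auto intro!: set_integral_Un int')
    also have "J {a<..b} \<le> (LINT u:{a<..b}|lborel. g b)"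
      unfolding J_def
    proof (rule set_integral_mono)
      fix u assume "u \<in> {a<..b}"
      then show "g u \<le> g b"
        using ab by (intro mono_onD[OF mono]) auto
    qed (use ab in \<open>auto intro!: int' const\<close>)
    also have "\<dots> = g b / real n"
      using ab by (subst const) auto
    finally show ?case
      using Suc by (simp add: add_divide_distrib a_def b_def)
  qed
  \<comment> \<open>Left endpoints leave the cell \<open>(0, 1 / n)\<close> uncovered; the base case
    settles it by non-negativity of the integral.\<close>
  have upper: "(\<Sum>i=1..N. g (real i / real n)) / real n \<le> J {0<..<real (Suc N) / real n}" if "N < n" for N
    using that
  proof (induction N)
    case 0
    have "real (Suc 0) / real n \<le> 1"
      using n by simp
    then have "{0<..<real (Suc 0) / real n} \<subseteq> {0<..<1}"
      by (auto simp only: greaterThanLessThan_iff intro: less_le_trans)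
    then show ?case
      using J_nonneg by simp
  next
    case (Suc N)
    define a b where "a = real (Suc N) / real n" and "b = real (Suc (Suc N)) / real n"
    have ab: "0 < a" "a < b" "b \<le> 1" "b - a = 1 / real n"
      using Suc.prems n0 by (auto simp: a_def b_def field_simps)
    have "(\<Sum>i=1..Suc N. g (real i / real n)) / real n =
        (\<Sum>i=1..N. g (real i / real n)) / real n + g a / real n"
      by (simp add: add_divide_distrib a_def)
    also have "\<dots> \<le> J {0<..<a} + J {a..<b}"
    proof (rule add_mono)
      show "(\<Sum>i=1..N. g (real i / real n)) / real n \<le> J {0<..<a}"
        using Suc by (simp add: a_def)
      have "g a / real n = (LINT u:{a..<b}|lborel. g a)"
        using ab by (subst const) auto
      also have "\<dots> \<le> J {a..<b}"
        unfolding J_def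
      proof (rule set_integral_mono)
        fix u assume "u \<in> {a..<b}"
        then show "g a \<le> g u"
          using ab by (intro mono_onD[OF mono]) auto
      qed (use ab in \<open>auto intro!: int' const\<close>)
      finally show "g a / real n \<le> J {a..<b}" .
    qed
    also have "\<dots> = J ({0<..<a} \<union> {a..<b})"
      unfolding J_def using ab by (intro set_integral_Un[symmetric] int') auto
    also have "{0<..<a} \<union> {a..<b} = {0<..<b}"
      using ab by auto
    finally show ?case
      by (simp only: b_def)
  qed
  obtain N where N: "n = Suc N"
    using n by (cases n) auto
  have range: "{1..<n} = {1..N}"
    using N by auto
  have S_le: "(\<Sum>i=1..<n. g (real i / real n)) \<le> real n * J {0<..<1}"
    using upper[of N] N n0 unfolding range by (simp add: field_simps)
  define a where "a = real N / real n"
  have a_eq: "a = 1 - 1 / real n" and a_bounds: "0 \<le> a" "a < 1"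
    using N by (auto simp: a_def field_simps)
  have "J {0<..<1} = J ({0<..a} \<union> {a<..<1})"
    using a_bounds by (intro arg_cong[where f = J]) auto
  also have "\<dots> = J {0<..a} + J {a<..<1}"
    unfolding J_def using a_bounds by (intro set_integral_Un int') auto
  also have "J {a<..<1} \<le> (LINT u:{a<..<1}|lborel. c * (1 - u) powr (- 2 / 3))"
    unfolding J_def
  proof (rule set_integral_mono)
    show "set_integrable lborel {a<..<1} (\<lambda>u. c * (1 - u) powr (- 2 / 3))"
      using tail_integral(1)[of "1 / real n"] n0 unfolding a_eq by simp
    show "g u \<le> c * (1 - u) powr (- 2 / 3)" if "u \<in> {a<..<1}" for u
      using that a_bounds by (intro tail) auto
  qed (use a_bounds in \<open>auto intro!: int'\<close>)
  also have "\<dots> = c * (3 * (1 / real n) powr (1 / 3))"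
    using tail_integral(2)[of "1 / real n"] n0 unfolding a_eq by simp
  also have "J {0<..a} \<le> (\<Sum>i=1..<n. g (real i / real n)) / real n"
    using lower[of N] N unfolding range a_def by simp
  finally have "real n * J {0<..<1} \<le> real n *
      ((\<Sum>i=1..<n. g (real i / real n)) / real n + c * (3 * (1 / real n) powr (1 / 3)))"
    using n0 by (intro mult_left_mono) auto
  also have "\<dots> = (\<Sum>i=1..<n. g (real i / real n)) + 3 * c * (real n * (1 / real n) powr (1 / 3))"
    using n0 by (simp add: algebra_simps)
  also have "real n * (1 / real n) powr (1 / 3) = (real n powr (1 / 3))\<^sup>2"
  proof -
    have "real n * (1 / real n) powr (1 / 3) = real n powr 1 * real n powr (- (1 / 3))"
      using n0 by (simp add: powr_divide powr_minus field_simps)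
    also have "\<dots> = real n powr (1 + - (1 / 3))"
      by (simp only: powr_add)
    also have "\<dots> = (real n powr (1 / 3))\<^sup>2"
      using n0 by (simp add: powr_realpow[symmetric] powr_powr)
    finally show ?thesis .
  qed
  finally have ge: "real n * J {0<..<1} \<le>
      (\<Sum>i=1..<n. g (real i / real n)) + 3 * c * (real n powr (1 / 3))\<^sup>2" .
  then show ?thesis
    using S_le unfolding J_def by linarith
qed

text \<open>Comparison with the integral of a power, one cell at a time by the mean value theorem.
  It is applied to cubed weights, with \<open>q = 3 * p\<close>.\<close>

lemma sum_powr_le:
  fixes q :: real
  assumes "0 \<le> q" "q < 1"
  shows "(\<Sum>j=1..n. real j powr (- q)) \<le> real n powr (1 - q) / (1 - q)"
proof (induction n)
  case (Suc n)
  have "real (Suc n) powr (- q) \<le> (real (Suc n) powr (1 - q) - real n powr (1 - q)) / (1 - q)"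
  proof (cases "n = 0")
    case True
    then show ?thesis
      using assms by simp
  next
    case False
    have "\<exists>z. real n < z \<and> z < real (Suc n) \<and> real (Suc n) powr (1 - q) - real n powr (1 - q) =
        (real (Suc n) - real n) * ((1 - q) * z powr (- q))"
      using False by (intro MVT2) (auto intro!: derivative_eq_intros)
    then obtain z where z: "real n < z" "z < real (Suc n)"
      "real (Suc n) powr (1 - q) - real n powr (1 - q) = (1 - q) * z powr (- q)"
      by auto
    have "real (Suc n) powr (- q) \<le> z powr (- q)"
      using z assms False by (intro powr_mono2') auto
    then show ?thesis
      using z(3) assms by simp
  qed
  with Suc show ?case
    by (simp add: diff_divide_distrib)
qed simp

text \<open>The weights are values of the quantile function \<open>Q\<close> at
  \<open>1 - j / n\<close>, so their first two power sums are Riemann sums for moments of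
  \<open>W\<close>. The tail assumption becomes \<open>Q u \<le> k * (1 - u) powr (- p)\<close> with
  \<open>p = 1 / (\<tau> - 1)\<close>, and \<tau> > 4 means \<open>p < 1 / 3\<close>: then
  \<open>2 * p < 2 / 3\<close> bounds the Riemann error of the squares, \<open>3 * p < 1\<close> the
  sum of cubes, and \<open>n powr p\<close> is of smaller order than
  \<open>n powr (1 / 3)\<close>.\<close>

lemma quantile_weights_critical:
  fixes M :: "'a measure" and W :: "'a \<Rightarrow> real" and F :: "real \<Rightarrow> real"
  assumes "prob_space M"
    and W: "W \<in> borel_measurable M" "AE x in M. 0 \<le> W x"
    and F: "F = cdf (distr M borel W)"
    and ratio: "prob_space.expectation M (\<lambda>x. (W x)\<^sup>2) / prob_space.expectation M W = 1"
    and \<tau>: "\<tau> > 4" and c: "c > 0"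
    and tail: "\<forall>\<^sub>F x in at_top. 1 - F x \<le> c * x powr (- (\<tau> - 1))"
  shows "\<exists>m C. critical_weights (weight F) m C"
proof -
  interpret M: prob_space M
    by fact
  have "real_distribution (distr M borel W)"
    using W by simp
  then interpret D: cdf_distribution "distr M borel W"
    by (simp add: cdf_distribution_def)
  define p where "p = 1 / (\<tau> - 1)"
  have p: "0 < p" "p < 1 / 3"
    using \<tau> by (auto simp: p_def field_simps)
  define m where "m = M.expectation W"
  have m_ne: "m \<noteq> 0" and m2: "M.expectation (\<lambda>x. (W x)\<^sup>2) = m"
    using ratio by (auto simp: m_def)
  \<comment> \<open>A non-integrable function has integral \<open>0\<close>, and division by
    \<open>0\<close> gives \<open>0\<close>; the ratio \<open>1\<close> thus forces both integrals
    to be non-zero and hence both functions to be integrable.\<close>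
  have int: "integrable M W" "integrable M (\<lambda>x. (W x)\<^sup>2)"
    using m_ne m2 not_integrable_integral_eq unfolding m_def by metis+
  have m_pos: "0 < m"
    using m_ne integral_nonneg_AE[OF W(2)] by (simp add: m_def)
  \<comment> \<open>The pseudo-inverse of the distribution function. It maps Lebesgue measure on
    \<open>(0, 1)\<close> to the law of \<open>W\<close>, which is how integrals are transferred
    below.\<close>
  define Q where "Q = D.I"
  have Q_le: "Q u \<le> s \<longleftrightarrow> u \<le> F s" if "u \<in> {0<..<1}" for u s
    using D.pseudoinverse[of u s] that by (simp add: Q_def F)
  have Q_mono: "mono_on {0<..<1} Q"
    using D.mono_I by (simp add: Q_def)
  have Q_nonneg: "0 \<le> Q u" if u: "u \<in> {0<..<1}" for u
  proof (rule ccontr)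
    assume neg: "\<not> 0 \<le> Q u"
    have "F (Q u) = measure M {x \<in> space M. W x \<le> Q u}"
      using W by (simp add: F cdf_def measure_distr vimage_def Int_def conj_commute)
    also have "\<dots> = 0"
    proof -
      have "AE x in M. \<not> W x \<le> Q u"
        using W(2) by eventually_elim (use neg in auto)
      then show ?thesis
        using W(1) by (subst M.prob_eq_0) auto
    qed
    finally show False
      using Q_le[OF u, of "Q u"] u by simp
  qed
  obtain x\<^sub>0 where x0: "\<And>x. x\<^sub>0 \<le> x \<Longrightarrow> 1 - F x \<le> c * x powr (- (\<tau> - 1))"
    using tail unfolding eventually_at_top_linorder by blast
  define k where "k = \<bar>x\<^sub>0\<bar> + c powr p"
  have k_pos: "0 < k"
    using c by (simp add: k_def add_nonneg_pos)
  have Q_tail: "Q u \<le> k * (1 - u) powr (- p)" if u: "u \<in> {0<..<1}" for u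
  proof -
    let ?v = "1 - u"
    \<comment> \<open>The second summand makes the tail bound equal to \<open>?v\<close>; adding
      \<open>\<bar>x\<^sub>0\<bar>\<close> keeps \<open>?s\<close> in the range where that bound is
      available.\<close>
    let ?s = "\<bar>x\<^sub>0\<bar> + (c / ?v) powr p"
    have v: "0 < ?v" "?v \<le> 1"
      using u by auto
    have pos: "0 < (c / ?v) powr p"
      using c v by simp
    have "1 - F ?s \<le> c * ?s powr (- (\<tau> - 1))"
      by (rule x0) (use pos in linarith)
    also have "\<dots> \<le> c * ((c / ?v) powr p) powr (- (\<tau> - 1))"
      using c pos \<tau> by (intro mult_left_mono powr_mono2') auto
    also have "\<dots> = c * (c / ?v) powr (- 1)"
    proof -
      have "p * - (\<tau> - 1) = - 1"
        using \<tau> by (simp add: p_def divide_simps)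
      then show ?thesis
        by (simp only: powr_powr)
    qed
    also have "\<dots> = ?v"
      using c v by (simp add: powr_minus)
    finally have "Q u \<le> ?s"
      using Q_le[OF u] by simp
    also have "\<dots> \<le> \<bar>x\<^sub>0\<bar> * ?v powr (- p) + c powr p * ?v powr (- p)"
    proof (rule add_mono)
      have "1 \<le> ?v powr (- p)"
        using v p by (simp add: powr_minus powr_le1 one_le_inverse_iff)
      then show "\<bar>x\<^sub>0\<bar> \<le> \<bar>x\<^sub>0\<bar> * ?v powr (- p)"
        by (simp add: mult_le_cancel_left1)
      show "(c / ?v) powr p \<le> c powr p * ?v powr (- p)"
        using c v by (simp add: powr_divide powr_minus field_simps)
    qed
    finally show ?thesis
      by (simp add: k_def algebra_simps)
  qed
  have powr_tail: "(1 - u) powr (- r) \<le> (1 - u) powr (- 2 / 3)" if "u \<in> {0<..<1}" "r \<le> 2 / 3" for u r :: real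
    using that by (intro powr_mono') auto
  \<comment> \<open>At \<open>j = n\<close> the argument of \<open>tail_inverse\<close> is
    \<open>1\<close>, where the convention gives \<open>0\<close>. The power sums therefore run over
    \<open>1 \<le> i < n\<close> once \<open>j\<close> is replaced by \<open>n - j\<close>.\<close>
  have weight_eq: "weight F n j = (if j = n then 0 else Q (real (n - j) / real n))"
    if "j \<in> {1..n}" for n j
  proof -
    have "1 - real j / real n = real (n - j) / real n"
      using that by (simp add: of_nat_diff field_simps)
    moreover have "1 - F s \<le> real j / real n \<longleftrightarrow> 1 - real j / real n \<le> F s" for s
      by linarith
    ultimately show ?thesis
      using that by (simp add: weight_def tail_inverse_def Q_def F)
  qed
  have ratio_mem: "real i / real n \<in> {0<..<1}" if "i \<in> {1..<n}" for i n
    using that by (simp add: field_simps)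
  have sum_eq: "(\<Sum>j=1..n. \<phi> (weight F n j)) = (\<Sum>i=1..<n. \<phi> (Q (real i / real n)))"
    if "1 \<le> n" "\<phi> 0 = 0" for \<phi> :: "real \<Rightarrow> real" and n
  proof -
    have "{1..n} = insert n {1..<n}"
      using that by auto
    then have "(\<Sum>j=1..n. \<phi> (weight F n j)) = (\<Sum>j=1..<n. \<phi> (weight F n j))"
      using that weight_eq[of n n] by simp
    also have "\<dots> = (\<Sum>j=1..<n. \<phi> (Q (real (n - j) / real n)))"
      by (intro sum.cong refl) (simp add: weight_eq)
    also have "\<dots> = (\<Sum>i=1..<n. \<phi> (Q (real i / real n)))"
      by (rule sum.reindex_bij_witness[of _ "\<lambda>i. n - i" "\<lambda>i. n - i"]) auto
    finally show ?thesis .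
  qed
  have transfer: "set_integrable lborel {0<..<1} (\<lambda>u. \<phi> (Q u))"
    "(LINT u:{0<..<1}|lborel. \<phi> (Q u)) = M.expectation (\<lambda>x. \<phi> (W x))"
    if \<phi>: "\<phi> \<in> borel_measurable borel" "integrable M (\<lambda>x. \<phi> (W x))" for \<phi> :: "real \<Rightarrow> real"
  proof -
    let ?R = "restrict_space lborel {0<..<1::real}"
    have Qm: "Q \<in> borel_measurable ?R"
      using D.measurable_CI by (simp add: Q_def cong: measurable_cong_sets)
    have distr_Q: "distr ?R borel Q = distr M borel W"
      using D.distr_I_eq_M by (simp add: Q_def)
    have "integrable (distr M borel W) \<phi>"
      using W(1) \<phi> by (simp add: integrable_distr_eq)
    then have "integrable ?R (\<lambda>u. \<phi> (Q u))"
      using Qm \<phi>(1) unfolding distr_Q[symmetric] by (simp add: integrable_distr_eq)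
    then show "set_integrable lborel {0<..<1} (\<lambda>u. \<phi> (Q u))"
      by (simp add: integrable_restrict_space set_integrable_def)
    have "(LINT u:{0<..<1}|lborel. \<phi> (Q u)) = integral\<^sup>L ?R (\<lambda>u. \<phi> (Q u))"
      by (simp add: integral_restrict_space set_lebesgue_integral_def)
    also have "\<dots> = integral\<^sup>L (distr ?R borel Q) \<phi>"
      using Qm \<phi>(1) by (simp add: integral_distr)
    also have "\<dots> = M.expectation (\<lambda>x. \<phi> (W x))"
      using W(1) \<phi>(1) unfolding distr_Q by (simp add: integral_distr)
    finally show "(LINT u:{0<..<1}|lborel. \<phi> (Q u)) = M.expectation (\<lambda>x. \<phi> (W x))" .
  qed
  have weight_le: "weight F n j \<le> k * (real n powr p * real j powr (- p))" if j: "j \<in> {1..n}" for n j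
  proof (cases "j = n")
    case True
    then show ?thesis
      using weight_eq[OF j] k_pos by simp
  next
    case False
    have mem: "real (n - j) / real n \<in> {0<..<1}"
      using j False by (intro ratio_mem) auto
    have "1 - real (n - j) / real n = real j / real n"
      using j by (simp add: of_nat_diff field_simps)
    then have "weight F n j \<le> k * (real j / real n) powr (- p)"
      using Q_tail[OF mem] weight_eq[OF j] False by simp
    also have "(real j / real n) powr (- p) = real n powr p * real j powr (- p)"
      using j by (simp add: powr_divide powr_minus field_simps)
    finally show ?thesis .
  qed
  have weight_nonneg: "0 \<le> weight F n j" if "j \<in> {1..n}" for n j
    using weight_eq[OF that] Q_nonneg[OF ratio_mem[of "n - j" n]] that by auto
  define C where "C = 3 * k + 3 * k\<^sup>2 + k ^ 3 / (1 - 3 * p)"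
  have C: "3 * k \<le> C" "3 * k\<^sup>2 \<le> C" "k ^ 3 / (1 - 3 * p) \<le> C"
    using k_pos p by (auto simp: C_def)
  have "critical_weights (weight F) m C"
  proof
    show "0 \<le> weight F n i" if "i \<in> {1..n}" for n i
      by (rule weight_nonneg[OF that])
    show "0 < m"
      by (rule m_pos)
    show "0 \<le> C"
      using C k_pos by linarith
    have "\<bar>(\<Sum>i=1..n. weight F n i) - m * real n\<bar> \<le> C * (real n powr (1 / 3))\<^sup>2" if n: "1 \<le> n" for n
    proof -
      have "\<bar>(\<Sum>i=1..<n. Q (real i / real n)) - real n * (LINT u:{0<..<1}|lborel. Q u)\<bar> \<le>
          3 * k * (real n powr (1 / 3))\<^sup>2"
      proof (rule monotone_sum_integral)
        show "set_integrable lborel {0<..<1} Q"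
          using transfer(1)[of "\<lambda>x. x"] int by simp
        fix u :: real assume u: "u \<in> {0<..<1}"
        have "k * (1 - u) powr (- p) \<le> k * (1 - u) powr (- 2 / 3)"
          using k_pos p u by (intro mult_left_mono powr_tail) auto
        with Q_tail[OF u] show "Q u \<le> k * (1 - u) powr (- 2 / 3)"
          by linarith
      qed (use Q_mono Q_nonneg n in auto)
      moreover have "3 * k * (real n powr (1 / 3))\<^sup>2 \<le> C * (real n powr (1 / 3))\<^sup>2"
        using C by (intro mult_right_mono) auto
      ultimately show ?thesis
        using sum_eq[OF n, of "\<lambda>x. x"] transfer(2)[of "\<lambda>x. x"] int by (simp add: m_def mult.commute)
    qed
    then show "\<forall>\<^sub>F n in sequentially.
        \<bar>(\<Sum>i=1..n. weight F n i) - m * real n\<bar> \<le> C * (real n powr (1 / 3))\<^sup>2"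
      by (intro eventually_sequentiallyI)
    have "\<bar>(\<Sum>i=1..n. (weight F n i)\<^sup>2) - m * real n\<bar> \<le> C * (real n powr (1 / 3))\<^sup>2" if n: "1 \<le> n" for n
    proof -
      have "\<bar>(\<Sum>i=1..<n. (Q (real i / real n))\<^sup>2) - real n * (LINT u:{0<..<1}|lborel. (Q u)\<^sup>2)\<bar> \<le>
          3 * k\<^sup>2 * (real n powr (1 / 3))\<^sup>2"
      proof (rule monotone_sum_integral)
        show "set_integrable lborel {0<..<1} (\<lambda>u. (Q u)\<^sup>2)"
          using transfer(1)[of "\<lambda>x. x\<^sup>2"] int by simp
        show "mono_on {0<..<1} (\<lambda>u. (Q u)\<^sup>2)"
          using Q_nonneg by (intro mono_onI power_mono mono_onD[OF Q_mono]) auto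
        fix u :: real assume u: "u \<in> {0<..<1}"
        have "(Q u)\<^sup>2 \<le> (k * (1 - u) powr (- p))\<^sup>2"
          using Q_tail[OF u] Q_nonneg[OF u] by (rule power_mono)
        also have "\<dots> = k\<^sup>2 * (1 - u) powr (- (2 * p))"
          using u by (simp add: power_mult_distrib powr_realpow[symmetric] powr_powr mult.commute)
        also have "\<dots> \<le> k\<^sup>2 * (1 - u) powr (- 2 / 3)"
          using p u by (intro mult_left_mono powr_tail) auto
        finally show "(Q u)\<^sup>2 \<le> k\<^sup>2 * (1 - u) powr (- 2 / 3)" .
      qed (use n in auto)
      moreover have "3 * k\<^sup>2 * (real n powr (1 / 3))\<^sup>2 \<le> C * (real n powr (1 / 3))\<^sup>2"
        using C by (intro mult_right_mono) auto
      ultimately show ?thesis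
        using sum_eq[OF n, of "\<lambda>x. x\<^sup>2"] transfer(2)[of "\<lambda>x. x\<^sup>2"] int m2 by (simp add: mult.commute)
    qed
    then show "\<forall>\<^sub>F n in sequentially.
        \<bar>(\<Sum>i=1..n. (weight F n i)\<^sup>2) - m * real n\<bar> \<le> C * (real n powr (1 / 3))\<^sup>2"
      by (intro eventually_sequentiallyI)
    have "(\<Sum>i=1..n. (weight F n i) ^ 3) \<le> C * real n" if n: "1 \<le> n" for n
    proof -
      have "(\<Sum>i=1..n. (weight F n i) ^ 3) \<le> (\<Sum>i=1..n. k ^ 3 * real n powr (3 * p) * real i powr (- (3 * p)))"
      proof (rule sum_mono)
        fix i assume i: "i \<in> {1..n}"
        have "(weight F n i) ^ 3 \<le> (k * (real n powr p * real i powr (- p))) ^ 3"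
          using weight_le[OF i] weight_nonneg[OF i] by (rule power_mono)
        also have "\<dots> = k ^ 3 * real n powr (3 * p) * real i powr (- (3 * p))"
          using i n by (simp add: power_mult_distrib powr_realpow[symmetric] powr_powr mult.commute)
        finally show "(weight F n i) ^ 3 \<le> k ^ 3 * real n powr (3 * p) * real i powr (- (3 * p))" .
      qed
      also have "\<dots> = k ^ 3 * real n powr (3 * p) * (\<Sum>i=1..n. real i powr (- (3 * p)))"
        by (simp add: sum_distrib_left)
      also have "\<dots> \<le> k ^ 3 * real n powr (3 * p) * (real n powr (1 - 3 * p) / (1 - 3 * p))"
        using k_pos p by (intro mult_left_mono sum_powr_le) auto
      also have "\<dots> = k ^ 3 / (1 - 3 * p) * (real n powr (3 * p) * real n powr (1 - 3 * p))"
        by simp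
      also have "\<dots> = k ^ 3 / (1 - 3 * p) * real n"
        using n by (simp add: powr_add[symmetric])
      also have "\<dots> \<le> C * real n"
        using C by (intro mult_right_mono) auto
      finally show ?thesis .
    qed
    then show "\<forall>\<^sub>F n in sequentially. (\<Sum>i=1..n. (weight F n i) ^ 3) \<le> C * real n"
      by (intro eventually_sequentiallyI)
    fix \<delta> :: real assume \<delta>: "0 < \<delta>"
    have "filterlim (\<lambda>n. real n powr (1 / 3 - p)) at_top sequentially"
      using p by real_asymp
    then have "\<forall>\<^sub>F n in sequentially. k / \<delta> \<le> real n powr (1 / 3 - p)"
      by (simp add: filterlim_at_top)
    then show "\<forall>\<^sub>F n in sequentially. \<forall>i\<in>{1..n}. weight F n i \<le> \<delta> * real n powr (1 / 3)"
    proof eventually_elim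
      case (elim n)
      show ?case
      proof
        fix i assume i: "i \<in> {1..n}"
        have "real i powr (- p) \<le> 1"
          using powr_mono2'[of "- p" 1 "real i"] i p by simp
        then have "k * (real n powr p * real i powr (- p)) \<le> k * (real n powr p * 1)"
          using k_pos by (intro mult_left_mono) auto
        with weight_le[OF i] have "weight F n i \<le> k * real n powr p"
          by simp
        also have "\<dots> \<le> \<delta> * real n powr (1 / 3 - p) * real n powr p"
          using elim \<delta> by (intro mult_right_mono) (auto simp: field_simps)
        also have "\<dots> = \<delta> * real n powr (1 / 3)"
          by (simp add: mult.assoc powr_add[symmetric])
        finally show "weight F n i \<le> \<delta> * real n powr (1 / 3)" .
      qed
    qed
  qed
  then show ?thesis
    by blast
qed

theorem theorem1p1:
  fixes M :: "'a measure" and W :: "'a \<Rightarrow> real" and F :: "real \<Rightarrow> real"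
    and \<tau> c\<^sub>F \<Lambda> :: real
  assumes "prob_space M"
    and "W \<in> borel_measurable M"
    and "AE x in M. 0 \<le> W x"
    and "F = cdf (distr M borel W)"
    and "prob_space.expectation M (\<lambda>x. (W x)\<^sup>2) / prob_space.expectation M W = 1"
    and "\<tau> > 4" and "c\<^sub>F > 0"
    and "\<forall>\<^sub>F x in at_top. 1 - F x \<le> c\<^sub>F * x powr (- (\<tau> - 1))"
    and "\<Lambda> > 0"
  shows "\<exists>b>0. \<forall>\<epsilon> :: nat \<Rightarrow> real.
    (\<forall>n\<ge>1. \<bar>\<epsilon> n\<bar> \<le> \<Lambda> * real n powr (- 1 / 3)) \<longrightarrow>
    (\<forall>\<omega>>1. \<forall>\<^sub>F n in sequentially.
      measure_pmf.prob (norros_reittu n (\<lambda>j. (1 + \<epsilon> n) * weight F n j))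
        {E. real n powr (2 / 3) / \<omega> \<le> real (max_cluster_size n E) \<and>
            real (max_cluster_size n E) \<le> \<omega> * real n powr (2 / 3)}
      \<ge> 1 - b / \<omega>)"
proof -
  obtain m C where "critical_weights (weight F) m C"
    using quantile_weights_critical[OF assms(1-8)] by blast
  then show ?thesis
    using \<open>\<Lambda> > 0\<close> by (rule critical_weights.largest_cluster_order)
qed

end
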